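(* Let $\mathcal{S}=(\mathcal{C}\times\mathcal{C})/(\Delta_{\mathcal{G}}\times\mathbb{Z}_2)$ be the pullback, to a general $(1,2,2)$-polarized abelian threefold $A$, of the Theta divisor of the Jacobian of a smooth plane quartic $\mathcal{D}$ under an isogeny $p$ with kernel $\mathcal{G}\cong(\mathbb{Z}/2)^2$, where $\mathcal{C}\subset\mathbb{P}^3$ is the genus $9$ curve described in the context. Under the identification $$H^0(\mathcal{S},\omega_{\mathcal{S}})=H^0(\mathcal{C}\times\mathcal{C},\omega_{\mathcal{C}}\boxtimes\omega_{\mathcal{C}})^{\Delta_{\mathcal{G}}\times\mathbb{Z}_2},$$ a basis of $H^0(\mathcal{S},\omega_{\mathcal{S}})$ is given by the restrictions to $\mathcal{C}\times\mathcal{C}$ of the following six bihomogeneous polynomials of bidegree $(2,2)$ on $\mathbb{P}^3\times\mathbb{P}^3$, with coordinates $[X_0,Y_0,Z_0,T_0]$ and $[X_1,Y_1,Z_1,T_1]$ on the two factors: $$\eta_{12}=\begin{vmatrix} X_0^2 & X_1^2 \\ Y_0^2 & Y_1^2 \end{vmatrix},\quad \eta_{13}=\begin{vmatrix} X_0^2 & X_1^2 \\ Z_0^2 & Z_1^2 \end{vmatrix},\quad \eta_{23}=\begin{vmatrix} Y_0^2 & Y_1^2 \\ Z_0^2 & Z_1^2 \end{vmatrix},$$ $$\omega_{45}=\begin{vmatrix} X_0Y_0 & X_1Y_1 \\ Z_0T_0 & Z_1T_1 \end{vmatrix},\quad \omega_{67}=\begin{vmatrix} X_0Z_0 & X_1Z_1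 \\ Y_0T_0 & Y_1T_1 \end{vmatrix},\quad \omega_{89}=\begin{vmatrix} X_0T_0 & X_1T_1 \\ Y_0Z_0 & Y_1Z_1 \end{vmatrix}.$$
   Context: Everything is over $\mathbb{C}$. Setting. $(A,\mathcal{L})$ is a general $(1,2,2)$-polarized abelian threefold; $p\colon A\to\mathcal{J}$ is an isogeny onto a principally polarized abelian threefold $(\mathcal{J},\Theta)$ with kernel $\mathcal{G}\cong(\mathbb{Z}/2)^2$; by generality $\mathcal{J}$ is the Jacobian of a smooth (non-hyperelliptic) plane quartic $\mathcal{D}$. $\mathcal{C}\subset A$ is the pullback under $p$ of the Abel--Jacobi embedded curve $\mathcal{D}\subset\mathcal{J}$; it is a smooth curve of genus $9$ with free $\mathcal{G}$-action. There are coordinates $[X,Y,Z,T]$ on $\mathbb{P}^3$ and generators $a,b$ of $\mathcal{G}$ such that $\mathcal{C}$ is embedded in $\mathbb{P}^3$ as the complete intersection $X^2+Y^2+Z^2+T^2=0$, $q(X^2,Y^2,Z^2,T^2)=XYZT$, with $q$ a quadratic form, where $a.[X,Y,Z,T]=[X,Y,-Z,-T]$, $b.[X,Y,Z,T]=[X,-Y,Z,-T]$, and $p\colon\mathcal{C}\to\mathcal{D}$ is $[X,Y,Z,T]\mapsto[X^2,Y^2,Z^2,T^2]$, with $\mathcal{D}=\{x+y+z+t=0,\ q(x,y,z,t)^2=xyzt\}\subset\mathbb{P}^3$. The surface. The Theta divisor is a translate of $W_2(\mathcal{D})\cong\mathcal{D}^{(2)}$ (second symmetric product), and $\mathcal{S}$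 is its pullback to $A$ via $p$. One has $\mathcal{S}=(\mathcal{C}\times\mathcal{C})/(\Delta_{\mathcal{G}}\times\mathbb{Z}_2)$, where $\Delta_{\mathcal{G}}$ is the diagonal subgroup of $\mathcal{G}\times\mathcal{G}$ and $\mathbb{Z}_2$ exchanges the two factors. Identifications. $\omega_{\mathcal{C}}\cong\mathcal{O}_{\mathbb{P}^3}(2)|_{\mathcal{C}}$ by adjunction, so sections of $\omega_{\mathcal{C}}$ are represented by quadratic forms on $\mathbb{P}^3$, with $\mathcal{G}$ acting on quadratic forms through the sign changes of coordinates $a\colon(X,Y,Z,T)\mapsto(X,Y,-Z,-T)$ and $b\colon(X,Y,Z,T)\mapsto(X,-Y,Z,-T)$. $\omega_{\mathcal{C}}\boxtimes\omega_{\mathcal{C}}=\omega_{\mathcal{C}\times\mathcal{C}}$, and invariance under $\Delta_{\mathcal{G}}\times\mathbb{Z}_2$ means invariance of holomorphic $2$-forms under pullback; in particular, invariance under the exchange of the factors corresponds to antisymmetry of the coefficient polynomials in the two sets of variables. *)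

theory Defs
  imports "HOL-Analysis.Analysis" "HOL-Library.Function_Algebras"
begin

section \<open>Smooth complete intersection curves in projective 3-space\<close>

text \<open>
  A curve in the projective space of \<open>complex^4\<close> is handled through its punctured affine cone
  \<open>cone F G = {P \<noteq> 0. F P = 0 \<and> G P = 0}\<close>, where \<open>F\<close> and \<open>G\<close> are homogeneous polynomial functions.
\<close>

abbreviation differential :: "(complex^4 \<Rightarrow> complex) \<Rightarrow> complex^4 \<Rightarrow> complex^4 \<Rightarrow> complex" where
  "differential F P \<equiv> frechet_derivative F (at P)"

definition cone :: "(complex^4 \<Rightarrow> complex) \<Rightarrow> (complex^4 \<Rightarrow> complex) \<Rightarrow> (complex^4) set" where
  "cone F G = {P. P \<noteq> 0 \<and> F P = 0 \<and> G P = 0}"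

definition tangent ::
  "(complex^4 \<Rightarrow> complex) \<Rightarrow> (complex^4 \<Rightarrow> complex) \<Rightarrow> complex^4 \<Rightarrow> (complex^4) set" where
  "tangent F G P = {v. differential F P v = 0 \<and> differential G P v = 0}"

text \<open>The Jacobian criterion.\<close>

definition smooth_complete_intersection ::
  "(complex^4 \<Rightarrow> complex) \<Rightarrow> (complex^4 \<Rightarrow> complex) \<Rightarrow> bool" where
  "smooth_complete_intersection F G \<longleftrightarrow>
     (\<forall>P \<in> cone F G. \<forall>a b.
        (\<forall>v. a * differential F P v + b * differential G P v = 0) \<longrightarrow> a = 0 \<and> b = 0)"


section \<open>Holomorphic 2-forms on the product of a curve with itself\<close>

type_synonym point2 = "(complex^4) \<times> (complex^4)"

type_synonym form2 = "point2 \<Rightarrow> point2 \<Rightarrow> point2 \<Rightarrow> complex"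
  \<comment> \<open>\<open>\<alpha> p u v\<close>: the value at the point \<open>p\<close> on the tangent vectors \<open>u\<close>, \<open>v\<close>\<close>

definition form_scale :: "complex \<Rightarrow> form2 \<Rightarrow> form2" where
  "form_scale c \<alpha> = (\<lambda>p u v. c * \<alpha> p u v)"

interpretation forms: vector_space form_scale
  by unfold_locales (auto simp: form_scale_def fun_eq_iff algebra_simps)

definition scale2 :: "complex \<Rightarrow> complex \<Rightarrow> point2 \<Rightarrow> point2" where
  "scale2 c d = map_prod (\<lambda>P. c *s P) (\<lambda>Q. d *s Q)"

definition cone2 :: "(complex^4 \<Rightarrow> complex) \<Rightarrow> (complex^4 \<Rightarrow> complex) \<Rightarrow> point2 set" where
  "cone2 F G = cone F G \<times> cone F G"

definition tangent2 ::
  "(complex^4 \<Rightarrow> complex) \<Rightarrow> (complex^4 \<Rightarrow> complex) \<Rightarrow> point2 \<Rightarrow> point2 set" where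
  "tangent2 F G p = tangent F G (fst p) \<times> tangent F G (snd p)"

text \<open>
  Alternating complex bilinear forms on the tangent spaces of \<open>cone2 F G\<close>. The value 0 is
  prescribed elsewhere, so that equality of forms is equality of functions.
\<close>

definition alternating_form ::
  "(complex^4 \<Rightarrow> complex) \<Rightarrow> (complex^4 \<Rightarrow> complex) \<Rightarrow> form2 \<Rightarrow> bool" where
  "alternating_form F G \<alpha> \<longleftrightarrow>
     (\<forall>p u v. \<not> (p \<in> cone2 F G \<and> u \<in> tangent2 F G p \<and> v \<in> tangent2 F G p) \<longrightarrow> \<alpha> p u v = 0) \<and>
     (\<forall>p \<in> cone2 F G. \<forall>u \<in> tangent2 F G p. \<forall>u' \<in> tangent2 F G p. \<forall>v \<in> tangent2 F G p. \<forall>c.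
        \<alpha> p (u + u') v = \<alpha> p u v + \<alpha> p u' v \<and>
        \<alpha> p (scale2 c c u) v = c * \<alpha> p u v \<and>
        \<alpha> p v u = - \<alpha> p u v)"

text \<open>
  A form on \<open>cone2 F G\<close> is the pullback of a form on the product of the projective curves iff it is
  invariant under rescaling the two factors independently and is annihilated by the tangent
  vectors \<open>(a P, b Q)\<close> at \<open>(P, Q)\<close> of the fibres.
\<close>

definition descends :: "form2 \<Rightarrow> bool" where
  "descends \<alpha> \<longleftrightarrow>
     (\<forall>c d p u v. c \<noteq> 0 \<and> d \<noteq> 0 \<longrightarrow> \<alpha> (scale2 c d p) (scale2 c d u) (scale2 c d v) = \<alpha> p u v) \<and>
     (\<forall>a b p v. \<alpha> p (scale2 a b p) v = 0)"

definition complex_differentiable2 :: "(complex \<times> complex \<Rightarrow> complex) \<Rightarrow> (complex \<times> complex) set \<Rightarrow> bool" where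
  "complex_differentiable2 h W \<longleftrightarrow>
     (\<forall>w \<in> W. \<exists>a b. (h has_derivative (\<lambda>(s, t). a * s + b * t)) (at w))"

definition holomorphic_arc ::
  "(complex^4 \<Rightarrow> complex) \<Rightarrow> (complex^4 \<Rightarrow> complex) \<Rightarrow> complex set \<Rightarrow> (complex \<Rightarrow> complex^4) \<Rightarrow> bool" where
  "holomorphic_arc F G U \<gamma> \<longleftrightarrow>
     open U \<and> \<gamma> ` U \<subseteq> cone F G \<and> (\<forall>i. (\<lambda>s. \<gamma> s $ i) holomorphic_on U)"

definition velocity :: "(complex \<Rightarrow> complex^4) \<Rightarrow> complex \<Rightarrow> complex^4" where
  "velocity \<gamma> s = (\<chi> i. deriv (\<lambda>z. \<gamma> z $ i) s)"

text \<open>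
  Holomorphy: the coefficient of \<open>ds \<and> dt\<close> is holomorphic whenever the form is pulled back along
  \<open>(s, t) \<mapsto> (\<gamma> s, \<delta> t)\<close> with \<open>\<gamma>\<close>, \<open>\<delta>\<close> holomorphic. Local parametrizations of the curve (lifted to the
  cone) are among these maps; for the others the condition follows from that for parametrizations.
\<close>

definition holomorphic_form ::
  "(complex^4 \<Rightarrow> complex) \<Rightarrow> (complex^4 \<Rightarrow> complex) \<Rightarrow> form2 \<Rightarrow> bool" where
  "holomorphic_form F G \<alpha> \<longleftrightarrow>
     (\<forall>U V \<gamma> \<delta>. holomorphic_arc F G U \<gamma> \<and> holomorphic_arc F G V \<delta> \<longrightarrow>
        complex_differentiable2
          (\<lambda>(s, t). \<alpha> (\<gamma> s, \<delta> t) (velocity \<gamma> s, 0) (0, velocity \<delta> t)) (U \<times> V))"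

definition H0_omega_product ::
  "(complex^4 \<Rightarrow> complex) \<Rightarrow> (complex^4 \<Rightarrow> complex) \<Rightarrow> form2 set" where
  "H0_omega_product F G = {\<alpha>. alternating_form F G \<alpha> \<and> descends \<alpha> \<and> holomorphic_form F G \<alpha>}"

definition pullback_form :: "(point2 \<Rightarrow> point2) \<Rightarrow> form2 \<Rightarrow> form2" where
  "pullback_form \<sigma> \<alpha> = (\<lambda>p u v. \<alpha> (\<sigma> p) (\<sigma> u) (\<sigma> v))"
  \<comment> \<open>only for linear \<open>\<sigma>\<close>, which are their own differentials\<close>


section \<open>Adjunction\<close>

text \<open>
  Let \<open>\<Omega>\<close> be the contraction of \<open>dX \<and> dY \<and> dZ \<and> dT\<close> with the Euler field. The Poincare residue \<open>\<kappa>\<close>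
  of \<open>\<Omega> / (F G)\<close> is the form on the tangent spaces of the cone with \<open>dF \<and> dG \<and> \<kappa> = \<Omega>\<close>; evaluating on
  \<open>(n, m, v)\<close> with \<open>v\<close> tangent gives the equation below, which determines \<open>\<kappa>\<close> where \<open>dF\<close> and \<open>dG\<close> are
  linearly independent. For \<open>deg F = 2\<close> and \<open>deg G = 4\<close>, \<open>A \<kappa>\<close> descends to the projective curve
  for every quadratic form \<open>A\<close>, and \<open>A \<mapsto> A \<kappa>\<close> is the adjunction isomorphism.
\<close>

definition residue_form ::
  "(complex^4 \<Rightarrow> complex) \<Rightarrow> (complex^4 \<Rightarrow> complex) \<Rightarrow> complex^4 \<Rightarrow> complex^4 \<Rightarrow> complex" where
  "residue_form F G P v =
     (THE k. \<forall>n m. (differential F P n * differential G P m - differential F P m * differential G P n) * k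
                     = det (vector [P, v, n, m] :: complex^4^4))"

text \<open>The 2-form \<open>B pr\<^sub>1\<^sup>* \<kappa> \<and> pr\<^sub>2\<^sup>* \<kappa>\<close> attached to a bihomogeneous polynomial \<open>B\<close> of bidegree (2,2).\<close>

definition adjunction_form ::
  "(complex^4 \<Rightarrow> complex) \<Rightarrow> (complex^4 \<Rightarrow> complex) \<Rightarrow> (complex^4 \<Rightarrow> complex^4 \<Rightarrow> complex) \<Rightarrow> form2" where
  "adjunction_form F G B = (\<lambda>p u v.
     if p \<in> cone2 F G \<and> u \<in> tangent2 F G p \<and> v \<in> tangent2 F G p
     then B (fst p) (snd p) *
       (residue_form F G (fst p) (fst u) * residue_form F G (snd p) (snd v) -
        residue_form F G (fst p) (fst v) * residue_form F G (snd p) (snd u))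
     else 0)"


section \<open>The curves and the group\<close>

text \<open>The coordinates \<open>X, Y, Z, T\<close> of \<open>P\<close> are \<open>P$1, P$2, P$3, P$4\<close>.\<close>

definition quadratic_form :: "(complex^4 \<Rightarrow> complex) \<Rightarrow> bool" where
  "quadratic_form q \<longleftrightarrow> (\<exists>M :: complex^4^4. \<forall>P. q P = (\<Sum>i\<in>UNIV. \<Sum>j\<in>UNIV. M $ i $ j * P $ i * P $ j))"

definition squares :: "complex^4 \<Rightarrow> complex^4" where
  "squares P = (\<chi> i. (P $ i)\<^sup>2)"

definition D_linear :: "complex^4 \<Rightarrow> complex" where
  "D_linear P = P$1 + P$2 + P$3 + P$4"

definition D_quartic :: "(complex^4 \<Rightarrow> complex) \<Rightarrow> complex^4 \<Rightarrow> complex" where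
  "D_quartic q P = (q P)\<^sup>2 - P$1 * P$2 * P$3 * P$4"

definition C_quadric :: "complex^4 \<Rightarrow> complex" where
  "C_quadric P = (P$1)\<^sup>2 + (P$2)\<^sup>2 + (P$3)\<^sup>2 + (P$4)\<^sup>2"

definition C_quartic :: "(complex^4 \<Rightarrow> complex) \<Rightarrow> complex^4 \<Rightarrow> complex" where
  "C_quartic q P = q (squares P) - P$1 * P$2 * P$3 * P$4"

definition act_a :: "complex^4 \<Rightarrow> complex^4" where
  "act_a P = vector [P$1, P$2, - P$3, - P$4]"

definition act_b :: "complex^4 \<Rightarrow> complex^4" where
  "act_b P = vector [P$1, - P$2, P$3, - P$4]"

definition group_G :: "(complex^4 \<Rightarrow> complex^4) set" where
  "group_G = {id, act_a, act_b, act_a \<circ> act_b}"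

text \<open>The group \<open>\<Delta>\<^sub>G \<times> Z\<^sub>2\<close> acting on the product.\<close>

definition group_DeltaG_Z2 :: "(point2 \<Rightarrow> point2) set" where
  "group_DeltaG_Z2 = {\<tau> \<circ> map_prod g g | \<tau> g. \<tau> \<in> {id, prod.swap} \<and> g \<in> group_G}"

text \<open>
  \<open>H\<^sup>0(S, \<omega>\<^sub>S)\<close> for \<open>S = (C \<times> C) / (\<Delta>\<^sub>G \<times> Z\<^sub>2)\<close>, as the space of invariant holomorphic 2-forms on
  \<open>C \<times> C\<close>.
\<close>

definition H0_omega_S :: "(complex^4 \<Rightarrow> complex) \<Rightarrow> form2 set" where
  "H0_omega_S q =
     {\<alpha> \<in> H0_omega_product C_quadric (C_quartic q). \<forall>\<sigma> \<in> group_DeltaG_Z2. pullback_form \<sigma> \<alpha> = \<alpha>}"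

definition minor2 :: "(complex^4 \<Rightarrow> complex) \<Rightarrow> (complex^4 \<Rightarrow> complex) \<Rightarrow> complex^4 \<Rightarrow> complex^4 \<Rightarrow> complex" where
  "minor2 A B P Q = det (vector [vector [A P, A Q], vector [B P, B Q]] :: complex^2^2)"

definition eta12 :: "complex^4 \<Rightarrow> complex^4 \<Rightarrow> complex" where
  "eta12 = minor2 (\<lambda>P. (P$1)\<^sup>2) (\<lambda>P. (P$2)\<^sup>2)"

definition eta13 :: "complex^4 \<Rightarrow> complex^4 \<Rightarrow> complex" where
  "eta13 = minor2 (\<lambda>P. (P$1)\<^sup>2) (\<lambda>P. (P$3)\<^sup>2)"

definition eta23 :: "complex^4 \<Rightarrow> complex^4 \<Rightarrow> complex" where
  "eta23 = minor2 (\<lambda>P. (P$2)\<^sup>2) (\<lambda>P. (P$3)\<^sup>2)"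

definition omega45 :: "complex^4 \<Rightarrow> complex^4 \<Rightarrow> complex" where
  "omega45 = minor2 (\<lambda>P. P$1 * P$2) (\<lambda>P. P$3 * P$4)"

definition omega67 :: "complex^4 \<Rightarrow> complex^4 \<Rightarrow> complex" where
  "omega67 = minor2 (\<lambda>P. P$1 * P$3) (\<lambda>P. P$2 * P$4)"

definition omega89 :: "complex^4 \<Rightarrow> complex^4 \<Rightarrow> complex" where
  "omega89 = minor2 (\<lambda>P. P$1 * P$4) (\<lambda>P. P$2 * P$3)"

end

theory Submission
  imports Defs "HOL-Complex_Analysis.Conformal_Mappings"
    "HOL-Computational_Algebra.Fundamental_Theorem_Algebra"
begin

text \<open>
  A 2-form on \<open>C \<times> C\<close> is \<open>h pr\<^sub>1\<^sup>* \<kappa> \<and> pr\<^sub>2\<^sup>* \<kappa>\<close> with \<open>\<kappa>\<close> the Poincare residue and \<open>h\<close> of bidegree (2,2),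
  so one has to show that a holomorphic \<open>f\<close> of degree 2 on the cone over \<open>C\<close> is a quadratic form, one
  character of the group at a time. An invariant \<open>f\<close> is a section of \<open>O(1)\<close> on the plane quartic \<open>D\<close>; for
  another character, \<open>f\<close> times a monomial such as \<open>X Y\<close> is a section of \<open>O(2)\<close> on \<open>D\<close>.

  For a section \<open>g\<close> on \<open>D\<close>, project from a point off \<open>D\<close>, so that \<open>D\<close> is given by a polynomial \<open>P\<close> of degree 4
  in \<open>w\<close> with constant leading coefficient. Since \<open>D\<close> is smooth, the sums of \<open>g w^j / P\<^sub>w\<close> over the fibres of the
  projection extend over the branch points; being homogeneous they are polynomials (or zero, in negative
  degree), and Lagrange interpolation expresses \<open>g\<close> through them. For the non-trivial characters this
  gives conics with \<open>x y g\<^sub>2 = q g\<^sub>1\<close> on \<open>D\<close>, and comparing with the equation of \<open>D\<close> yields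
  \<open>f = \<mu> X Y + \<nu> Z T\<close>.
\<close>

section \<open>Traces along a smooth branched cover of the line\<close>

text \<open>Holomorphy of a form is an analytic condition, so the algebraic nature of
  \<open>f\<close> has to be produced. The traces do this: they are entire on both charts of the
  line and have polynomial growth, hence are polynomials by Liouville. The denominator
  \<open>pw\<close> has two roles: \<open>G dx / pw\<close> is a differential without poles on a
  smooth curve, and \<open>pw\<close> is the denominator in Lagrange interpolation. As
  \<open>pw\<close> has degree 3, the trace of \<open>g w^j\<close> for \<open>g\<close> of degree
  \<open>k\<close> has degree \<open>k + j - 3\<close>, which decides which traces vanish. A section
  with non-trivial character does not descend to D, and the conic obtained from \<open>f X Y\<close>
  no longer shows that \<open>X Y\<close> divides it. This is recovered from the second product
  \<open>f Z T\<close>; no two coordinates vanish at the same point of C, because D would be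
  singular at its image. Smoothness is assumed for D only, and that of C is deduced from it. The
  coefficient of a form depends on two points, but it is antisymmetric, so its behaviour in the
  second point is read off from that in the first.\<close>

lemma holomorphic_implicit_function:
  fixes f fx fw :: "complex \<times> complex \<Rightarrow> complex"
  assumes der: "\<And>z. (f has_derivative (\<lambda>(h, k). fx z * h + fw z * k)) (at z)"
    and cont: "continuous_on UNIV fx" "continuous_on UNIV fw"
    and zero: "f (x0, w0) = 0" and nz: "fw (x0, w0) \<noteq> 0" and "0 < d0"
  obtains r d \<psi> where "0 < r" "0 < d" "d \<le> d0" "\<psi> holomorphic_on ball x0 r" "\<psi> x0 = w0"
    "\<And>x. x \<in> ball x0 r \<Longrightarrow> \<psi> x \<in> ball w0 d"
    "\<And>x w. x \<in> ball x0 r \<Longrightarrow> w \<in> ball w0 d \<Longrightarrow> f (x, w) = 0 \<longleftrightarrow> w = \<psi> x"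
proof -
  \<comment> \<open>\<open>\<Phi>\<close> straightens the zero set of \<open>f\<close> to the line
    with second coordinate 0, so the implicit function is the second component of the inverse
    \<open>g\<close> along that line.\<close>
  define \<Phi> where "\<Phi> = (\<lambda>z. (fst z, f z))"
  define D where "D z = (\<lambda>h. (fst h, fx z * fst h + fw z * snd h))" for z
  have blD: "bounded_linear (D z)" for z
    unfolding D_def by (intro bounded_linear_intros)
  have app: "blinfun_apply (Blinfun (D z)) = D z" for z
    using blD by (simp add: bounded_linear_Blinfun_apply)
  have derf: "(f has_derivative (\<lambda>h. fx z * fst h + fw z * snd h)) (at z)" for z
    using der[of z] by (simp add: case_prod_unfold)
  have der\<Phi>: "(\<Phi> has_derivative blinfun_apply (Blinfun (D z))) (at z)" for z
    unfolding app unfolding \<Phi>_def D_def by (intro derivative_intros derf)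
  have cont\<Phi>: "continuous_on UNIV (\<lambda>z. Blinfun (D z))"
    by (rule continuous_on_blinfun_componentwise)
      (unfold app, unfold D_def, intro continuous_intros cont)
  define I where "I = (\<lambda>h. (fst h, (snd h - fx (x0, w0) * fst h) / fw (x0, w0)))"
  have blI: "bounded_linear I"
    unfolding I_def by (intro bounded_linear_Pair bounded_linear_fst
      bounded_linear_compose[OF bounded_linear_divide] bounded_linear_sub bounded_linear_snd
      bounded_linear_compose[OF bounded_linear_mult_right])
  have inv: "Blinfun I o\<^sub>L Blinfun (D (x0, w0)) = id_blinfun"
    by (rule blinfun_eqI) (use nz in \<open>simp add: app bounded_linear_Blinfun_apply[OF blI], simp add: I_def D_def\<close>)
  obtain U' V g g' where U': "open U'" "(x0, w0) \<in> U'" and V: "open V" "\<Phi> (x0, w0) \<in> V"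
    and hom: "homeomorphism U' V \<Phi> g"
    and derg: "\<And>y. y \<in> V \<Longrightarrow> (g has_derivative (g' y)) (at y)"
    and g': "\<And>y. y \<in> V \<Longrightarrow> g' y = inv (blinfun_apply (Blinfun (D (g y))))"
    and bij: "\<And>y. y \<in> V \<Longrightarrow> bij (blinfun_apply (Blinfun (D (g y))))"
    using inverse_function_theorem[OF open_UNIV der\<Phi> cont\<Phi> UNIV_I inv] by metis
  have V0: "(x0, 0) \<in> V" using V(2) zero by (simp add: \<Phi>_def)
  have g0: "g (x0, 0) = (x0, w0)"
    using homeomorphism_apply1[OF hom U'(2)] zero by (simp add: \<Phi>_def)
  obtain A B where AB: "open A" "open B" "x0 \<in> A" "w0 \<in> B" "A \<times> B \<subseteq> U'"
    using U' by (metis open_prod_elim mem_Sigma_iff)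
  obtain ra where ra: "ra > 0" "ball x0 ra \<subseteq> A" using AB openE by blast
  obtain rb where rb: "rb > 0" "ball w0 rb \<subseteq> B" using AB openE by blast
  define d where "d = min rb d0"
  define \<psi> where "\<psi> x = snd (g (x, 0))" for x
  have openV: "open {x. (x, 0) \<in> V}"
    using open_vimage[OF V(1), of "\<lambda>x. (x, 0)"] by (simp add: vimage_def continuous_on_Pair)
  have \<psi>_deriv: "\<exists>a. (\<psi> has_field_derivative a) (at x)" if x: "(x, 0) \<in> V" for x
  proof -
    let ?z = "g (x, 0)"
    have d1: "((\<lambda>s. snd (g (s, 0))) has_derivative (\<lambda>h. snd (g' (x, 0) (h, 0)))) (at x)"
      by (rule has_derivative_compose[where g = "\<lambda>y. snd (g y)" and f = "\<lambda>s. (s, 0)"])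
        (auto intro!: derivative_eq_intros derg x)
    have b: "bij (D ?z)" using bij[OF x] by (simp add: app)
    have fw: "fw ?z \<noteq> 0"
    proof
      assume "fw ?z = 0"
      then have "D ?z (0, 1) = D ?z (0, 0)" by (simp add: D_def)
      then show False using b by (metis bij_def injD old.prod.inject zero_neq_one)
    qed
    \<comment> \<open>The inverse function theorem used here is the real one. The differential of
      \<open>\<psi>\<close> is multiplication by \<open>- fx / fw\<close>, which is complex linear,
      hence \<open>\<psi>\<close> is holomorphic.\<close>
    have "(\<lambda>h. snd (g' (x, 0) (h, 0))) = (*) (- fx ?z / fw ?z)"
    proof
      fix h
      have "D ?z (g' (x, 0) (h, 0)) = (h, 0)"
        using b by (simp add: g'[OF x] app bij_is_surj surj_f_inv_f)
      then have "fst (g' (x, 0) (h, 0)) = h" "fx ?z * h + fw ?z * snd (g' (x, 0) (h, 0)) = 0"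
        by (auto simp: D_def)
      then show "snd (g' (x, 0) (h, 0)) = - fx ?z / fw ?z * h" using fw
        by (simp add: field_simps) (metis add.commute add_eq_0_iff)
    qed
    with d1 have "(\<psi> has_derivative (*) (- fx ?z / fw ?z)) (at x)"
      unfolding \<psi>_def by metis
    then show ?thesis unfolding has_field_derivative_def by blast
  qed
  have "isCont \<psi> x0"
    using \<psi>_deriv[OF V0] DERIV_isCont by blast
  moreover have "\<psi> x0 = w0" by (simp add: \<psi>_def g0)
  ultimately have "\<forall>\<^sub>F x in nhds x0. \<psi> x \<in> ball w0 d"
    using \<open>0 < d0\<close> rb(1) topological_tendstoD[of \<psi> w0 "nhds x0" "ball w0 d"]
    by (auto simp: d_def isCont_def tendsto_at_iff_tendsto_nhds)
  moreover have "\<forall>\<^sub>F x in nhds x0. (x, 0) \<in> V"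
    using openV V0 by (auto simp: eventually_nhds)
  moreover have "\<forall>\<^sub>F x in nhds x0. x \<in> ball x0 ra"
    using ra(1) by (intro eventually_nhds_in_open) auto
  ultimately have "\<forall>\<^sub>F x in nhds x0. \<psi> x \<in> ball w0 d \<and> (x, 0) \<in> V \<and> x \<in> ball x0 ra"
    by eventually_elim auto
  then obtain r where r: "r > 0" "\<And>x. x \<in> ball x0 r \<Longrightarrow> \<psi> x \<in> ball w0 d \<and> (x, 0) \<in> V \<and> x \<in> ball x0 ra"
    by (auto simp: eventually_nhds_metric dist_commute)
  show ?thesis
  proof
    show "0 < r" "0 < d" "d \<le> d0" using r(1) rb(1) \<open>0 < d0\<close> by (auto simp: d_def)
    show "\<psi> holomorphic_on ball x0 r"
      unfolding holomorphic_on_open[OF open_ball] using r(2) \<psi>_deriv by blast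
    show "\<psi> x0 = w0" by fact
    show "\<psi> x \<in> ball w0 d" if "x \<in> ball x0 r" for x using r(2)[OF that] by simp
    fix x w assume x: "x \<in> ball x0 r" and w: "w \<in> ball w0 d"
    have xV: "(x, 0) \<in> V" and "x \<in> ball x0 ra" using r(2)[OF x] by auto
    then have "(x, w) \<in> A \<times> B" using w ra rb by (auto simp: d_def)
    with AB have U: "(x, w) \<in> U'" by blast
    show "f (x, w) = 0 \<longleftrightarrow> w = \<psi> x"
    proof
      assume "f (x, w) = 0"
      then have "g (x, 0) = (x, w)" using homeomorphism_apply1[OF hom U] by (simp add: \<Phi>_def)
      then show "w = \<psi> x" by (simp add: \<psi>_def)
    next
      assume w: "w = \<psi> x"
      have "\<Phi> (g (x, 0)) = (x, 0)" using homeomorphism_apply2[OF hom xV] .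
      then have "fst (g (x, 0)) = x" "f (g (x, 0)) = 0" by (auto simp: \<Phi>_def)
      then show "f (x, w) = 0" using w by (metis \<psi>_def prod.collapse)
    qed
  qed
qed

text \<open>Carries identities that hold off isolated exceptional points, such as branch points, to
  these points themselves.\<close>

lemma isCont_eq_if_eventually_eq:
  fixes f g :: "'a::{perfect_space,t2_space} \<Rightarrow> 'b::t2_space"
  assumes "isCont f a" "isCont g a" "\<forall>\<^sub>F x in at a. f x = g x"
  shows "f a = g a"
proof -
  have "(g \<longlongrightarrow> f a) (at a)"
    using Lim_transform_eventually[OF isContD[OF assms(1)] assms(3)] .
  then show ?thesis by (rule tendsto_unique[OF at_neq_bot _ isContD[OF assms(2)]])
qed

text \<open>An affine curve, monic in \<open>w\<close> up to the constant \<open>e\<close>: no root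
  escapes to infinity, so the projection to the \<open>x\<close>-line is finite. The coefficients
  may be any entire functions. \<open>smooth\<close> is the Jacobian criterion; its two sums are the
  partial derivatives in \<open>w\<close> and in \<open>x\<close>.\<close>

locale smooth_cover =
  fixes n :: nat and c :: "nat \<Rightarrow> complex \<Rightarrow> complex" and e :: complex
  assumes hol_c: "\<And>l. c l holomorphic_on UNIV"
    and lead: "\<And>x. c n x = e" and e: "e \<noteq> 0"
    and smooth: "\<And>x w. (\<Sum>l\<le>n. c l x * w ^ l) = 0 \<Longrightarrow>
      (\<Sum>l\<le>n. c l x * (of_nat l * w ^ (l - 1))) \<noteq> 0 \<or> (\<Sum>l\<le>n. deriv (c l) x * w ^ l) \<noteq> 0"
begin

definition p :: "complex \<Rightarrow> complex \<Rightarrow> complex" where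
  "p x w = (\<Sum>l\<le>n. c l x * w ^ l)"

definition pw :: "complex \<Rightarrow> complex \<Rightarrow> complex" where
  "pw x w = (\<Sum>l\<le>n. c l x * (of_nat l * w ^ (l - 1)))"

definition px :: "complex \<Rightarrow> complex \<Rightarrow> complex" where
  "px x w = (\<Sum>l\<le>n. deriv (c l) x * w ^ l)"

definition roots :: "complex \<Rightarrow> complex set" where
  "roots x = {w. p x w = 0}"

definition branch_points :: "complex set" where
  "branch_points = {x. \<exists>w. p x w = 0 \<and> pw x w = 0}"

text \<open>Only values on the curve are tested, along graphs over \<open>x\<close> and along graphs
  over \<open>w\<close>. By smoothness one of the two kinds is available near each point, so this is
  holomorphy on the Riemann surface.\<close>

definition regular_function :: "(complex \<Rightarrow> complex \<Rightarrow> complex) \<Rightarrow> bool" where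
  "regular_function G \<longleftrightarrow>
     (\<forall>U \<psi>. open U \<and> \<psi> holomorphic_on U \<and> (\<forall>s\<in>U. p s (\<psi> s) = 0) \<longrightarrow>
        (\<lambda>s. G s (\<psi> s)) holomorphic_on U) \<and>
     (\<forall>U \<xi>. open U \<and> \<xi> holomorphic_on U \<and> (\<forall>s\<in>U. p (\<xi> s) s = 0) \<longrightarrow>
        (\<lambda>s. G (\<xi> s) s) holomorphic_on U)"

text \<open>The coefficient of \<open>dx\<close> in the trace of the differential
  \<open>G dx / pw\<close>. Roots are counted without multiplicity and division by 0 yields 0, so
  the values at branch points carry no meaning; \<open>fibre_trace_extends\<close> replaces
  them.\<close>

definition fibre_trace :: "(complex \<Rightarrow> complex \<Rightarrow> complex) \<Rightarrow> complex \<Rightarrow> complex" where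
  "fibre_trace G x = (\<Sum>w\<in>roots x. G x w / pw x w)"

lemma smooth_point: "p x w = 0 \<Longrightarrow> pw x w \<noteq> 0 \<or> px x w \<noteq> 0"
  unfolding p_def pw_def px_def using smooth .

definition fibre_poly :: "complex \<Rightarrow> complex poly" where
  "fibre_poly x = (\<Sum>l\<le>n. monom (c l x) l)"

lemma coeff_fibre_poly: "coeff (fibre_poly x) k = (if k \<le> n then c k x else 0)"
proof -
  have "coeff (fibre_poly x) k = (\<Sum>l\<le>n. if l = k then c l x else 0)"
    by (simp add: fibre_poly_def coeff_sum)
  then show ?thesis by simp
qed

lemma poly_fibre_poly: "poly (fibre_poly x) w = p x w"
  by (simp add: fibre_poly_def p_def poly_sum poly_monom)

lemma fibre_poly_nonzero: "fibre_poly x \<noteq> 0"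
  using coeff_fibre_poly[of x n] e lead by auto

lemma degree_fibre_poly: "degree (fibre_poly x) = n"
proof (rule antisym)
  show "degree (fibre_poly x) \<le> n" by (rule degree_le) (simp add: coeff_fibre_poly)
  show "n \<le> degree (fibre_poly x)" by (rule le_degree) (simp add: coeff_fibre_poly lead e)
qed

lemma finite_roots: "finite (roots x)"
  using poly_roots_finite[OF fibre_poly_nonzero, of x] by (simp add: roots_def poly_fibre_poly)

lemma card_roots_le: "card (roots x) \<le> n"
  using card_poly_roots_bound[OF fibre_poly_nonzero, of x]
  by (simp add: roots_def poly_fibre_poly degree_fibre_poly)

lemma pderiv_sum: "pderiv (sum f A) = (\<Sum>x\<in>A. pderiv (f x))"
  by (induction A rule: infinite_finite_induct) (auto simp: pderiv_add)

lemma pderiv_fibre_poly: "poly (pderiv (fibre_poly x)) w = pw x w"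
proof -
  have "pderiv (monom a l) = monom (of_nat l * a) (l - 1)" for a :: complex and l
    by (rule pderiv_monom)
  then have "pderiv (fibre_poly x) = (\<Sum>l\<le>n. monom (of_nat l * c l x) (l - 1))"
    unfolding fibre_poly_def pderiv_sum by simp
  then show ?thesis by (simp add: pw_def poly_sum poly_monom algebra_simps)
qed

lemma card_roots:
  assumes "x \<notin> branch_points" shows "card (roots x) = n"
proof -
  have "rsquarefree (fibre_poly x)"
    unfolding rsquarefree_roots
    using assms by (auto simp: poly_fibre_poly pderiv_fibre_poly branch_points_def)
  then have dec: "smult (lead_coeff (fibre_poly x)) (\<Prod>z\<in>roots x. [:-z, 1:]) = fibre_poly x"
    using complex_poly_decompose_rsquarefree[of "fibre_poly x"] by (simp add: roots_def poly_fibre_poly)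
  have "n = degree (\<Prod>z\<in>roots x. [:-z, 1:])"
    using arg_cong[OF dec, of degree] by (simp add: degree_fibre_poly coeff_fibre_poly lead e)
  also have "\<dots> = card (roots x)"
    by (subst degree_prod_eq_sum_degree) auto
  finally show ?thesis by simp
qed

lemma DERIV_c: "(c l has_field_derivative deriv (c l) x) (at x)"
  using hol_c[of l] by (simp add: holomorphic_derivI)

lemma has_derivative_p:
  "((\<lambda>z. p (fst z) (snd z)) has_derivative
     (\<lambda>(h, k). px (fst z) (snd z) * h + pw (fst z) (snd z) * k)) (at z)"
proof -
  have 1: "((\<lambda>z. c l (fst z)) has_derivative (\<lambda>h. deriv (c l) (fst z) * fst h)) (at z)" for l
    by (rule has_derivative_compose[where g = "c l" and f = fst])
      (auto intro!: derivative_eq_intros DERIV_c[unfolded has_field_derivative_def])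
  have "((\<lambda>z. p (fst z) (snd z)) has_derivative
     (\<lambda>h. \<Sum>l\<le>n. c l (fst z) * (of_nat l * snd h * snd z ^ (l - 1)) +
        deriv (c l) (fst z) * fst h * snd z ^ l)) (at z)"
    unfolding p_def
    by (rule has_derivative_sum, rule has_derivative_mult[OF 1])
      (auto intro!: derivative_eq_intros)
  also have "(\<lambda>h. \<Sum>l\<le>n. c l (fst z) * (of_nat l * snd h * snd z ^ (l - 1)) +
        deriv (c l) (fst z) * fst h * snd z ^ l) =
     (\<lambda>(h, k). px (fst z) (snd z) * h + pw (fst z) (snd z) * k)"
    by (auto simp: fun_eq_iff px_def pw_def sum.distrib sum_distrib_right sum_distrib_left
        algebra_simps)
  finally show ?thesis .
qed

lemma continuous_on_c: "continuous_on A f \<Longrightarrow> continuous_on A (\<lambda>z. c l (f z))"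
  using holomorphic_on_imp_continuous_on[OF hol_c[of l]]
  by (metis continuous_on_compose2 subset_UNIV)

lemma continuous_on_deriv_c: "continuous_on A f \<Longrightarrow> continuous_on A (\<lambda>z. deriv (c l) (f z))"
  using holomorphic_on_imp_continuous_on[OF holomorphic_deriv[OF hol_c[of l] open_UNIV]]
  by (metis continuous_on_compose2 subset_UNIV)

lemma continuous_on_p [continuous_intros]:
  "continuous_on A f \<Longrightarrow> continuous_on A g \<Longrightarrow> continuous_on A (\<lambda>z. p (f z) (g z))"
  unfolding p_def by (intro continuous_intros continuous_on_c)

lemma continuous_on_pw [continuous_intros]:
  "continuous_on A f \<Longrightarrow> continuous_on A g \<Longrightarrow> continuous_on A (\<lambda>z. pw (f z) (g z))"
  unfolding pw_def by (intro continuous_intros continuous_on_c)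

lemma continuous_on_px [continuous_intros]:
  "continuous_on A f \<Longrightarrow> continuous_on A g \<Longrightarrow> continuous_on A (\<lambda>z. px (f z) (g z))"
  unfolding px_def by (intro continuous_intros continuous_on_deriv_c)

lemma holomorphic_on_pw:
  "f holomorphic_on A \<Longrightarrow> g holomorphic_on A \<Longrightarrow> (\<lambda>z. pw (f z) (g z)) holomorphic_on A"
proof -
  assume *: "f holomorphic_on A" "g holomorphic_on A"
  have "(\<lambda>z. c l (f z)) holomorphic_on A" for l
    using holomorphic_on_compose_gen[OF *(1) hol_c[of l]] by (auto simp: o_def)
  with * show ?thesis unfolding pw_def by (intro holomorphic_intros)
qed

section \<open>Local parametrizations of the curve and its fibres near a branch point\<close>

lemma graph_over_x:
  assumes "p x0 w0 = 0" "pw x0 w0 \<noteq> 0" "0 < d0"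
  obtains r d \<psi> where "0 < r" "0 < d" "d \<le> d0" "\<psi> holomorphic_on ball x0 r" "\<psi> x0 = w0"
    "\<And>x. x \<in> ball x0 r \<Longrightarrow> \<psi> x \<in> ball w0 d"
    "\<And>x w. x \<in> ball x0 r \<Longrightarrow> w \<in> ball w0 d \<Longrightarrow> p x w = 0 \<longleftrightarrow> w = \<psi> x"
proof (rule holomorphic_implicit_function[OF has_derivative_p, of x0 w0 d0])
  show "continuous_on UNIV (\<lambda>z. px (fst z) (snd z))" "continuous_on UNIV (\<lambda>z. pw (fst z) (snd z))"
    by (intro continuous_intros)+
qed (use assms that in auto)

lemma graph_over_w:
  assumes "p x0 w0 = 0" "px x0 w0 \<noteq> 0" "0 < d0"
  obtains r d \<xi> where "0 < r" "0 < d" "d \<le> d0" "\<xi> holomorphic_on ball w0 r" "\<xi> w0 = x0"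
    "\<And>w. w \<in> ball w0 r \<Longrightarrow> \<xi> w \<in> ball x0 d"
    "\<And>x w. x \<in> ball x0 d \<Longrightarrow> w \<in> ball w0 r \<Longrightarrow> p x w = 0 \<longleftrightarrow> x = \<xi> w"
proof (rule holomorphic_implicit_function[of "\<lambda>z. p (snd z) (fst z)" "\<lambda>z. pw (snd z) (fst z)"
      "\<lambda>z. px (snd z) (fst z)" w0 x0 d0])
  show "continuous_on UNIV (\<lambda>z. px (snd z) (fst z))" "continuous_on UNIV (\<lambda>z. pw (snd z) (fst z))"
    by (intro continuous_intros)+
  fix z :: "complex \<times> complex"
  have "((\<lambda>z. p (fst (prod.swap z)) (snd (prod.swap z))) has_derivative
     (\<lambda>h. (\<lambda>(h, k). px (fst (prod.swap z)) (snd (prod.swap z)) * h +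
        pw (fst (prod.swap z)) (snd (prod.swap z)) * k) (prod.swap h))) (at z)"
    by (rule has_derivative_compose[OF _ has_derivative_p])
      (auto simp: prod.swap_def intro!: derivative_eq_intros)
  then show "((\<lambda>z. p (snd z) (fst z)) has_derivative
      (\<lambda>(h, k). pw (snd z) (fst z) * h + px (snd z) (fst z) * k)) (at z)"
    by (simp add: case_prod_unfold add.commute)
qed (use assms that in auto)

lemma local_graph:
  assumes pt: "p x0 w0 = 0"
  obtains (over_x) U \<psi> where "open U" "x0 \<in> U" "\<psi> holomorphic_on U" "\<psi> x0 = w0" "\<And>s. s \<in> U \<Longrightarrow> p s (\<psi> s) = 0"
  | (over_w) U \<xi> where "open U" "w0 \<in> U" "\<xi> holomorphic_on U" "\<xi> w0 = x0" "\<And>s. s \<in> U \<Longrightarrow> p (\<xi> s) s = 0"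
proof (cases "pw x0 w0 = 0")
  case False
  obtain r d \<psi> where "0 < r" "\<psi> holomorphic_on ball x0 r" "\<psi> x0 = w0"
    "\<And>s. s \<in> ball x0 r \<Longrightarrow> \<psi> s \<in> ball w0 d"
    "\<And>s w. s \<in> ball x0 r \<Longrightarrow> w \<in> ball w0 d \<Longrightarrow> p s w = 0 \<longleftrightarrow> w = \<psi> s"
    by (rule graph_over_x[OF pt False zero_less_one]) blast
  then show ?thesis by (intro over_x[of "ball x0 r" \<psi>]) auto
next
  case True
  then have px: "px x0 w0 \<noteq> 0" using smooth_point[OF pt] by simp
  obtain r d \<xi> where "0 < r" "\<xi> holomorphic_on ball w0 r" "\<xi> w0 = x0"
    "\<And>s. s \<in> ball w0 r \<Longrightarrow> \<xi> s \<in> ball x0 d"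
    "\<And>x s. x \<in> ball x0 d \<Longrightarrow> s \<in> ball w0 r \<Longrightarrow> p x s = 0 \<longleftrightarrow> x = \<xi> s"
    by (rule graph_over_w[OF pt px zero_less_one]) blast
  then show ?thesis by (intro over_w[of "ball w0 r" \<xi>]) auto
qed

text \<open>Continuity of the roots: a constant leading coefficient bounds them uniformly for
  \<open>x\<close> near \<open>x0\<close>, and compactness excludes roots that stay away from the
  fibre over \<open>x0\<close>.\<close>

lemma roots_near:
  assumes "0 < d"
  obtains r where "0 < r" "\<And>x w. x \<in> ball x0 r \<Longrightarrow> p x w = 0 \<Longrightarrow> \<exists>w0. p x0 w0 = 0 \<and> w \<in> ball w0 d"
proof -
  have "\<exists>M. \<forall>x\<in>cball x0 1. norm (c l x) \<le> M" for l
    using compact_imp_bounded[OF compact_continuous_image[OF continuous_on_c[OF continuous_on_id] compact_cball], of l x0 1]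
    by (force simp: bounded_iff)
  then obtain M where M: "\<And>l x. x \<in> cball x0 1 \<Longrightarrow> norm (c l x) \<le> M l" by metis
  \<comment> \<open>The Cauchy bound for the roots, uniform in \<open>x\<close>; \<open>M l\<close>
    bounds the coefficient \<open>c l\<close> on the closed unit disc about
    \<open>x0\<close>.\<close>
  define B where "B = max 1 ((\<Sum>l<n. M l) / norm e)"
  have bound: "norm w \<le> B" if "x \<in> cball x0 1" "p x w = 0" for x w
  proof (rule ccontr)
    assume "\<not> norm w \<le> B"
    then have w: "norm w > 1" "norm w > (\<Sum>l<n. M l) / norm e" by (auto simp: B_def)
    have "n \<noteq> 0" using that(2) e lead by (auto simp: p_def intro: ccontr)
    have "p x w = (\<Sum>l<n. c l x * w ^ l) + e * w ^ n"
      by (simp add: p_def lead flip: lessThan_Suc_atMost)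
    then have "norm (e * w ^ n) = norm (\<Sum>l<n. c l x * w ^ l)"
      using that(2) by (metis add_eq_0_iff norm_minus_cancel)
    also have "\<dots> \<le> (\<Sum>l<n. M l * norm w ^ (n - 1))"
    proof (rule sum_norm_le)
      fix l assume "l \<in> {..<n}"
      then have "norm w ^ l \<le> norm w ^ (n - 1)" using w by (intro power_increasing) auto
      then show "norm (c l x * w ^ l) \<le> M l * norm w ^ (n - 1)"
        using M[OF that(1), of l] order_trans[OF norm_ge_zero M[OF that(1), of l]]
        unfolding norm_mult norm_power by (intro mult_mono) auto
    qed
    also have "\<dots> = (\<Sum>l<n. M l) * norm w ^ (n - 1)" by (simp add: sum_distrib_right)
    also have "\<dots> < (norm w * norm e) * norm w ^ (n - 1)"
      using w(2) e less_trans[OF zero_less_one w(1)]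
      by (intro mult_strict_right_mono zero_less_power) (simp_all add: pos_divide_less_eq)
    also have "\<dots> = norm (e * w ^ n)"
      using \<open>n \<noteq> 0\<close> by (cases n) (auto simp: norm_mult norm_power)
    finally show False by simp
  qed
  \<comment> \<open>Points of the curve at distance at least \<open>d\<close> from the whole fibre
    over \<open>x0\<close>. \<open>Z\<close> is compact and its projection misses \<open>x0\<close>,
    hence misses a neighbourhood of \<open>x0\<close>.\<close>
  define Z where "Z = (cball x0 1 \<times> cball 0 B) \<inter> {z. p (fst z) (snd z) = 0} \<inter>
     (\<Inter>w0\<in>roots x0. {z. d \<le> dist w0 (snd z)})"
  have "closed {z. p (fst z) (snd z) = 0}"
    by (intro closed_Collect_eq continuous_intros)
  moreover have "closed (\<Inter>w0\<in>roots x0. {z :: complex \<times> complex. d \<le> dist w0 (snd z)})"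
    by (intro closed_INT ballI closed_Collect_le continuous_intros)
  ultimately have "compact Z"
    unfolding Z_def by (intro compact_Int_closed compact_Times compact_cball)
  then have "closed (fst ` Z)"
    by (intro compact_imp_closed compact_continuous_image continuous_intros)
  moreover have "x0 \<notin> fst ` Z"
    using assms by (force simp: Z_def roots_def)
  ultimately obtain r where r: "r > 0" "ball x0 r \<subseteq> - fst ` Z"
    by (metis ComplI open_Compl openE)
  show ?thesis
  proof
    show "0 < min r 1" using r by simp
    fix x w assume x: "x \<in> ball x0 (min r 1)" and w: "p x w = 0"
    have "x \<notin> fst ` Z" using x r by auto
    then have "(x, w) \<notin> Z" by force
    then show "\<exists>w0. p x0 w0 = 0 \<and> w \<in> ball w0 d"
      using x w bound[of x w] by (auto simp: Z_def roots_def not_le)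
  qed
qed

text \<open>Where \<open>pw\<close> vanishes the curve is a graph \<open>x = \<xi> w\<close> with \<open>pw = - px \<xi>'\<close>, and \<open>(\<xi> w - x0) / \<xi>' w\<close> tends to 0
  because \<open>\<xi> - x0\<close> has a zero of finite order. The same computation shows that branch points are isolated.\<close>

lemma local_estimate:
  assumes G: "regular_function G" and pt: "p x0 w0 = 0" and \<epsilon>: "0 < \<epsilon>"
  obtains d where "0 < d"
    "\<And>x w. x \<in> ball x0 d \<Longrightarrow> w \<in> ball w0 d \<Longrightarrow> p x w = 0 \<Longrightarrow> x \<noteq> x0 \<Longrightarrow>
       pw x w \<noteq> 0 \<and> norm (G x w * (x - x0)) \<le> \<epsilon> * norm (pw x w)"
proof (cases "pw x0 w0 = 0")
  case False
  obtain r d \<psi> where r: "0 < r" "0 < d" and \<psi>: "\<psi> holomorphic_on ball x0 r" "\<psi> x0 = w0"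
    and in_d: "\<And>x. x \<in> ball x0 r \<Longrightarrow> \<psi> x \<in> ball w0 d"
    and graph: "\<And>x w. x \<in> ball x0 r \<Longrightarrow> w \<in> ball w0 d \<Longrightarrow> p x w = 0 \<longleftrightarrow> w = \<psi> x"
    by (rule graph_over_x[OF pt False zero_less_one]) blast
  have "(\<lambda>s. G s (\<psi> s)) holomorphic_on ball x0 r"
    using G \<psi> in_d graph unfolding regular_function_def by (metis open_ball)
  then have contG: "continuous_on (ball x0 r) (\<lambda>s. G s (\<psi> s))"
    by (rule holomorphic_on_imp_continuous_on)
  \<comment> \<open>\<open>\<Theta>\<close> is negative at \<open>x0\<close>, because
    \<open>s - x0\<close> vanishes there while \<open>pw\<close> does not. Negativity persists
    nearby and also forces \<open>pw \<noteq> 0\<close>.\<close>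
  define \<Theta> where "\<Theta> s = norm (G s (\<psi> s) * (s - x0)) - \<epsilon> * norm (pw s (\<psi> s))" for s
  have "continuous_on (ball x0 r) \<Theta>"
    unfolding \<Theta>_def by (intro continuous_intros contG holomorphic_on_imp_continuous_on[OF \<psi>(1)])
  then have "isCont \<Theta> x0" using r by (simp add: continuous_on_eq_continuous_at)
  moreover have "\<Theta> x0 < 0" using False \<epsilon> by (simp add: \<Theta>_def \<psi>(2))
  ultimately have "\<forall>\<^sub>F s in nhds x0. \<Theta> s < 0"
    by (auto simp: isCont_def tendsto_at_iff_tendsto_nhds intro: order_tendstoD(2))
  then obtain r' where r': "r' > 0" "\<And>s. s \<in> ball x0 r' \<Longrightarrow> \<Theta> s < 0"
    by (auto simp: eventually_nhds_metric dist_commute)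
  show ?thesis
  proof
    show "0 < min (min r r') d" using r r' by simp
    fix x w assume *: "x \<in> ball x0 (min (min r r') d)" "w \<in> ball w0 (min (min r r') d)" "p x w = 0"
    then have "w = \<psi> x" using graph[of x w] by auto
    moreover have "\<Theta> x < 0" using * by (intro r') auto
    ultimately have "norm (G x w * (x - x0)) < \<epsilon> * norm (pw x w)" by (simp add: \<Theta>_def)
    then show "pw x w \<noteq> 0 \<and> norm (G x w * (x - x0)) \<le> \<epsilon> * norm (pw x w)"
      by (auto simp: not_less)
  qed
next
  case True
  with smooth_point[OF pt] have px: "px x0 w0 \<noteq> 0" by simp
  obtain r d \<xi> where r: "0 < r" "0 < d" and \<xi>: "\<xi> holomorphic_on ball w0 r" "\<xi> w0 = x0"
    and in_d: "\<And>w. w \<in> ball w0 r \<Longrightarrow> \<xi> w \<in> ball x0 d"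
    and graph: "\<And>x w. x \<in> ball x0 d \<Longrightarrow> w \<in> ball w0 r \<Longrightarrow> p x w = 0 \<longleftrightarrow> x = \<xi> w"
    by (rule graph_over_w[OF pt px zero_less_one]) blast
  have on_curve: "p (\<xi> w) w = 0" if "w \<in> ball w0 r" for w using graph in_d that by blast
  \<comment> \<open>A constant \<open>\<xi>\<close> would place a whole disc of roots in the fibre
    over \<open>x0\<close>, which is finite.\<close>
  have nonconst: "\<not> (\<lambda>w. \<xi> w - x0) constant_on ball w0 r"
  proof
    assume "(\<lambda>w. \<xi> w - x0) constant_on ball w0 r"
    then obtain a where a: "\<And>w. w \<in> ball w0 r \<Longrightarrow> \<xi> w - x0 = a" by (auto simp: constant_on_def)
    then have "a = 0" using r(1) \<xi>(2) by force
    with a have "\<xi> w = x0" if "w \<in> ball w0 r" for w using that by simp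
    then have "ball w0 r \<subseteq> roots x0" using on_curve by (force simp: roots_def)
    then have "finite (ball w0 r)" using finite_roots finite_subset by blast
    then show False using r(1) uncountable_ball[of r w0] countable_finite by blast
  qed
  obtain k rk m where m: "0 < m" and rk: "0 < rk" "ball w0 rk \<subseteq> ball w0 r"
    and k: "k holomorphic_on ball w0 rk"
    and fact: "\<And>w. w \<in> ball w0 rk \<Longrightarrow> \<xi> w - x0 = (w - w0) ^ m * k w"
    and knz: "\<And>w. w \<in> ball w0 rk \<Longrightarrow> k w \<noteq> 0"
    by (rule holomorphic_factor_zero_nonconstant[of "\<lambda>w. \<xi> w - x0" "ball w0 r" w0])
      (use \<xi> r nonconst in \<open>auto intro!: holomorphic_intros\<close>)
  \<comment> \<open>\<open>\<xi>'\<close> is computed from the factorization of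
    \<open>\<xi> w - x0\<close>. The factor \<open>(w - w0)^(m - 1)\<close> is kept separate because
    it cancels in the estimate.\<close>
  have pw_eq: "pw (\<xi> w) w = - px (\<xi> w) w * ((w - w0) ^ (m - 1) * (of_nat m * k w + (w - w0) * deriv k w))"
    if w: "w \<in> ball w0 rk" for w
  proof -
    have "(k has_field_derivative deriv k w) (at w)"
      using holomorphic_derivI[OF k open_ball w] .
    moreover have "((\<lambda>w. (w - w0) ^ m) has_field_derivative of_nat m * (w - w0) ^ (m - 1)) (at w)"
      by (auto intro!: derivative_eq_intros)
    ultimately have "((\<lambda>w. x0 + (w - w0) ^ m * k w) has_field_derivative
        (0 + (of_nat m * (w - w0) ^ (m - 1) * k w + deriv k w * (w - w0) ^ m))) (at w)"
      by (intro DERIV_add DERIV_const DERIV_mult)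
    moreover have "0 + (of_nat m * (w - w0) ^ (m - 1) * k w + deriv k w * (w - w0) ^ m) =
        (w - w0) ^ (m - 1) * (of_nat m * k w + (w - w0) * deriv k w)"
      using m by (cases m) (simp_all add: algebra_simps)
    ultimately have "((\<lambda>w. x0 + (w - w0) ^ m * k w) has_field_derivative
        ((w - w0) ^ (m - 1) * (of_nat m * k w + (w - w0) * deriv k w))) (at w)"
      by simp
    then have "(\<xi> has_field_derivative
        ((w - w0) ^ (m - 1) * (of_nat m * k w + (w - w0) * deriv k w))) (at w)" (is "(_ has_field_derivative ?D) _")
      by (rule has_field_derivative_transform_within_open[OF _ open_ball w])
        (use fact in \<open>auto simp: algebra_simps\<close>)
    then have "((\<lambda>w. (\<xi> w, w)) has_derivative (\<lambda>h. (?D * h, h))) (at w)"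
      by (auto simp: has_field_derivative_def intro!: derivative_eq_intros)
    from has_derivative_compose[OF this has_derivative_p]
    have "((\<lambda>w. p (\<xi> w) w) has_derivative (\<lambda>h. (px (\<xi> w) w * ?D + pw (\<xi> w) w) * h)) (at w)"
      by (simp add: algebra_simps)
    then have "((\<lambda>w. p (\<xi> w) w) has_field_derivative (px (\<xi> w) w * ?D + pw (\<xi> w) w)) (at w)"
      by (simp add: has_field_derivative_def)
    moreover have "((\<lambda>w. p (\<xi> w) w) has_field_derivative 0) (at w)"
    proof (rule has_field_derivative_transform_within_open[where f = "\<lambda>_. 0"])
      show "0 = p (\<xi> z) z" if "z \<in> ball w0 rk" for z using on_curve rk that by (simp add: subset_iff)
    qed (use w in auto)
    ultimately have "px (\<xi> w) w * ?D + pw (\<xi> w) w = 0" by (rule DERIV_unique)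
    then have "pw (\<xi> w) w = - (px (\<xi> w) w * ?D)" by (rule add_eq_0_iff[THEN iffD1])
    then show ?thesis by (simp only: mult_minus_left)
  qed
  have "(\<lambda>s. G (\<xi> s) s) holomorphic_on ball w0 r"
    using G \<xi> on_curve unfolding regular_function_def by (metis open_ball)
  then have contG: "continuous_on (ball w0 rk) (\<lambda>s. G (\<xi> s) s)"
    using rk(2) continuous_on_subset holomorphic_on_imp_continuous_on by blast
  have cont\<xi>: "continuous_on (ball w0 rk) \<xi>"
    using \<xi>(1) rk(2) continuous_on_subset holomorphic_on_imp_continuous_on by blast
  have contk: "continuous_on (ball w0 rk) k" "continuous_on (ball w0 rk) (deriv k)"
    using k holomorphic_deriv holomorphic_on_imp_continuous_on by blast+
  \<comment> \<open>The wanted inequality after division by \<open>norm ((w - w0)^(m - 1))\<close>.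
    At \<open>w0\<close> the first term is 0 and the subtracted one is positive, as
    \<open>px\<close>, \<open>k\<close> and \<open>m\<close> are non-zero there.\<close>
  define \<Theta> where "\<Theta> w = norm (G (\<xi> w) w * ((w - w0) * k w)) -
    \<epsilon> * (norm (px (\<xi> w) w) * norm (of_nat m * k w + (w - w0) * deriv k w))" for w
  have "continuous_on (ball w0 rk) \<Theta>"
    unfolding \<Theta>_def by (intro continuous_intros contG contk cont\<xi>)
  then have "isCont \<Theta> w0" using rk by (simp add: continuous_on_eq_continuous_at)
  moreover have "\<Theta> w0 < 0" using px \<epsilon> m knz[of w0] rk by (simp add: \<Theta>_def \<xi>(2))
  ultimately have "\<forall>\<^sub>F s in nhds w0. \<Theta> s < 0"
    by (auto simp: isCont_def tendsto_at_iff_tendsto_nhds intro: order_tendstoD(2))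
  then obtain r' where r': "r' > 0" "\<And>s. s \<in> ball w0 r' \<Longrightarrow> \<Theta> s < 0"
    by (auto simp: eventually_nhds_metric dist_commute)
  show ?thesis
  proof
    show "0 < min (min rk r') d" using r rk r' by simp
    fix x w assume *: "x \<in> ball x0 (min (min rk r') d)" "w \<in> ball w0 (min (min rk r') d)" "p x w = 0"
      and "x \<noteq> x0"
    have w: "w \<in> ball w0 rk" "w \<in> ball w0 r" using * rk by auto
    have x: "x = \<xi> w" using graph[of x w] * w by auto
    then have "w \<noteq> w0" using \<open>x \<noteq> x0\<close> \<xi>(2) by auto
    then have pos: "norm ((w - w0) ^ (m - 1)) > 0" by simp
    have "\<Theta> w < 0" using * by (intro r') auto
    then have "norm ((w - w0) ^ (m - 1)) * norm (G x w * ((w - w0) * k w)) <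
      norm ((w - w0) ^ (m - 1)) * (\<epsilon> * (norm (px x w) * norm (of_nat m * k w + (w - w0) * deriv k w)))"
      using pos unfolding \<Theta>_def x by (intro mult_strict_left_mono) auto
    also have "\<dots> = \<epsilon> * norm (pw x w)"
      unfolding x pw_eq[OF w(1)] by (simp only: norm_mult norm_minus_cancel mult_ac)
    also have "norm ((w - w0) ^ (m - 1)) * norm (G x w * ((w - w0) * k w)) = norm (G x w * (x - x0))"
    proof -
      have "x - x0 = (w - w0) ^ (m - 1) * ((w - w0) * k w)"
        using fact[OF w(1)] m x by (cases m) auto
      then show ?thesis by (simp only: norm_mult mult_ac)
    qed
    finally show "pw x w \<noteq> 0 \<and> norm (G x w * (x - x0)) \<le> \<epsilon> * norm (pw x w)"
      by (auto simp: not_less)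
  qed
qed

text \<open>The local radii are replaced by their minimum over the finite fibre, and continuity of
  the roots puts every nearby root into one of the resulting discs.\<close>

lemma fibre_estimate:
  assumes G: "regular_function G" and \<epsilon>: "0 < \<epsilon>"
  obtains r where "0 < r" "\<And>x w. x \<in> ball x0 r \<Longrightarrow> p x w = 0 \<Longrightarrow> x \<noteq> x0 \<Longrightarrow>
       pw x w \<noteq> 0 \<and> norm (G x w * (x - x0)) \<le> \<epsilon> * norm (pw x w)"
proof -
  have "\<forall>w0\<in>roots x0. \<exists>d>0. \<forall>x w. x \<in> ball x0 d \<and> w \<in> ball w0 d \<and> p x w = 0 \<and> x \<noteq> x0 \<longrightarrow>
       pw x w \<noteq> 0 \<and> norm (G x w * (x - x0)) \<le> \<epsilon> * norm (pw x w)"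
  proof
    fix w0 assume "w0 \<in> roots x0"
    then have "p x0 w0 = 0" by (simp add: roots_def)
    then show "\<exists>d>0. \<forall>x w. x \<in> ball x0 d \<and> w \<in> ball w0 d \<and> p x w = 0 \<and> x \<noteq> x0 \<longrightarrow>
       pw x w \<noteq> 0 \<and> norm (G x w * (x - x0)) \<le> \<epsilon> * norm (pw x w)"
      by (rule local_estimate[OF G _ \<epsilon>]) blast
  qed
  then obtain d where d: "\<And>w0. w0 \<in> roots x0 \<Longrightarrow> d w0 > 0" and
    est: "\<And>w0 x w. w0 \<in> roots x0 \<Longrightarrow> x \<in> ball x0 (d w0) \<Longrightarrow> w \<in> ball w0 (d w0) \<Longrightarrow>
       p x w = 0 \<Longrightarrow> x \<noteq> x0 \<Longrightarrow> pw x w \<noteq> 0 \<and> norm (G x w * (x - x0)) \<le> \<epsilon> * norm (pw x w)"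
    unfolding bchoice_iff by blast
  define D where "D = Min (insert 1 (d ` roots x0))"
  have D: "D > 0" using d by (auto simp: D_def finite_roots)
  have Dle: "D \<le> d w0" if "w0 \<in> roots x0" for w0 using that by (auto simp: D_def finite_roots)
  obtain r where r: "0 < r" "\<And>x w. x \<in> ball x0 r \<Longrightarrow> p x w = 0 \<Longrightarrow> \<exists>w0. p x0 w0 = 0 \<and> w \<in> ball w0 D"
    by (rule roots_near[OF D, of x0]) blast
  show ?thesis
  proof
    show "0 < min r D" using r D by simp
    fix x w assume *: "x \<in> ball x0 (min r D)" "p x w = 0" "x \<noteq> x0"
    then obtain w0 where w0: "w0 \<in> roots x0" "w \<in> ball w0 D" using r(2)[of x w] by (auto simp: roots_def)
    show "pw x w \<noteq> 0 \<and> norm (G x w * (x - x0)) \<le> \<epsilon> * norm (pw x w)"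
      using * w0 Dle[OF w0(1)] by (intro est[OF w0(1)]) auto
  qed
qed

text \<open>For \<open>G = 0\<close> all that remains of the estimate is its claim
  \<open>pw \<noteq> 0\<close>.\<close>

lemma branch_points_isolated:
  obtains r where "0 < r" "\<And>x. x \<in> ball x0 r \<Longrightarrow> x \<noteq> x0 \<Longrightarrow> x \<notin> branch_points"
proof (rule fibre_estimate[of "\<lambda>_ _. 0" 1 x0])
  show "regular_function (\<lambda>_ _. 0)" by (simp add: regular_function_def)
qed (use that in \<open>auto simp: branch_points_def\<close>)

text \<open>At most \<open>n\<close> terms, each eventually bounded by \<open>\<epsilon>\<close>
  after multiplication by \<open>x - x0\<close>. This is the hypothesis of Riemann's theorem on
  removable singularities.\<close>

lemma fibre_trace_tendsto:
  assumes G: "regular_function G"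
  shows "((\<lambda>x. (x - x0) * fibre_trace G x) \<longlongrightarrow> 0) (at x0)"
proof (rule tendstoI)
  fix \<delta> :: real assume \<delta>: "0 < \<delta>"
  define \<epsilon> where "\<epsilon> = \<delta> / (real n + 1)"
  have \<epsilon>: "\<epsilon> > 0" using \<delta> by (simp add: \<epsilon>_def)
  obtain r where r: "0 < r" "\<And>x w. x \<in> ball x0 r \<Longrightarrow> p x w = 0 \<Longrightarrow> x \<noteq> x0 \<Longrightarrow>
       pw x w \<noteq> 0 \<and> norm (G x w * (x - x0)) \<le> \<epsilon> * norm (pw x w)"
    by (rule fibre_estimate[OF G \<epsilon>, of x0]) blast
  have "norm ((x - x0) * fibre_trace G x) < \<delta>" if x: "x \<in> ball x0 r" "x \<noteq> x0" for x
  proof -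
    have "norm ((x - x0) * fibre_trace G x) \<le> (\<Sum>w\<in>roots x. \<epsilon>)"
      unfolding fibre_trace_def sum_distrib_left
    proof (rule sum_norm_le)
      fix w assume "w \<in> roots x"
      then have "pw x w \<noteq> 0" "norm (G x w * (x - x0)) \<le> \<epsilon> * norm (pw x w)"
        using r(2)[OF x(1) _ x(2)] by (auto simp: roots_def)
      then show "norm ((x - x0) * (G x w / pw x w)) \<le> \<epsilon>"
        by (simp add: norm_mult norm_divide field_simps)
    qed
    also have "\<dots> = real (card (roots x)) * \<epsilon>" by simp
    also have "\<dots> \<le> real n * \<epsilon>" using \<epsilon> card_roots_le[of x] by (intro mult_right_mono) auto
    also have "\<dots> < \<delta>" using \<delta> by (simp add: \<epsilon>_def field_simps)
    finally show ?thesis .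
  qed
  then show "\<forall>\<^sub>F x in at x0. dist ((x - x0) * fibre_trace G x) 0 < \<delta>"
    using r(1) by (auto simp: eventually_at dist_commute intro!: exI[of _ r])
qed

text \<open>Near an unbranched point the fibre consists of the values of finitely many holomorphic
  sections, no two of which meet, so the trace is a finite sum of holomorphic functions.\<close>

lemma fibre_trace_holomorphic:
  assumes G: "regular_function G" and x0: "x0 \<notin> branch_points"
  obtains r where "0 < r" "fibre_trace G holomorphic_on ball x0 r"
proof -
  let ?R = "roots x0"
  \<comment> \<open>At most half the distance of any two roots: the discs of this radius around them
    are disjoint, so the sections \<open>\<psi> w0\<close> take different values.\<close>
  obtain \<delta> where \<delta>: "\<delta> > 0" "\<And>a b. a \<in> ?R \<Longrightarrow> b \<in> ?R \<Longrightarrow> a \<noteq> b \<Longrightarrow> 2 * \<delta> \<le> dist a b"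
  proof
    let ?D = "insert 1 ((\<lambda>(a, b). dist a b / 2) ` {(a, b) \<in> ?R \<times> ?R. a \<noteq> b})"
    have "finite {(a, b) \<in> ?R \<times> ?R. a \<noteq> b}"
      by (rule finite_subset[of _ "?R \<times> ?R"]) (blast, simp add: finite_roots)
    then have fin: "finite ?D" by simp
    then show "Min ?D > 0" by (subst Min_gr_iff) auto
    fix a b assume "a \<in> ?R" "b \<in> ?R" "a \<noteq> b"
    then have "Min ?D \<le> dist a b / 2" using fin by (intro Min_le) auto
    then show "2 * Min ?D \<le> dist a b" by simp
  qed
  have "\<forall>w0\<in>?R. \<exists>r d \<psi>. 0 < r \<and> 0 < d \<and> d \<le> \<delta> \<and> \<psi> holomorphic_on ball x0 r \<and>
      (\<forall>x\<in>ball x0 r. \<psi> x \<in> ball w0 d \<and> (\<forall>w\<in>ball w0 d. p x w = 0 \<longleftrightarrow> w = \<psi> x))"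
  proof
    fix w0 assume "w0 \<in> ?R"
    then have "p x0 w0 = 0" "pw x0 w0 \<noteq> 0" using x0 by (auto simp: roots_def branch_points_def)
    then show "\<exists>r d \<psi>. 0 < r \<and> 0 < d \<and> d \<le> \<delta> \<and> \<psi> holomorphic_on ball x0 r \<and>
      (\<forall>x\<in>ball x0 r. \<psi> x \<in> ball w0 d \<and> (\<forall>w\<in>ball w0 d. p x w = 0 \<longleftrightarrow> w = \<psi> x))"
      by (rule graph_over_x[OF _ _ \<delta>(1)]) blast
  qed
  then obtain r d \<psi> where
    r: "\<And>w0. w0 \<in> ?R \<Longrightarrow> 0 < r w0" and d: "\<And>w0. w0 \<in> ?R \<Longrightarrow> 0 < d w0" "\<And>w0. w0 \<in> ?R \<Longrightarrow> d w0 \<le> \<delta>"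
    and \<psi>: "\<And>w0. w0 \<in> ?R \<Longrightarrow> \<psi> w0 holomorphic_on ball x0 (r w0)"
    and \<psi>d: "\<And>w0 x. w0 \<in> ?R \<Longrightarrow> x \<in> ball x0 (r w0) \<Longrightarrow> \<psi> w0 x \<in> ball w0 (d w0)"
    and graph: "\<And>w0 x w. w0 \<in> ?R \<Longrightarrow> x \<in> ball x0 (r w0) \<Longrightarrow> w \<in> ball w0 (d w0) \<Longrightarrow>
      p x w = 0 \<longleftrightarrow> w = \<psi> w0 x"
    unfolding bchoice_iff by blast
  define D where "D = Min (insert 1 (d ` ?R))"
  have D: "D > 0" using d by (auto simp: D_def finite_roots)
  have Dle: "D \<le> d w0" if "w0 \<in> ?R" for w0 using that by (auto simp: D_def finite_roots)
  obtain r1 where r1: "0 < r1" "\<And>x w. x \<in> ball x0 r1 \<Longrightarrow> p x w = 0 \<Longrightarrow> \<exists>w0. p x0 w0 = 0 \<and> w \<in> ball w0 D"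
    by (rule roots_near[OF D, of x0]) blast
  obtain r2 where r2: "0 < r2" "\<And>x. x \<in> ball x0 r2 \<Longrightarrow> x \<noteq> x0 \<Longrightarrow> x \<notin> branch_points"
    by (rule branch_points_isolated[of x0]) blast
  define r0 where "r0 = Min (insert r1 (insert r2 (r ` ?R)))"
  have r0: "r0 > 0" "r0 \<le> r1" "r0 \<le> r2" "\<And>w0. w0 \<in> ?R \<Longrightarrow> r0 \<le> r w0"
  proof -
    have fin: "finite (insert r1 (insert r2 (r ` ?R)))" by (simp add: finite_roots)
    show "r0 > 0" unfolding r0_def using fin r r1 r2 by (subst Min_gr_iff) auto
    show "r0 \<le> r1" "r0 \<le> r2" "\<And>w0. w0 \<in> ?R \<Longrightarrow> r0 \<le> r w0"
      unfolding r0_def using fin by (auto intro: Min_le simp del: Min_insert)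
  qed
  have inr: "x \<in> ball x0 (r w0)" if "x \<in> ball x0 r0" "w0 \<in> ?R" for x w0
    using that r0(4)[OF that(2)] by auto
  have on_curve: "p x (\<psi> w0 x) = 0" if "x \<in> ball x0 r0" "w0 \<in> ?R" for x w0
    using graph \<psi>d inr that by blast
  have inj: "inj_on (\<lambda>w0. \<psi> w0 x) ?R" if x: "x \<in> ball x0 r0" for x
  proof
    fix a b assume ab: "a \<in> ?R" "b \<in> ?R" "\<psi> a x = \<psi> b x"
    have "dist a (\<psi> a x) < \<delta>" "dist b (\<psi> a x) < \<delta>"
      using \<psi>d[OF ab(1) inr[OF x ab(1)]] \<psi>d[OF ab(2) inr[OF x ab(2)]] ab d(2)[OF ab(1)] d(2)[OF ab(2)]
      by auto
    then have "dist a b < 2 * \<delta>" using dist_triangle2[of a b "\<psi> a x"] by linarith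
    then show "a = b" using \<delta>(2)[OF ab(1,2)] by force
  qed
  have roots_eq: "roots x = (\<lambda>w0. \<psi> w0 x) ` ?R" if x: "x \<in> ball x0 r0" for x
  proof
    show "(\<lambda>w0. \<psi> w0 x) ` ?R \<subseteq> roots x" using on_curve[OF x] by (auto simp: roots_def)
    show "roots x \<subseteq> (\<lambda>w0. \<psi> w0 x) ` ?R"
    proof
      fix w assume w: "w \<in> roots x"
      then obtain w0 where w0: "w0 \<in> ?R" "w \<in> ball w0 D"
        using r1(2)[of x w] x r0 by (auto simp: roots_def)
      then have "w \<in> ball w0 (d w0)" using Dle[OF w0(1)] by auto
      then have "w = \<psi> w0 x" using graph[OF w0(1) inr[OF x w0(1)]] w by (auto simp: roots_def)
      then show "w \<in> (\<lambda>w0. \<psi> w0 x) ` ?R" using w0 by blast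
    qed
  qed
  have fibre_trace_eq: "fibre_trace G x = (\<Sum>w0\<in>?R. G x (\<psi> w0 x) / pw x (\<psi> w0 x))" if x: "x \<in> ball x0 r0" for x
    unfolding fibre_trace_def roots_eq[OF x] by (subst sum.reindex[OF inj[OF x]]) simp
  have nz: "pw x (\<psi> w0 x) \<noteq> 0" if "x \<in> ball x0 r0" "w0 \<in> ?R" for x w0
    using r2(2)[of x] x0 that r0 on_curve[OF that] by (cases "x = x0") (auto simp: branch_points_def)
  have h\<psi>: "\<psi> w0 holomorphic_on ball x0 r0" if "w0 \<in> ?R" for w0
    using \<psi>[OF that] inr that by (meson holomorphic_on_subset subsetI)
  have "(\<lambda>x. \<Sum>w0\<in>?R. G x (\<psi> w0 x) / pw x (\<psi> w0 x)) holomorphic_on ball x0 r0"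
  proof (intro holomorphic_on_sum holomorphic_on_divide)
    fix w0 assume w0: "w0 \<in> ?R"
    show "(\<lambda>x. G x (\<psi> w0 x)) holomorphic_on ball x0 r0"
      using G h\<psi>[OF w0] on_curve w0 unfolding regular_function_def by (metis open_ball)
    show "(\<lambda>x. pw x (\<psi> w0 x)) holomorphic_on ball x0 r0"
      by (intro holomorphic_on_pw h\<psi>[OF w0] holomorphic_on_ident)
    show "\<And>x. x \<in> ball x0 r0 \<Longrightarrow> pw x (\<psi> w0 x) \<noteq> 0" using nz w0 by blast
  qed
  then have "fibre_trace G holomorphic_on ball x0 r0"
    by (rule holomorphic_transform) (simp add: fibre_trace_eq)
  with r0(1) that show ?thesis by blast
qed

text \<open>Branch points are isolated and the trace grows more slowly there than
  \<open>1 / (x - x0)\<close>, so every singularity is removable.\<close>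

lemma fibre_trace_extends:
  assumes G: "regular_function G"
  obtains A where "A holomorphic_on UNIV" "\<And>x. x \<notin> branch_points \<Longrightarrow> A x = fibre_trace G x"
proof -
  define A where "A x = (if x \<in> branch_points then Lim (at x) (fibre_trace G) else fibre_trace G x)" for x
  have "\<exists>r>0. A holomorphic_on ball x0 r" for x0
  proof -
    obtain r where r: "0 < r" "\<And>x. x \<in> ball x0 r \<Longrightarrow> x \<noteq> x0 \<Longrightarrow> x \<notin> branch_points"
      by (rule branch_points_isolated[of x0]) blast
    have "fibre_trace G holomorphic_on ball x0 r - {x0}"
    proof (rule holomorphic_onI)
      fix x assume "x \<in> ball x0 r - {x0}"
      then have "x \<notin> branch_points" using r by auto
      then obtain r' where "0 < r'" "fibre_trace G holomorphic_on ball x r'"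
        by (rule fibre_trace_holomorphic[OF G])
      then show "fibre_trace G field_differentiable at x within ball x0 r - {x0}"
        by (metis centre_in_ball field_differentiable_at_within holomorphic_on_imp_differentiable_at open_ball)
    qed
    then obtain g where g: "g holomorphic_on ball x0 r" "\<And>x. x \<in> ball x0 r - {x0} \<Longrightarrow> g x = fibre_trace G x"
      using holomorphic_on_extend_lim[of "fibre_trace G" "ball x0 r" x0] fibre_trace_tendsto[OF G, of x0] r(1)
      by auto
    have "A x = g x" if x: "x \<in> ball x0 r" for x
    proof (cases "x \<in> branch_points")
      case False
      show ?thesis
      proof (cases "x = x0")
        case True
        obtain r' where r': "0 < r'" "fibre_trace G holomorphic_on ball x0 r'"
          by (rule fibre_trace_holomorphic[OF G False]) (use True in blast)
        have "isCont g x0"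
          using holomorphic_on_imp_continuous_on[OF g(1)] r(1) by (simp add: continuous_on_eq_continuous_at)
        moreover have "isCont (fibre_trace G) x0"
          using holomorphic_on_imp_continuous_on[OF r'(2)] r'(1) by (simp add: continuous_on_eq_continuous_at)
        moreover have "\<forall>\<^sub>F x in at x0. g x = fibre_trace G x"
          using r(1) g(2) by (auto simp: eventually_at dist_commute intro!: exI[of _ r])
        ultimately have "g x0 = fibre_trace G x0"
          by (rule isCont_eq_if_eventually_eq)
        with True False show ?thesis by (simp add: A_def)
      qed (use g x False in \<open>auto simp: A_def\<close>)
    next
      case True
      then have x0: "x = x0" using r x by blast
      have "isCont g x0"
        using holomorphic_on_imp_continuous_on[OF g(1)] r(1) by (simp add: continuous_on_eq_continuous_at)
      moreover have "\<forall>\<^sub>F x in at x0. g x = fibre_trace G x"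
        using r(1) g(2) by (auto simp: eventually_at dist_commute intro!: exI[of _ r])
      ultimately have "(fibre_trace G \<longlongrightarrow> g x0) (at x0)"
        using Lim_transform_eventually[OF isContD] by blast
      then show ?thesis using True x0 by (auto simp: A_def intro: tendsto_Lim)
    qed
    then have "A holomorphic_on ball x0 r" using holomorphic_transform[OF g(1)] by metis
    with r(1) show ?thesis by blast
  qed
  then have "A holomorphic_on UNIV"
    by (metis UNIV_I analytic_on_def analytic_imp_holomorphic)
  then show ?thesis by (rule that) (simp add: A_def)
qed

text \<open>Lagrange interpolation at the simple roots of \<open>p x\<close>, with \<open>(p x w0 - p x w) / (w0 - w)\<close> expanded
  in powers of \<open>w0\<close> and \<open>w\<close>.\<close>

lemma interpolation_unbranched:
  assumes x: "x \<notin> branch_points" and w0: "p x w0 = 0"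
  shows "G x w0 = (\<Sum>l\<le>n. c l x * (\<Sum>m<l. w0 ^ m * fibre_trace (\<lambda>x w. G x w * w ^ (l - Suc m)) x))"
proof -
  define D where "D w = (\<Sum>l\<le>n. c l x * (\<Sum>m<l. w0 ^ m * w ^ (l - Suc m)))" for w
  have "(\<Sum>l\<le>n. c l x * (\<Sum>m<l. w0 ^ m * fibre_trace (\<lambda>x w. G x w * w ^ (l - Suc m)) x)) =
    (\<Sum>l\<le>n. \<Sum>m<l. \<Sum>w\<in>roots x. c l x * (w0 ^ m * (G x w * w ^ (l - Suc m) / pw x w)))"
    by (simp add: fibre_trace_def sum_distrib_left)
  also have "\<dots> = (\<Sum>l\<le>n. \<Sum>w\<in>roots x. \<Sum>m<l. c l x * (w0 ^ m * (G x w * w ^ (l - Suc m) / pw x w)))"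
    by (intro sum.cong refl sum.swap)
  also have "\<dots> = (\<Sum>w\<in>roots x. \<Sum>l\<le>n. \<Sum>m<l. c l x * (w0 ^ m * (G x w * w ^ (l - Suc m) / pw x w)))"
    by (rule sum.swap)
  also have "\<dots> = (\<Sum>w\<in>roots x. G x w / pw x w * D w)"
    unfolding D_def sum_distrib_left by (intro sum.cong refl) (simp add: algebra_simps)
  also have "\<dots> = (\<Sum>w\<in>roots x. if w = w0 then G x w0 else 0)"
  proof (intro sum.cong refl)
    fix w assume w: "w \<in> roots x"
    \<comment> \<open>\<open>D w\<close> is the difference quotient of \<open>p x\<close> between
      \<open>w0\<close> and \<open>w\<close>: it vanishes at every other root and equals
      \<open>pw x w0\<close> at \<open>w0\<close>, so one term of the sum survives.\<close>
    have diff: "(w0 - w) * D w = p x w0 - p x w"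
      unfolding D_def p_def sum_distrib_left sum_subtractf[symmetric] right_diff_distrib[symmetric]
      by (simp add: power_diff_sumr2 sum_distrib_left algebra_simps)
    show "G x w / pw x w * D w = (if w = w0 then G x w0 else 0)"
    proof (cases "w = w0")
      case True
      have "D w0 = pw x w0"
        unfolding D_def pw_def
      proof (intro sum.cong refl arg_cong[where f = "(*) _"])
        fix l
        have "(\<Sum>m<l. w0 ^ m * w0 ^ (l - Suc m)) = (\<Sum>m<l. w0 ^ (l - 1))"
          by (intro sum.cong refl) (simp flip: power_add)
        then show "(\<Sum>m<l. w0 ^ m * w0 ^ (l - Suc m)) = of_nat l * w0 ^ (l - 1)" by simp
      qed
      moreover have "pw x w0 \<noteq> 0" using x w0 by (auto simp: branch_points_def)
      ultimately show ?thesis using True by simp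
    next
      case False
      then have "D w = 0" using diff w0 w by (auto simp: roots_def)
      then show ?thesis using False by simp
    qed
  qed
  also have "\<dots> = G x w0" using w0 finite_roots by (simp add: roots_def)
  finally show ?thesis by simp
qed

lemma regular_function_mult_power:
  "regular_function G \<Longrightarrow> regular_function (\<lambda>x w. G x w * w ^ j)"
  unfolding regular_function_def by (intro conjI allI impI holomorphic_intros) auto

text \<open>Both sides are continuous along a local parametrization of the curve and agree over
  unbranched \<open>x\<close>, hence also over branch points.\<close>

lemma interpolation:
  assumes G: "regular_function G"
    and A: "\<And>j. continuous_on UNIV (A j)"
      "\<And>j x. x \<notin> branch_points \<Longrightarrow> A j x = fibre_trace (\<lambda>x w. G x w * w ^ j) x"
    and pt: "p x0 w0 = 0"
  shows "G x0 w0 = (\<Sum>l\<le>n. c l x0 * (\<Sum>m<l. w0 ^ m * A (l - Suc m) x0))"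
proof -
  define I where "I x w = (\<Sum>l\<le>n. c l x * (\<Sum>m<l. w ^ m * A (l - Suc m) x))" for x w
  have contI: "continuous_on S (\<lambda>s. I (f s) (g s))" if "continuous_on S f" "continuous_on S g"
    for S and f g :: "complex \<Rightarrow> complex"
    unfolding I_def
    by (intro continuous_intros continuous_on_c that continuous_on_compose2[OF A(1) that(1)] subset_UNIV)
  have good: "G x w = I x w" if "x \<notin> branch_points" "p x w = 0" for x w
    using interpolation_unbranched[OF that, of G] A(2)[OF that(1)] by (simp add: I_def)
  obtain rb where rb: "0 < rb" "\<And>x. x \<in> ball x0 rb \<Longrightarrow> x \<noteq> x0 \<Longrightarrow> x \<notin> branch_points"
    by (rule branch_points_isolated[of x0]) blast
  have eq: "f s0 = g s0" if "0 < r" "continuous_on (ball s0 r) f" "continuous_on (ball s0 r) g"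
     "\<forall>\<^sub>F s in at s0. f s = g s" for f g :: "complex \<Rightarrow> complex" and s0 r
  proof -
    have "isCont f s0" "isCont g s0"
      using that by (simp_all add: continuous_on_eq_continuous_at)
    then show ?thesis using that(4) by (rule isCont_eq_if_eventually_eq)
  qed
  show ?thesis
  proof (cases "pw x0 w0 = 0")
    case False
    obtain r d \<psi> where r: "0 < r" "0 < d" and \<psi>: "\<psi> holomorphic_on ball x0 r" "\<psi> x0 = w0"
      and in_d: "\<And>x. x \<in> ball x0 r \<Longrightarrow> \<psi> x \<in> ball w0 d"
      and graph: "\<And>x w. x \<in> ball x0 r \<Longrightarrow> w \<in> ball w0 d \<Longrightarrow> p x w = 0 \<longleftrightarrow> w = \<psi> x"
      by (rule graph_over_x[OF pt False zero_less_one]) blast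
    have on_curve: "p s (\<psi> s) = 0" if "s \<in> ball x0 r" for s using graph in_d that by blast
    have "G x0 (\<psi> x0) = I x0 (\<psi> x0)"
    proof (rule eq[OF r(1), of x0 "\<lambda>s. G s (\<psi> s)" "\<lambda>s. I s (\<psi> s)"])
      show "continuous_on (ball x0 r) (\<lambda>s. G s (\<psi> s))"
        using G \<psi> on_curve unfolding regular_function_def
        by (metis open_ball holomorphic_on_imp_continuous_on)
      show "continuous_on (ball x0 r) (\<lambda>s. I s (\<psi> s))"
        by (intro contI continuous_on_id holomorphic_on_imp_continuous_on[OF \<psi>(1)])
      have "\<forall>\<^sub>F s in at x0. s \<in> ball x0 r \<and> s \<in> ball x0 rb \<and> s \<noteq> x0"
        using r rb by (auto simp: eventually_at dist_commute intro!: exI[of _ "min r rb"])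
      then show "\<forall>\<^sub>F s in at x0. G s (\<psi> s) = I s (\<psi> s)"
        by eventually_elim (use good rb on_curve in blast)
    qed
    then show ?thesis using \<psi>(2) by (simp add: I_def)
  next
    case True
    with smooth_point[OF pt] have px: "px x0 w0 \<noteq> 0" by simp
    \<comment> \<open>The prescribed bound on the radius of the target disc is used here:
      \<open>d \<le> rb\<close> keeps \<open>\<xi> s\<close> where only \<open>x0\<close> can be a
      branch point, and \<open>\<xi> s = x0\<close> holds only for \<open>s\<close> in the finite
      fibre over \<open>x0\<close>.\<close>
    obtain r d \<xi> where r: "0 < r" "0 < d" "d \<le> rb" and \<xi>: "\<xi> holomorphic_on ball w0 r" "\<xi> w0 = x0"
      and in_d: "\<And>w. w \<in> ball w0 r \<Longrightarrow> \<xi> w \<in> ball x0 d"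
      and graph: "\<And>x w. x \<in> ball x0 d \<Longrightarrow> w \<in> ball w0 r \<Longrightarrow> p x w = 0 \<longleftrightarrow> x = \<xi> w"
      by (rule graph_over_w[OF pt px rb(1)]) blast
    have on_curve: "p (\<xi> s) s = 0" if "s \<in> ball w0 r" for s using graph in_d that by blast
    have "G (\<xi> w0) w0 = I (\<xi> w0) w0"
    proof (rule eq[OF r(1), of w0 "\<lambda>s. G (\<xi> s) s" "\<lambda>s. I (\<xi> s) s"])
      show "continuous_on (ball w0 r) (\<lambda>s. G (\<xi> s) s)"
        using G \<xi> on_curve unfolding regular_function_def
        by (metis open_ball holomorphic_on_imp_continuous_on)
      show "continuous_on (ball w0 r) (\<lambda>s. I (\<xi> s) s)"
        by (intro contI continuous_on_id holomorphic_on_imp_continuous_on[OF \<xi>(1)])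
      have "\<forall>\<^sub>F s in at w0. s \<in> ball w0 r"
        using r by (auto simp: eventually_at dist_commute intro!: exI[of _ r])
      moreover have "\<forall>\<^sub>F s in at w0. s \<notin> roots x0"
        using islimpt_finite[OF finite_roots, of w0 x0] by (simp add: islimpt_iff_eventually)
      ultimately show "\<forall>\<^sub>F s in at w0. G (\<xi> s) s = I (\<xi> s) s"
      proof eventually_elim
        case (elim s)
        then have "\<xi> s \<noteq> x0" using on_curve by (auto simp: roots_def)
        moreover have "\<xi> s \<in> ball x0 rb" using in_d[of s] elim r by auto
        ultimately show ?case using rb good on_curve elim by blast
      qed
    qed
    then show ?thesis using \<xi>(2) by (simp add: I_def)
  qed
qed

text \<open>On an unbranched fibre, \<open>e\<close> times the sum minus \<open>\<delta>\<close>
  times \<open>p\<close> has degree less than \<open>n\<close> in \<open>w\<close> but vanishes at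
  \<open>n\<close> distinct points, so it is zero; continuity in \<open>x\<close> handles the branch
  points.\<close>

lemma vanishing_on_curve:
  assumes d: "\<And>l. l \<le> n \<Longrightarrow> continuous_on UNIV (d l)" "\<And>x. d n x = \<delta>"
    and van: "\<And>x w. p x w = 0 \<Longrightarrow> (\<Sum>l\<le>n. d l x * w ^ l) = 0"
  shows "e * (\<Sum>l\<le>n. d l x * w ^ l) = \<delta> * p x w"
proof -
  have unbranched: "e * (\<Sum>l\<le>n. d l x * w ^ l) = \<delta> * p x w" if x: "x \<notin> branch_points" for x
  proof -
    define r where "r = (\<Sum>l<n. monom (e * d l x - \<delta> * c l x) l)"
    have r: "poly r w = e * (\<Sum>l\<le>n. d l x * w ^ l) - \<delta> * p x w" for w
      unfolding r_def p_def lessThan_Suc_atMost[symmetric]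
      by (simp add: poly_sum poly_monom lead d(2) sum_distrib_left sum_subtractf algebra_simps)
    have "r = 0"
    proof (rule ccontr)
      assume "r \<noteq> 0"
      then have "n \<noteq> 0" by (auto simp: r_def intro: ccontr)
      then have "degree r < n"
        unfolding r_def by (intro degree_sum_less) (auto intro: le_less_trans[OF degree_monom_le])
      moreover have "card (roots x) \<le> card {w. poly r w = 0}"
        using poly_roots_finite[OF \<open>r \<noteq> 0\<close>] van by (intro card_mono) (auto simp: roots_def r)
      ultimately show False using card_poly_roots_bound[OF \<open>r \<noteq> 0\<close>] card_roots[OF x] by linarith
    qed
    then show ?thesis using r[of w] by simp
  qed
  obtain rb where rb: "0 < rb" "\<And>x'. x' \<in> ball x rb \<Longrightarrow> x' \<noteq> x \<Longrightarrow> x' \<notin> branch_points"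
    by (rule branch_points_isolated[of x]) blast
  show ?thesis
  proof (rule isCont_eq_if_eventually_eq[of x "\<lambda>x. e * (\<Sum>l\<le>n. d l x * w ^ l)" "\<lambda>x. \<delta> * p x w"])
    have "continuous_on UNIV (\<lambda>x. e * (\<Sum>l\<le>n. d l x * w ^ l))"
      by (intro continuous_intros d) auto
    then show "isCont (\<lambda>x. e * (\<Sum>l\<le>n. d l x * w ^ l)) x"
      by (simp add: continuous_on_eq_continuous_at)
    have "continuous_on UNIV (\<lambda>x. \<delta> * p x w)" by (intro continuous_intros)
    then show "isCont (\<lambda>x. \<delta> * p x w) x" by (simp add: continuous_on_eq_continuous_at)
    show "\<forall>\<^sub>F x in at x. e * (\<Sum>l\<le>n. d l x * w ^ l) = \<delta> * p x w"
      using rb unbranched by (auto simp: eventually_at dist_commute intro!: exI[of _ rb])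
  qed
qed

end

section \<open>Sections on a smooth plane quartic\<close>

text \<open>\<open>A\<close> and \<open>B\<close> are the two local expressions of a section of O(n)
  on the projective line. Boundedness of \<open>B\<close> on the unit disc is the growth condition
  that makes \<open>A\<close> a polynomial of degree at most \<open>n\<close>.\<close>

lemma reciprocal_entire:
  assumes A: "A holomorphic_on UNIV" and B: "B holomorphic_on UNIV"
    and AB: "\<And>x. x \<noteq> 0 \<Longrightarrow> A x = x ^ n * B (1 / x)"
  obtains a :: "nat \<Rightarrow> complex" where "\<And>x. A x = (\<Sum>i\<le>n. a i * x ^ i)"
    "\<And>y. B y = (\<Sum>i\<le>n. a i * y ^ (n - i))"
proof -
  have contB: "continuous_on UNIV B" by (rule holomorphic_on_imp_continuous_on[OF B])
  have "compact (B ` cball 0 1)"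
    by (intro compact_continuous_image compact_cball continuous_on_subset[OF contB]) auto
  then have "bounded (B ` cball 0 1)" by (rule compact_imp_bounded)
  then obtain M where M: "\<And>y. norm y \<le> 1 \<Longrightarrow> norm (B y) \<le> M"
    unfolding bounded_iff by (metis imageI mem_cball_0)
  have "norm (A x) \<le> M * norm x ^ n" if x: "1 \<le> norm x" for x
  proof -
    have "x \<noteq> 0" "norm (1 / x) \<le> 1" using x by (auto simp: norm_divide divide_le_eq_1)
    then show ?thesis using AB[of x] M[of "1 / x"]
      by (simp add: norm_mult norm_power mult.commute mult_right_mono)
  qed
  then have A_eq: "A x = (\<Sum>i\<le>n. (deriv ^^ i) A 0 / fact i * x ^ i)" for x
    by (rule Liouville_polynomial[OF A])
  define a where "a i = (deriv ^^ i) A 0 / fact i" for i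
  have B_eq: "B y = (\<Sum>i\<le>n. a i * y ^ (n - i))" if y: "y \<noteq> 0" for y
  proof -
    have "B y = y ^ n * A (1 / y)" using AB[of "1 / y"] y by (simp add: power_one_over)
    also have "\<dots> = (\<Sum>i\<le>n. a i * y ^ (n - i))"
      unfolding A_eq[of "1 / y"] sum_distrib_left a_def
      using y by (intro sum.cong refl) (simp add: power_diff power_one_over field_simps)
    finally show ?thesis .
  qed
  have "B 0 = (\<Sum>i\<le>n. a i * 0 ^ (n - i))"
  proof (rule isCont_eq_if_eventually_eq[of 0 B "\<lambda>y. \<Sum>i\<le>n. a i * y ^ (n - i)"])
    show "isCont B 0" using contB by (simp add: continuous_on_eq_continuous_at)
    show "isCont (\<lambda>y. \<Sum>i\<le>n. a i * y ^ (n - i)) 0" by (intro continuous_intros)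
    show "\<forall>\<^sub>F y in at 0. B y = (\<Sum>i\<le>n. a i * y ^ (n - i))"
      using B_eq by (auto simp: eventually_at_filter)
  qed
  with B_eq have "B y = (\<Sum>i\<le>n. a i * y ^ (n - i))" for y by (cases "y = 0") auto
  with A_eq that[of a] show ?thesis by (simp add: a_def)
qed

text \<open>The case of negative degree \<open>-n\<close>: \<open>x^n A\<close> is a constant, and
  it vanishes at 0.\<close>

lemma reciprocal_entire_zero:
  assumes A: "A holomorphic_on UNIV" and B: "B holomorphic_on UNIV" and n: "0 < n"
    and AB: "\<And>x :: complex. x \<noteq> 0 \<Longrightarrow> x ^ n * A x = B (1 / x)"
  shows "A x = 0" "B x = 0"
proof -
  obtain a :: "nat \<Rightarrow> complex" where a: "\<And>x. x ^ n * A x = (\<Sum>i\<le>0. a i * x ^ i)"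
    "\<And>y. B y = (\<Sum>i\<le>0. a i * y ^ (0 - i))"
    by (rule reciprocal_entire[of "\<lambda>x. x ^ n * A x" B 0])
      (use A B AB in \<open>auto intro!: holomorphic_intros\<close>)
  have "a 0 = 0" using a(1)[of 0] n by (cases n) auto
  with a have *: "x ^ n * A x = 0" "B x = 0" for x by auto
  show "B x = 0" by (rule *)
  have nz: "A y = 0" if "y \<noteq> 0" for y using *(1)[of y] that by simp
  have "isCont A 0"
    using holomorphic_on_imp_continuous_on[OF A] by (simp add: continuous_on_eq_continuous_at)
  then have "A 0 = 0"
    by (rule isCont_eq_if_eventually_eq) (use nz in \<open>auto simp: eventually_at_filter\<close>)
  with nz show "A x = 0" by (cases "x = 0") auto
qed

section \<open>Quadratic polynomials, conics and the equation of the quartic\<close>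

lemma quadratic_root_exists:
  fixes a b c :: complex assumes "a \<noteq> 0"
  obtains z where "a * z\<^sup>2 + b * z + c = 0"
proof
  let ?s = "csqrt (b\<^sup>2 - 4 * a * c)"
  let ?z = "(?s - b) / (2 * a)"
  have "?s = 2 * a * ?z + b" using assms by simp
  then have "(2 * a * ?z + b)\<^sup>2 = b\<^sup>2 - 4 * a * c" using power2_csqrt[of "b\<^sup>2 - 4 * a * c"] by metis
  then have "4 * a * (a * ?z\<^sup>2 + b * ?z + c) = 0" by (simp only: power2_eq_square) algebra
  with assms show "a * ?z\<^sup>2 + b * ?z + c = 0" by simp
qed

lemma quadratic_product_zero:
  fixes a b c :: complex
  assumes "\<And>w. (a * w\<^sup>2 + b * w + c) * (a' * w\<^sup>2 + b' * w + c') = 0" and "a \<noteq> 0"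
  shows "a' = 0 \<and> b' = 0 \<and> c' = 0"
proof -
  have "poly ([:c, b, a:] * [:c', b', a':]) w = 0" for w
    using assms(1)[of w] by (simp add: power2_eq_square algebra_simps)
  then have "[:c, b, a:] * [:c', b', a':] = 0" using poly_all_0_iff_0 by blast
  moreover have "[:c, b, a:] \<noteq> 0" using assms(2) by simp
  ultimately have "[:c', b', a':] = 0" by (simp only: mult_eq_0_iff) blast
  then show ?thesis by simp
qed

text \<open>Ternary forms stand for quadratic forms on the plane \<open>x + y + z + t = 0\<close>:
  here \<open>w\<close> is the third coordinate, and \<open>t = - (x + y + w)\<close> is
  eliminated.\<close>

definition quad :: "(nat \<Rightarrow> complex) \<Rightarrow> complex \<Rightarrow> complex \<Rightarrow> complex \<Rightarrow> complex" where
  "quad a x y w = a 1 * x\<^sup>2 + a 2 * y\<^sup>2 + a 3 * w\<^sup>2 + a 4 * x * y + a 5 * x * w + a 6 * y * w"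

lemma quad_scale: "quad a (c * x) (c * y) (c * w) = c\<^sup>2 * quad a x y w"
  by (simp add: quad_def power2_eq_square algebra_simps)

lemma quad_diff: "quad (\<lambda>i. a i - c * b i) x y w = quad a x y w - c * quad b x y w"
  by (simp add: quad_def algebra_simps)

lemma quad_zero_coeffs:
  assumes "\<And>x y w. x \<noteq> 0 \<Longrightarrow> y \<noteq> 0 \<Longrightarrow> w \<noteq> 0 \<Longrightarrow> quad a x y w = 0"
  shows "quad a x y w = 0"
proof -
  \<comment> \<open>Six points with non-zero coordinates that impose independent conditions on
    conics.\<close>
  have "a 1 + a 2 + a 3 + a 4 + a 5 + a 6 = 0" "a 1 + a 2 + a 3 + a 4 - a 5 - a 6 = 0"
    "a 1 + a 2 + a 3 - a 4 + a 5 - a 6 = 0" "a 1 + a 2 + a 3 - a 4 - a 5 + a 6 = 0"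
    "a 1 + a 2 + 4 * a 3 + a 4 + 2 * a 5 + 2 * a 6 = 0"
    "a 1 + 4 * a 2 + a 3 + 2 * a 4 + a 5 + 2 * a 6 = 0"
    using assms[of 1 1 1] assms[of 1 1 "-1"] assms[of 1 "-1" 1] assms[of "-1" 1 1] assms[of 1 1 2] assms[of 1 2 1]
    by (simp_all add: quad_def mult.commute)
  then have "a 1 = 0 \<and> a 2 = 0 \<and> a 3 = 0 \<and> a 4 = 0 \<and> a 5 = 0 \<and> a 6 = 0" by algebra
  then show ?thesis by (simp add: quad_def)
qed

text \<open>The equation of D after the elimination of \<open>t\<close>, which turns
  \<open>- x y z t\<close> into \<open>x y w (x + y + w)\<close>. The three expressions in the
  conclusion are its partial derivatives.\<close>

locale plane_quartic =
  fixes q :: "nat \<Rightarrow> complex"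
  assumes smooth: "\<And>x y w. (quad q x y w)\<^sup>2 + x * y * w * (x + y + w) = 0 \<Longrightarrow> x \<noteq> 0 \<or> y \<noteq> 0 \<or> w \<noteq> 0 \<Longrightarrow>
    2 * quad q x y w * (2 * q 1 * x + q 4 * y + q 5 * w) + y * w * (x + y + w) + x * y * w \<noteq> 0 \<or>
    2 * quad q x y w * (2 * q 2 * y + q 4 * x + q 6 * w) + x * w * (x + y + w) + x * y * w \<noteq> 0 \<or>
    2 * quad q x y w * (2 * q 3 * w + q 5 * x + q 6 * y) + x * y * (x + y + w) + x * y * w \<noteq> 0"
begin

definition quartic :: "complex \<Rightarrow> complex \<Rightarrow> complex \<Rightarrow> complex" where
  "quartic x y w = (quad q x y w)\<^sup>2 + x * y * w * (x + y + w)"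

definition quartic_x :: "complex \<Rightarrow> complex \<Rightarrow> complex \<Rightarrow> complex" where
  "quartic_x x y w = 2 * quad q x y w * (2 * q 1 * x + q 4 * y + q 5 * w) + y * w * (x + y + w) + x * y * w"

definition quartic_y :: "complex \<Rightarrow> complex \<Rightarrow> complex \<Rightarrow> complex" where
  "quartic_y x y w = 2 * quad q x y w * (2 * q 2 * y + q 4 * x + q 6 * w) + x * w * (x + y + w) + x * y * w"

definition quartic_w :: "complex \<Rightarrow> complex \<Rightarrow> complex \<Rightarrow> complex" where
  "quartic_w x y w = 2 * quad q x y w * (2 * q 3 * w + q 5 * x + q 6 * y) + x * y * (x + y + w) + x * y * w"

definition cone_D :: "complex \<Rightarrow> complex \<Rightarrow> complex \<Rightarrow> bool" where
  "cone_D x y w \<longleftrightarrow> quartic x y w = 0 \<and> (x \<noteq> 0 \<or> y \<noteq> 0 \<or> w \<noteq> 0)"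

lemma smoothD: "cone_D x y w \<Longrightarrow> quartic_x x y w \<noteq> 0 \<or> quartic_y x y w \<noteq> 0 \<or> quartic_w x y w \<noteq> 0"
  unfolding cone_D_def quartic_def quartic_x_def quartic_y_def quartic_w_def using smooth by blast

lemma euler: "x * quartic_x x y w + y * quartic_y x y w + w * quartic_w x y w = 4 * quartic x y w"
  unfolding quartic_def quartic_x_def quartic_y_def quartic_w_def quad_def power2_eq_square by algebra

lemma cone_D_scale: "c \<noteq> 0 \<Longrightarrow> cone_D (c * x) (c * y) (c * w) \<longleftrightarrow> cone_D x y w"
proof -
  assume "c \<noteq> 0"
  have "quartic (c * x) (c * y) (c * w) = c ^ 4 * quartic x y w"
    unfolding quartic_def quad_scale by algebra
  then show ?thesis using \<open>c \<noteq> 0\<close> by (simp add: cone_D_def)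
qed

lemma quartic_w_scale: "quartic_w (c * x) (c * y) (c * w) = c ^ 3 * quartic_w x y w"
  unfolding quartic_w_def quad_scale by algebra

text \<open>Each vertex of the coordinate triangle lies on two of its sides; if \<open>q\<close>
  vanished there, the vertex would be a singular point of the curve.\<close>

lemma q_nonzero: "q 1 \<noteq> 0" "q 2 \<noteq> 0" "q 3 \<noteq> 0"
  using smooth[of 1 0 0] smooth[of 0 1 0] smooth[of 0 0 1] by (auto simp: quad_def)

text \<open>If one of \<open>x\<close>, \<open>y\<close>, \<open>w\<close>, \<open>x + y + w\<close>
  vanishes at a point of the curve, then so does \<open>q\<close>; if a second one vanishes there,
  then so do all partial derivatives. The next three lemmas hold for the same reason.\<close>

lemma x_zero: "cone_D 0 y w \<Longrightarrow> y \<noteq> 0 \<and> w \<noteq> 0 \<and> y + w \<noteq> 0"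
  using smoothD[of 0 y w] by (auto simp: cone_D_def quartic_def quartic_x_def quartic_y_def quartic_w_def)

lemma y_zero: "cone_D x 0 w \<Longrightarrow> x \<noteq> 0 \<and> w \<noteq> 0 \<and> x + w \<noteq> 0"
  using smoothD[of x 0 w] by (auto simp: cone_D_def quartic_def quartic_x_def quartic_y_def quartic_w_def)

lemma w_zero: "cone_D x y 0 \<Longrightarrow> x \<noteq> 0 \<and> y \<noteq> 0 \<and> x + y \<noteq> 0"
  using smoothD[of x y 0] by (auto simp: cone_D_def quartic_def quartic_x_def quartic_y_def quartic_w_def)

lemma t_zero: "cone_D x y w \<Longrightarrow> x + y + w = 0 \<Longrightarrow> x \<noteq> 0 \<and> y \<noteq> 0 \<and> w \<noteq> 0"
  using smoothD[of x y w] by (auto simp: cone_D_def quartic_def quartic_x_def quartic_y_def quartic_w_def)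

text \<open>Coefficients of \<open>quartic\<close> as a polynomial in \<open>w\<close>; the leading one is constant because the
  curve does not pass through \<open>(0 : 0 : 1)\<close>.\<close>

definition C :: "nat \<Rightarrow> complex \<Rightarrow> complex \<Rightarrow> complex" where
  "C l x y = (let A = q 1 * x\<^sup>2 + q 4 * x * y + q 2 * y\<^sup>2; B = q 5 * x + q 6 * y in
     [A\<^sup>2, 2 * A * B + x * y * (x + y), B\<^sup>2 + 2 * q 3 * A + x * y, 2 * q 3 * B, (q 3)\<^sup>2] ! l)"

lemma C_simps:
  "C 0 x y = (q 1 * x\<^sup>2 + q 4 * x * y + q 2 * y\<^sup>2)\<^sup>2"
  "C (Suc 0) x y = 2 * (q 1 * x\<^sup>2 + q 4 * x * y + q 2 * y\<^sup>2) * (q 5 * x + q 6 * y) + x * y * (x + y)"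
  "C 2 x y = (q 5 * x + q 6 * y)\<^sup>2 + 2 * q 3 * (q 1 * x\<^sup>2 + q 4 * x * y + q 2 * y\<^sup>2) + x * y"
  "C 3 x y = 2 * q 3 * (q 5 * x + q 6 * y)"
  "C 4 x y = (q 3)\<^sup>2"
  by (simp_all add: C_def Let_def)

lemma atMost_4: "{..4 :: nat} = {0, Suc 0, 2, 3, 4}"
  by (auto simp: numeral_eq_Suc atMost_Suc)

lemma quartic_eq: "(\<Sum>l\<le>4. C l x y * w ^ l) = quartic x y w"
  unfolding quartic_def quad_def
  by (simp add: atMost_4 C_simps) algebra

lemma quartic_w_eq: "(\<Sum>l\<le>4. C l x y * (of_nat l * w ^ (l - Suc 0))) = quartic_w x y w"
proof -
  have "((\<lambda>w. \<Sum>l\<le>4. C l x y * w ^ l) has_field_derivative (\<Sum>l\<le>4. C l x y * (of_nat l * w ^ (l - Suc 0)))) (at w)"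
    by (intro DERIV_sum) (auto intro!: derivative_eq_intros)
  moreover have "((\<lambda>w. quartic x y w) has_field_derivative quartic_w x y w) (at w)"
    unfolding quartic_def quartic_w_def quad_def
    by (auto intro!: derivative_eq_intros) algebra
  ultimately show ?thesis unfolding quartic_eq by (rule DERIV_unique)
qed

lemma holomorphic_C:
  assumes "f holomorphic_on A" "g holomorphic_on A" shows "(\<lambda>z. C l (f z) (g z)) holomorphic_on A"
proof (cases "l \<le> 4")
  case True
  then have "l \<in> {..4}" by simp
  then show ?thesis unfolding atMost_4 by (auto simp: C_simps intro!: holomorphic_intros assms)
next
  case False
  then obtain m where "l = 5 + m" using le_Suc_ex[of 5 l] by auto
  \<comment> \<open>Beyond the end of the list \<open>!\<close> returns an unspecified value, but
    the same one for all \<open>x\<close> and \<open>y\<close>, hence a constant function.\<close>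
  then have "C l x y = [] ! m" for x y by (simp add: C_def Let_def numeral_eq_Suc)
  then show ?thesis by simp
qed

lemma chart1: "smooth_cover 4 (\<lambda>l x. C l x 1) ((q 3)\<^sup>2)"
proof
  show hol: "(\<lambda>x. C l x 1) holomorphic_on UNIV" for l by (intro holomorphic_C holomorphic_intros)
  show "C 4 x 1 = (q 3)\<^sup>2" for x by (simp add: C_simps)
  show "(q 3)\<^sup>2 \<noteq> 0" using q_nonzero by simp
  fix x w assume "(\<Sum>l\<le>4. C l x 1 * w ^ l) = 0"
  then have quartic: "quartic x 1 w = 0" by (simp add: quartic_eq)
  have "((\<lambda>x. \<Sum>l\<le>4. C l x 1 * w ^ l) has_field_derivative (\<Sum>l\<le>4. deriv (\<lambda>x. C l x 1) x * w ^ l)) (at x)"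
    by (intro DERIV_sum DERIV_cmult_right holomorphic_derivI[OF hol]) auto
  moreover have "((\<lambda>x. quartic x 1 w) has_field_derivative quartic_x x 1 w) (at x)"
    unfolding quartic_def quartic_x_def quad_def
    by (auto intro!: derivative_eq_intros) algebra
  ultimately have "(\<Sum>l\<le>4. deriv (\<lambda>x. C l x 1) x * w ^ l) = quartic_x x 1 w"
    unfolding quartic_eq by (rule DERIV_unique)
  \<comment> \<open>By Euler's relation at \<open>y = 1\<close>, the vanishing of the equation and
    of its derivatives in \<open>x\<close> and \<open>w\<close> entails that of the derivative in
    \<open>y\<close>.\<close>
  then show "(\<Sum>l\<le>4. C l x 1 * (of_nat l * w ^ (l - 1))) \<noteq> 0 \<or> (\<Sum>l\<le>4. deriv (\<lambda>x. C l x 1) x * w ^ l) \<noteq> 0"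
    using smoothD[of x 1 w] quartic euler[of x 1 w] by (auto simp: cone_D_def quartic_w_eq)
qed

lemma chart2: "smooth_cover 4 (\<lambda>l y. C l 1 y) ((q 3)\<^sup>2)"
proof
  show hol: "(\<lambda>y. C l 1 y) holomorphic_on UNIV" for l by (intro holomorphic_C holomorphic_intros)
  show "C 4 1 y = (q 3)\<^sup>2" for y by (simp add: C_simps)
  show "(q 3)\<^sup>2 \<noteq> 0" using q_nonzero by simp
  fix y w assume "(\<Sum>l\<le>4. C l 1 y * w ^ l) = 0"
  then have quartic: "quartic 1 y w = 0" by (simp add: quartic_eq)
  have "((\<lambda>y. \<Sum>l\<le>4. C l 1 y * w ^ l) has_field_derivative (\<Sum>l\<le>4. deriv (\<lambda>y. C l 1 y) y * w ^ l)) (at y)"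
    by (intro DERIV_sum DERIV_cmult_right holomorphic_derivI[OF hol]) auto
  moreover have "((\<lambda>y. quartic 1 y w) has_field_derivative quartic_y 1 y w) (at y)"
    unfolding quartic_def quartic_y_def quad_def
    by (auto intro!: derivative_eq_intros) algebra
  ultimately have "(\<Sum>l\<le>4. deriv (\<lambda>y. C l 1 y) y * w ^ l) = quartic_y 1 y w"
    unfolding quartic_eq by (rule DERIV_unique)
  then show "(\<Sum>l\<le>4. C l 1 y * (of_nat l * w ^ (l - 1))) \<noteq> 0 \<or> (\<Sum>l\<le>4. deriv (\<lambda>y. C l 1 y) y * w ^ l) \<noteq> 0"
    using smoothD[of 1 y w] quartic euler[of 1 y w] by (auto simp: cone_D_def quartic_w_eq)
qed

end

sublocale plane_quartic \<subseteq> chart1: smooth_cover 4 "\<lambda>l x. C l x 1" "(q 3)\<^sup>2"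
  by (rule chart1)

sublocale plane_quartic \<subseteq> chart2: smooth_cover 4 "\<lambda>l y. C l 1 y" "(q 3)\<^sup>2"
  by (rule chart2)

context plane_quartic
begin

lemma chart1_p: "chart1.p x w = quartic x 1 w" by (simp add: chart1.p_def quartic_eq)

lemma chart2_p: "chart2.p y w = quartic 1 y w" by (simp add: chart2.p_def quartic_eq)

lemma chart1_pw: "chart1.pw x w = quartic_w x 1 w" by (simp add: chart1.pw_def quartic_w_eq)

lemma chart2_pw: "chart2.pw y w = quartic_w 1 y w" by (simp add: chart2.pw_def quartic_w_eq)

section \<open>Homogeneous functions on the cone over the quartic and their traces\<close>

definition homogeneous :: "nat \<Rightarrow> (complex \<Rightarrow> complex \<Rightarrow> complex \<Rightarrow> complex) \<Rightarrow> bool" where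
  "homogeneous k g \<longleftrightarrow>
     (\<forall>x y w c. cone_D x y w \<and> c \<noteq> 0 \<longrightarrow> g (c * x) (c * y) (c * w) = c ^ k * g x y w)"

text \<open>The charts \<open>y = 1\<close> and \<open>x = 1\<close> cover the curve, since it
  misses (0 : 0 : 1).\<close>

definition regular :: "(complex \<Rightarrow> complex \<Rightarrow> complex \<Rightarrow> complex) \<Rightarrow> bool" where
  "regular g \<longleftrightarrow> chart1.regular_function (\<lambda>x w. g x 1 w) \<and> chart2.regular_function (\<lambda>y w. g 1 y w)"

lemma quartic_chart_change: "x \<noteq> 0 \<Longrightarrow> quartic x 1 (x * w) = 0 \<longleftrightarrow> quartic 1 (1 / x) w = 0"
  using cone_D_scale[of x 1 "1 / x" w] by (simp add: cone_D_def)

lemma quartic_w_chart_change: "x \<noteq> 0 \<Longrightarrow> quartic_w x 1 (x * w) = x ^ 3 * quartic_w 1 (1 / x) w"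
  using quartic_w_scale[of x 1 "1 / x" w] by simp

lemma branch_points_chart_change:
  assumes "x \<noteq> 0" "x \<notin> chart1.branch_points" shows "1 / x \<notin> chart2.branch_points"
proof
  assume "1 / x \<in> chart2.branch_points"
  then obtain w where "quartic 1 (1 / x) w = 0" "quartic_w 1 (1 / x) w = 0"
    unfolding chart2.branch_points_def chart2_p chart2_pw by blast
  then have "quartic x 1 (x * w) = 0" "quartic_w x 1 (x * w) = 0"
    by (simp_all only: quartic_chart_change[OF assms(1)] quartic_w_chart_change[OF assms(1)]) simp
  then show False using assms(2) unfolding chart1.branch_points_def chart1_p chart1_pw by blast
qed

text \<open>Multiplication by \<open>x\<close> identifies the fibres in the two charts. The summand
  has degree \<open>k + j - 3\<close>, because \<open>quartic_w\<close> has degree 3; the factor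
  \<open>x^3\<close> stands on the left to avoid negative exponents.\<close>

lemma fibre_trace_chart_change:
  assumes g: "homogeneous k g" and x: "x \<noteq> 0"
  shows "x ^ 3 * chart1.fibre_trace (\<lambda>x w. g x 1 w * w ^ j) x =
    x ^ (k + j) * chart2.fibre_trace (\<lambda>y w. g 1 y w * w ^ j) (1 / x)"
proof -
  have roots: "chart1.roots x = (*) x ` chart2.roots (1 / x)"
  proof (intro equalityI subsetI)
    fix w assume "w \<in> chart1.roots x"
    then have "w / x \<in> chart2.roots (1 / x)"
      using quartic_chart_change[OF x, of "w / x"] x by (simp add: chart1.roots_def chart2.roots_def chart1_p chart2_p)
    then show "w \<in> (*) x ` chart2.roots (1 / x)" using x by (intro image_eqI[of _ _ "w / x"]) auto
  qed (use quartic_chart_change[OF x] in \<open>auto simp: chart1.roots_def chart2.roots_def chart1_p chart2_p\<close>)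
  have "x ^ 3 * chart1.fibre_trace (\<lambda>x w. g x 1 w * w ^ j) x =
      (\<Sum>w\<in>chart2.roots (1 / x). x ^ 3 * (g x 1 (x * w) * (x * w) ^ j / quartic_w x 1 (x * w)))"
    unfolding chart1.fibre_trace_def chart1_pw roots sum_distrib_left
    using x by (subst sum.reindex) (auto simp: inj_on_def)
  also have "\<dots> = (\<Sum>w\<in>chart2.roots (1 / x). x ^ (k + j) * (g 1 (1 / x) w * w ^ j / quartic_w 1 (1 / x) w))"
  proof (intro sum.cong refl)
    fix w assume "w \<in> chart2.roots (1 / x)"
    then have "cone_D 1 (1 / x) w" by (simp add: chart2.roots_def chart2_p cone_D_def)
    then have "g (x * 1) (x * (1 / x)) (x * w) = x ^ k * g 1 (1 / x) w"
      using g x unfolding homogeneous_def by blast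
    then have "g x 1 (x * w) = x ^ k * g 1 (1 / x) w" using x by simp
    then show "x ^ 3 * (g x 1 (x * w) * (x * w) ^ j / quartic_w x 1 (x * w)) =
        x ^ (k + j) * (g 1 (1 / x) w * w ^ j / quartic_w 1 (1 / x) w)"
      unfolding quartic_w_chart_change[OF x] using x by (simp add: power_mult_distrib power_add)
  qed
  finally show ?thesis by (simp add: chart2.fibre_trace_def chart2_pw sum_distrib_left)
qed

text \<open>Lagrange interpolation on a fibre of degree 4, written out: \<open>c\<close> are the
  coefficients of the equation and \<open>a j\<close> is the trace of \<open>g w^j\<close>.\<close>

definition interpolant :: "(nat \<Rightarrow> complex) \<Rightarrow> (nat \<Rightarrow> complex) \<Rightarrow> complex \<Rightarrow> complex" where
  "interpolant c a w = c (Suc 0) * a 0 + c 2 * (a 1 + w * a 0) + c 3 * (a 2 + w * a 1 + w\<^sup>2 * a 0) +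
    c 4 * (a 3 + w * a 2 + w\<^sup>2 * a 1 + w ^ 3 * a 0)"

lemma interpolation_expand: "(\<Sum>l\<le>4. c l * (\<Sum>m<l. w ^ m * a (l - Suc m))) = interpolant c a w"
proof -
  have "{..<Suc 0} = {0}" "{..<2::nat} = {0, 1}" "{..<3::nat} = {0, 1, 2}" "{..<4::nat} = {0, 1, 2, 3}"
    by auto
  then show ?thesis by (simp add: interpolant_def atMost_4 algebra_simps)
qed

text \<open>\<open>A j\<close> and \<open>B j\<close> are the two local expressions of the trace of
  \<open>g w^j\<close>, a section of O(k + j - 3) on the projective line; together they determine
  \<open>g\<close> on the curve.\<close>

lemma chart_interpolation:
  assumes g: "homogeneous k g" "regular g"
  obtains A B :: "nat \<Rightarrow> complex \<Rightarrow> complex" where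
    "\<And>j. A j holomorphic_on UNIV" "\<And>j. B j holomorphic_on UNIV"
    "\<And>j x. x \<noteq> 0 \<Longrightarrow> x ^ 3 * A j x = x ^ (k + j) * B j (1 / x)"
    "\<And>x w. quartic x 1 w = 0 \<Longrightarrow> g x 1 w = interpolant (\<lambda>l. C l x 1) (\<lambda>j. A j x) w"
    "\<And>y w. quartic 1 y w = 0 \<Longrightarrow> g 1 y w = interpolant (\<lambda>l. C l 1 y) (\<lambda>j. B j y) w"
proof -
  let ?S = "\<lambda>j. chart1.fibre_trace (\<lambda>x w. g x 1 w * w ^ j)"
  let ?T = "\<lambda>j. chart2.fibre_trace (\<lambda>y w. g 1 y w * w ^ j)"
  have reg: "chart1.regular_function (\<lambda>x w. g x 1 w)" "chart2.regular_function (\<lambda>y w. g 1 y w)"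
    using g(2) by (auto simp: regular_def)
  have "\<exists>A. A holomorphic_on UNIV \<and> (\<forall>x. x \<notin> chart1.branch_points \<longrightarrow> A x = ?S j x)" for j
    by (rule chart1.fibre_trace_extends[OF chart1.regular_function_mult_power[OF reg(1), of j]]) blast
  then have "\<forall>j. \<exists>A. A holomorphic_on UNIV \<and> (\<forall>x. x \<notin> chart1.branch_points \<longrightarrow> A x = ?S j x)"
    by blast
  then obtain A where A: "\<And>j. A j holomorphic_on UNIV"
    "\<And>j x. x \<notin> chart1.branch_points \<Longrightarrow> A j x = ?S j x"
    unfolding choice_iff by blast
  have "\<exists>B. B holomorphic_on UNIV \<and> (\<forall>x. x \<notin> chart2.branch_points \<longrightarrow> B x = ?T j x)" for j
    by (rule chart2.fibre_trace_extends[OF chart2.regular_function_mult_power[OF reg(2), of j]]) blast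
  then have "\<forall>j. \<exists>B. B holomorphic_on UNIV \<and> (\<forall>x. x \<notin> chart2.branch_points \<longrightarrow> B x = ?T j x)"
    by blast
  then obtain B where B: "\<And>j. B j holomorphic_on UNIV"
    "\<And>j x. x \<notin> chart2.branch_points \<Longrightarrow> B j x = ?T j x"
    unfolding choice_iff by blast
  have contA: "continuous_on UNIV (A j)" and contB: "continuous_on UNIV (B j)" for j
    using A(1) B(1) by (auto intro: holomorphic_on_imp_continuous_on)
  have isContA: "isCont (A j) x" and isContB: "isCont (B j) x" for j x
    using contA contB by (auto simp: continuous_on_eq_continuous_at)
  show ?thesis
  proof (rule that[OF A(1) B(1)])
    fix j and x :: complex assume x: "x \<noteq> 0"
    obtain r where r: "0 < r" "\<And>x'. x' \<in> ball x r \<Longrightarrow> x' \<noteq> x \<Longrightarrow> x' \<notin> chart1.branch_points"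
      by (rule chart1.branch_points_isolated[of x]) blast
    show "x ^ 3 * A j x = x ^ (k + j) * B j (1 / x)"
    proof (rule isCont_eq_if_eventually_eq[of x "\<lambda>x. x ^ 3 * A j x" "\<lambda>x. x ^ (k + j) * B j (1 / x)"])
      show "isCont (\<lambda>x. x ^ 3 * A j x) x" by (intro continuous_intros isContA)
      show "isCont (\<lambda>x. x ^ (k + j) * B j (1 / x)) x"
        using x by (intro continuous_intros isCont_o2[OF _ isContB]) auto
      have "\<forall>\<^sub>F x' in at x. x' \<noteq> 0"
        by (rule tendsto_imp_eventually_ne[OF tendsto_ident_at x])
      moreover have "\<forall>\<^sub>F x' in at x. x' \<in> ball x r \<and> x' \<noteq> x"
        using r by (auto simp: eventually_at dist_commute intro!: exI[of _ r])
      ultimately show "\<forall>\<^sub>F x' in at x. x' ^ 3 * A j x' = x' ^ (k + j) * B j (1 / x')"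
      proof eventually_elim
        case (elim x')
        then have "x' \<notin> chart1.branch_points" using r by blast
        then show ?case
          using elim branch_points_chart_change[of x'] fibre_trace_chart_change[OF g(1), of x' j]
          by (simp add: A(2) B(2))
      qed
    qed
  next
    fix x w assume quartic: "quartic x 1 w = 0"
    show "g x 1 w = interpolant (\<lambda>l. C l x 1) (\<lambda>j. A j x) w"
      unfolding interpolation_expand[of "\<lambda>l. C l x 1" w "\<lambda>j. A j x", symmetric]
      by (rule chart1.interpolation[OF reg(1) contA]) (simp_all add: A(2) chart1_p quartic)
  next
    fix y w assume quartic: "quartic 1 y w = 0"
    show "g 1 y w = interpolant (\<lambda>l. C l 1 y) (\<lambda>j. B j y) w"
      unfolding interpolation_expand[of "\<lambda>l. C l 1 y" w "\<lambda>j. B j y", symmetric]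
      by (rule chart2.interpolation[OF reg(2) contB]) (simp_all add: B(2) chart2_p quartic)
  qed
qed

lemma homogeneous_eqI:
  assumes g: "homogeneous k g" and R: "\<And>c x y w. R (c * x) (c * y) (c * w) = c ^ k * R x y w"
    and charts: "\<And>x w. quartic x 1 w = 0 \<Longrightarrow> g x 1 w = R x 1 w" "\<And>y w. quartic 1 y w = 0 \<Longrightarrow> g 1 y w = R 1 y w"
    and pt: "cone_D x y w"
  shows "g x y w = R x y w"
proof -
  have g': "c \<noteq> 0 \<Longrightarrow> cone_D x y w \<Longrightarrow> g (c * x) (c * y) (c * w) = c ^ k * g x y w" for c x y w
    using g by (auto simp: homogeneous_def)
  consider "y \<noteq> 0" | "y = 0" "x \<noteq> 0" using y_zero pt by blast
  then show ?thesis
  proof cases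
    case 1
    then have "cone_D (x / y) 1 (w / y)" using cone_D_scale[of y "x / y" 1 "w / y"] pt by simp
    then show ?thesis
      using g'[of y "x / y" 1 "w / y"] R[of y "x / y" 1 "w / y"] charts(1)[of "x / y" "w / y"] 1
      by (simp add: cone_D_def)
  next
    case 2
    then have "cone_D 1 (y / x) (w / x)" using cone_D_scale[of x 1 "y / x" "w / x"] pt by simp
    then show ?thesis
      using g'[of x 1 "y / x" "w / x"] R[of x 1 "y / x" "w / x"] charts(2)[of "y / x" "w / x"] 2
      by (simp add: cone_D_def)
  qed
qed

text \<open>The trace of \<open>g w^j\<close> is a section of O(j - 2) on the line: zero for
  \<open>j\<close> = 0 and 1, a constant for \<open>j\<close> = 2, linear for \<open>j\<close> = 3.
  Interpolation then yields a linear form.\<close>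

theorem regular_linear:
  assumes g: "homogeneous 1 g" "regular g"
  obtains \<alpha> \<beta> \<gamma> where "\<And>x y w. cone_D x y w \<Longrightarrow> g x y w = \<alpha> * x + \<beta> * y + \<gamma> * w"
proof -
  obtain A B where A: "\<And>j. A j holomorphic_on UNIV" and B: "\<And>j. B j holomorphic_on UNIV"
    and AB: "\<And>j x. x \<noteq> 0 \<Longrightarrow> x ^ 3 * A j x = x ^ (1 + j) * B j (1 / x)"
    and gA: "\<And>x w. quartic x 1 w = 0 \<Longrightarrow> g x 1 w = interpolant (\<lambda>l. C l x 1) (\<lambda>j. A j x) w"
    and gB: "\<And>y w. quartic 1 y w = 0 \<Longrightarrow> g 1 y w = interpolant (\<lambda>l. C l 1 y) (\<lambda>j. B j y) w"
    by (rule chart_interpolation[OF g]) blast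
  have AB': "x ^ 2 * A 0 x = B 0 (1 / x)" "x ^ 1 * A 1 x = B 1 (1 / x)"
    "A 2 x = x ^ 0 * B 2 (1 / x)" "A 3 x = x ^ 1 * B 3 (1 / x)" if "x \<noteq> 0" for x
    using AB[OF that, of 0] AB[OF that, of 1] AB[OF that, of 2] AB[OF that, of 3] that
    by (simp_all add: numeral_eq_Suc mult_ac)
  have zero: "A 0 x = 0" "B 0 x = 0" "A 1 x = 0" "B 1 x = 0" for x
    using reciprocal_entire_zero[OF A B _ AB'(1)] reciprocal_entire_zero[OF A B _ AB'(2)] by auto
  obtain a where a: "\<And>x. A 2 x = (\<Sum>i\<le>0. a i * x ^ i)" "\<And>y. B 2 y = (\<Sum>i\<le>0. a i * y ^ (0 - i))"
    by (rule reciprocal_entire[OF A B AB'(3)]) (assumption, rule that)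
  obtain b where b: "\<And>x. A 3 x = (\<Sum>i\<le>1. b i * x ^ i)" "\<And>y. B 3 y = (\<Sum>i\<le>1. b i * y ^ (1 - i))"
    by (rule reciprocal_entire[OF A B AB'(4)]) (assumption, rule that)
  \<comment> \<open>Read off from \<open>interpolant\<close>: \<open>a 0\<close> is the constant
    trace, and \<open>b 1\<close>, \<open>b 0\<close> are the coefficients of the linear
    one.\<close>
  let ?R = "\<lambda>x y w. ((q 3)\<^sup>2 * b 1 + 2 * q 3 * q 5 * a 0) * x + ((q 3)\<^sup>2 * b 0 + 2 * q 3 * q 6 * a 0) * y +
    (q 3)\<^sup>2 * a 0 * w"
  show ?thesis
  proof (rule that, rule homogeneous_eqI[OF g(1), of ?R])
    show "?R (c * x) (c * y) (c * w) = c ^ 1 * ?R x y w" for c x y w by (simp add: algebra_simps)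
    show "g x 1 w = ?R x 1 w" if "quartic x 1 w = 0" for x w
      unfolding gA[OF that] interpolant_def zero a b C_simps by (simp add: algebra_simps)
    show "g 1 y w = ?R 1 y w" if "quartic 1 y w = 0" for y w
      unfolding gB[OF that] interpolant_def zero a b C_simps by (simp add: algebra_simps)
  qed
qed

text \<open>Now the trace of \<open>g w^j\<close> is a section of O(j - 1): zero for
  \<open>j\<close> = 0 and of degree 0, 1, 2 for \<open>j\<close> = 1, 2, 3.\<close>

theorem regular_quadratic:
  assumes g: "homogeneous 2 g" "regular g"
  obtains s where "\<And>x y w. cone_D x y w \<Longrightarrow> g x y w = quad s x y w"
proof -
  obtain A B where A: "\<And>j. A j holomorphic_on UNIV" and B: "\<And>j. B j holomorphic_on UNIV"
    and AB: "\<And>j x. x \<noteq> 0 \<Longrightarrow> x ^ 3 * A j x = x ^ (2 + j) * B j (1 / x)"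
    and gA: "\<And>x w. quartic x 1 w = 0 \<Longrightarrow> g x 1 w = interpolant (\<lambda>l. C l x 1) (\<lambda>j. A j x) w"
    and gB: "\<And>y w. quartic 1 y w = 0 \<Longrightarrow> g 1 y w = interpolant (\<lambda>l. C l 1 y) (\<lambda>j. B j y) w"
    by (rule chart_interpolation[OF g]) blast
  have AB': "x ^ 1 * A 0 x = B 0 (1 / x)" "A 1 x = x ^ 0 * B 1 (1 / x)"
    "A 2 x = x ^ 1 * B 2 (1 / x)" "A 3 x = x ^ 2 * B 3 (1 / x)" if "x \<noteq> 0" for x
    using AB[OF that, of 0] AB[OF that, of 1] AB[OF that, of 2] AB[OF that, of 3] that
    by (simp_all add: numeral_eq_Suc mult_ac)
  have zero: "A 0 x = 0" "B 0 x = 0" for x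
    using reciprocal_entire_zero[OF A B _ AB'(1)] by auto
  obtain a where a: "\<And>x. A 1 x = (\<Sum>i\<le>0. a i * x ^ i)" "\<And>y. B 1 y = (\<Sum>i\<le>0. a i * y ^ (0 - i))"
    by (rule reciprocal_entire[OF A B AB'(2)]) (assumption, rule that)
  obtain b where b: "\<And>x. A 2 x = (\<Sum>i\<le>1. b i * x ^ i)" "\<And>y. B 2 y = (\<Sum>i\<le>1. b i * y ^ (1 - i))"
    by (rule reciprocal_entire[OF A B AB'(3)]) (assumption, rule that)
  obtain d where d: "\<And>x. A 3 x = (\<Sum>i\<le>2. d i * x ^ i)" "\<And>y. B 3 y = (\<Sum>i\<le>2. d i * y ^ (2 - i))"
    by (rule reciprocal_entire[OF A B AB'(4)]) (assumption, rule that)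
  \<comment> \<open>Read off from \<open>interpolant\<close>; the summand 1 in the coefficient of
    \<open>x y\<close> comes from the term \<open>x y\<close> of \<open>C 2\<close>. The initial 0
    fills index 0, as \<open>quad\<close> counts from 1.\<close>
  define s where "s = (!) [0,
    a 0 * ((q 5)\<^sup>2 + 2 * q 3 * q 1) + 2 * q 3 * q 5 * b 1 + (q 3)\<^sup>2 * d 2,
    a 0 * ((q 6)\<^sup>2 + 2 * q 3 * q 2) + 2 * q 3 * q 6 * b 0 + (q 3)\<^sup>2 * d 0,
    (q 3)\<^sup>2 * a 0,
    a 0 * (2 * q 5 * q 6 + 2 * q 3 * q 4 + 1) + 2 * q 3 * (q 5 * b 0 + q 6 * b 1) + (q 3)\<^sup>2 * d 1,
    2 * q 3 * q 5 * a 0 + (q 3)\<^sup>2 * b 1,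
    2 * q 3 * q 6 * a 0 + (q 3)\<^sup>2 * b 0]"
  have two: "{..2::nat} = {0, 1, 2}" "{..1::nat} = {0, 1}" by auto
  show ?thesis
  proof (rule that, rule homogeneous_eqI[OF g(1), of "quad s"])
    show "quad s (c * x) (c * y) (c * w) = c ^ 2 * quad s x y w" for c x y w by (rule quad_scale)
    show "g x 1 w = quad s x 1 w" if "quartic x 1 w = 0" for x w
      unfolding gA[OF that] interpolant_def zero a b d C_simps quad_def s_def two
      by (simp add: algebra_simps power2_eq_square)
    show "g 1 y w = quad s 1 y w" if "quartic 1 y w = 0" for y w
      unfolding gB[OF that] interpolant_def zero a b d C_simps quad_def s_def two
      by (simp add: algebra_simps power2_eq_square)
  qed
qed

text \<open>The difference of the products is a quartic form that vanishes on D, hence a constant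
  multiple of the equation. This is \<open>vanishing_on_curve\<close> for \<open>y = 1\<close>,
  carried to \<open>y \<noteq> 0\<close> by homogeneity and to \<open>y = 0\<close> by
  continuity.\<close>

theorem quartic_vanishing:
  assumes van: "\<And>x y w. cone_D x y w \<Longrightarrow> quad a x y w * quad b x y w = quad c x y w * quad d x y w"
  obtains \<mu> where "\<And>x y w. quad a x y w * quad b x y w - quad c x y w * quad d x y w = \<mu> * quartic x y w"
proof -
  define c0 c1 where "c0 a x = a 1 * x\<^sup>2 + a 4 * x + a 2" and "c1 a x = a 5 * x + a 6"
    for a :: "nat \<Rightarrow> complex" and x
  have quad1: "quad a x 1 w = c0 a x + c1 a x * w + a 3 * w\<^sup>2" for a x w
    by (simp add: quad_def c0_def c1_def algebra_simps)
  \<comment> \<open>\<open>D a b l\<close> is the coefficient of \<open>w^l\<close> in the product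
    of the conics \<open>a\<close> and \<open>b\<close> at \<open>y = 1\<close>.\<close>
  define D where "D a b l x = [c0 a x * c0 b x, c0 a x * c1 b x + c1 a x * c0 b x,
      c0 a x * b 3 + c1 a x * c1 b x + a 3 * c0 b x, c1 a x * b 3 + a 3 * c1 b x, a 3 * b 3] ! l"
    for a b :: "nat \<Rightarrow> complex" and l x
  have D: "(\<Sum>l\<le>4. D a b l x * w ^ l) = quad a x 1 w * quad b x 1 w" for a b x w
    unfolding quad1 by (simp add: atMost_4 D_def) algebra
  define F where "F x y w = quad a x y w * quad b x y w - quad c x y w * quad d x y w" for x y w
  define \<delta> where "\<delta> = a 3 * b 3 - c 3 * d 3"
  have sum: "(\<Sum>l\<le>4. (D a b l x - D c d l x) * w ^ l) = F x 1 w" for x w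
    by (simp add: left_diff_distrib sum_subtractf D F_def)
  have chart: "(q 3)\<^sup>2 * F x 1 w = \<delta> * quartic x 1 w" for x w
    unfolding sum[symmetric] chart1_p[symmetric]
  proof (rule chart1.vanishing_on_curve)
    fix l :: nat assume "l \<le> 4"
    then have "l \<in> {..4}" by simp
    then show "continuous_on UNIV (\<lambda>x. D a b l x - D c d l x)"
      unfolding atMost_4 D_def c0_def c1_def by (auto intro!: continuous_intros)
  next
    show "D a b 4 x - D c d 4 x = \<delta>" for x by (simp add: D_def \<delta>_def)
    fix x w assume "chart1.p x w = 0"
    then have "cone_D x 1 w" by (simp add: chart1_p cone_D_def)
    then show "(\<Sum>l\<le>4. (D a b l x - D c d l x) * w ^ l) = 0"
      unfolding sum F_def using van by simp
  qed
  have scale: "F (c * x) (c * y) (c * w) = c ^ 4 * F x y w" "quartic (c * x) (c * y) (c * w) = c ^ 4 * quartic x y w" for c x y w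
    unfolding F_def quartic_def quad_scale by algebra+
  have nz: "(q 3)\<^sup>2 * F x y w = \<delta> * quartic x y w" if "y \<noteq> 0" for x y w
    using chart[of "x / y" "w / y"] scale[of y "x / y" 1 "w / y"] that by simp
  have "(q 3)\<^sup>2 * F x 0 w = \<delta> * quartic x 0 w" for x w
  proof (rule isCont_eq_if_eventually_eq[of 0 "\<lambda>y. (q 3)\<^sup>2 * F x y w" "\<lambda>y. \<delta> * quartic x y w"])
    show "isCont (\<lambda>y. (q 3)\<^sup>2 * F x y w) 0" "isCont (\<lambda>y. \<delta> * quartic x y w) 0"
      unfolding F_def quartic_def quad_def by (intro continuous_intros)+
  qed (use nz in \<open>auto simp: eventually_at_filter\<close>)
  with nz have all: "(q 3)\<^sup>2 * F x y w = \<delta> * quartic x y w" for x y w by (cases "y = 0") auto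
  show ?thesis
  proof (rule that)
    show "quad a x y w * quad b x y w - quad c x y w * quad d x y w = \<delta> / (q 3)\<^sup>2 * quartic x y w" for x y w
      using all[of x y w] q_nonzero(3) by (simp add: F_def field_simps)
  qed
qed

text \<open>Two points in one fibre of the projection and a third one in another fibre are not
  collinear, so a linear form is determined by its values at them.\<close>

lemma noncollinear_points:
  obtains x1 x2 w1 w2 w3 where "x1 \<noteq> x2" "w1 \<noteq> w2" "cone_D x1 1 w1" "cone_D x1 1 w2" "cone_D x2 1 w3"
proof -
  obtain r where r: "0 < r" "\<And>x. x \<in> ball 0 r \<Longrightarrow> x \<noteq> 0 \<Longrightarrow> x \<notin> chart1.branch_points"
    by (rule chart1.branch_points_isolated[of 0]) blast
  define x1 x2 :: complex where "x1 = of_real (r / 2)" and "x2 = of_real (r / 4)"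
  have "x1 \<in> ball 0 r" "x2 \<in> ball 0 r" "x1 \<noteq> 0" "x2 \<noteq> 0" "x1 \<noteq> x2"
    using r(1) by (auto simp: x1_def x2_def norm_divide)
  then have card: "card (chart1.roots x1) = 4" "card (chart1.roots x2) = 4"
    using r(2) chart1.card_roots by auto
  have "chart1.roots x2 \<noteq> {}" using card by auto
  then obtain w3 where w3: "w3 \<in> chart1.roots x2" by blast
  have "\<not> (\<exists>w. chart1.roots x1 \<subseteq> {w})" using card(1) card_mono[of "{_}" "chart1.roots x1"] by fastforce
  then obtain w1 w2 where w: "w1 \<in> chart1.roots x1" "w2 \<in> chart1.roots x1" "w1 \<noteq> w2" by blast
  show ?thesis
    by (rule that[OF \<open>x1 \<noteq> x2\<close> w(3)]) (use w w3 in \<open>auto simp: chart1.roots_def chart1_p cone_D_def\<close>)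
qed

lemma linear_vanishing:
  assumes "\<And>x y w. cone_D x y w \<Longrightarrow> \<alpha> * x + \<beta> * y + \<gamma> * w = 0"
  shows "\<alpha> = 0 \<and> \<beta> = 0 \<and> \<gamma> = 0"
proof -
  obtain x1 x2 w1 w2 w3 where pts: "x1 \<noteq> x2" "w1 \<noteq> w2" "cone_D x1 1 w1" "cone_D x1 1 w2" "cone_D x2 1 w3"
    by (rule noncollinear_points)
  have 1: "\<alpha> * x1 + \<beta> + \<gamma> * w1 = 0" "\<alpha> * x1 + \<beta> + \<gamma> * w2 = 0" "\<alpha> * x2 + \<beta> + \<gamma> * w3 = 0"
    using assms[OF pts(3)] assms[OF pts(4)] assms[OF pts(5)] by auto
  then have "\<gamma> * (w1 - w2) = 0" by algebra
  with pts have "\<gamma> = 0" by simp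
  with 1 have "\<alpha> * (x1 - x2) = 0" by algebra
  with pts have "\<alpha> = 0" by simp
  with \<open>\<gamma> = 0\<close> 1 show ?thesis by simp
qed

section \<open>Points on the coordinate lines and division by the equations of these lines\<close>

lemma point_x_zero: obtains w where "cone_D 0 1 w"
proof -
  obtain w where "q 3 * w\<^sup>2 + q 6 * w + q 2 = 0" by (rule quadratic_root_exists[OF q_nonzero(3)])
  \<comment> \<open>On the line \<open>x = 0\<close> the quartic restricts to the square of
    \<open>q\<close>.\<close>
  then have "cone_D 0 1 w" by (simp add: cone_D_def quartic_def quad_def algebra_simps)
  then show ?thesis by (rule that)
qed

lemma point_y_zero: obtains w where "cone_D 1 0 w"
proof -
  obtain w where "q 3 * w\<^sup>2 + q 5 * w + q 1 = 0" by (rule quadratic_root_exists[OF q_nonzero(3)])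
  then have "cone_D 1 0 w" by (simp add: cone_D_def quartic_def quad_def algebra_simps)
  then show ?thesis by (rule that)
qed

lemma point_w_zero: obtains x where "cone_D x 1 0"
proof -
  obtain x where "q 1 * x\<^sup>2 + q 4 * x + q 2 = 0" by (rule quadratic_root_exists[OF q_nonzero(1)])
  then have "cone_D x 1 0" by (simp add: cone_D_def quartic_def quad_def algebra_simps)
  then show ?thesis by (rule that)
qed

text \<open>\<open>q\<close> is not identically zero on the line \<open>x = 0\<close>, hence
  \<open>s\<close> is: \<open>x\<close> divides \<open>s\<close>.\<close>

lemma x_dvd_quad:
  assumes "\<And>y w. quad q 0 y w * quad s 0 y w = 0" shows "s 2 = 0 \<and> s 3 = 0 \<and> s 6 = 0"
  using quadratic_product_zero[of "q 3" "q 6" "q 2" "s 3" "s 6" "s 2"] assms[of 1] q_nonzero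
  by (simp add: quad_def algebra_simps)

lemma y_dvd_quad:
  assumes "\<And>x w. quad q x 0 w * quad s x 0 w = 0" shows "s 1 = 0 \<and> s 3 = 0 \<and> s 5 = 0"
  using quadratic_product_zero[of "q 3" "q 5" "q 1" "s 3" "s 5" "s 1"] assms[of 1] q_nonzero
  by (simp add: quad_def algebra_simps)

lemma w_dvd_quad:
  assumes "\<And>x y. quad q x y 0 * quad s x y 0 = 0" shows "s 1 = 0 \<and> s 2 = 0 \<and> s 4 = 0"
  using quadratic_product_zero[of "q 1" "q 4" "q 2" "s 1" "s 4" "s 2"] assms[of _ 1] q_nonzero
  by (simp add: quad_def algebra_simps)

text \<open>\<open>quad m\<close> is \<open>x y\<close>, \<open>x w\<close> or \<open>y w\<close>,
  that is, the square on C of \<open>X Y\<close>, \<open>X Z\<close> or \<open>Y Z\<close>. Each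
  non-trivial character contains exactly one of these three monomials.\<close>

definition pair_monomial :: "(nat \<Rightarrow> complex) \<Rightarrow> bool" where
  "pair_monomial m \<longleftrightarrow> (\<exists>k\<in>{4, 5, 6}. m = (\<lambda>i. if i = k then 1 else 0))"

text \<open>None of \<open>x\<close>, \<open>y\<close>, \<open>w\<close> divides \<open>q\<close>,
  so both linear factors of \<open>m\<close> divide \<open>s\<close>. By degree the quotient is a
  constant, and \<open>r\<close> is the same multiple of \<open>q\<close>.\<close>

lemma pair_monomial_dvd:
  assumes m: "pair_monomial m" and eq: "\<And>x y w. quad q x y w * quad s x y w = quad m x y w * quad r x y w"
  obtains \<mu> where "\<And>x y w. quad s x y w = \<mu> * quad m x y w" "\<And>x y w. quad r x y w = \<mu> * quad q x y w"
proof -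
  have "\<exists>\<mu>. \<forall>x y w. quad s x y w = \<mu> * quad m x y w"
  proof -
    consider "m = (\<lambda>i. if i = 4 then 1 else 0)" | "m = (\<lambda>i. if i = 5 then 1 else 0)"
      | "m = (\<lambda>i. if i = 6 then 1 else 0)"
      using m unfolding pair_monomial_def by blast
    then show ?thesis
    proof cases
      case 1
      then have "s 2 = 0 \<and> s 3 = 0 \<and> s 6 = 0" "s 1 = 0 \<and> s 3 = 0 \<and> s 5 = 0"
        by (intro x_dvd_quad y_dvd_quad; simp add: eq; simp add: quad_def)+
      then show ?thesis using 1 by (intro exI[of _ "s 4"]) (simp add: quad_def)
    next
      case 2
      then have "s 2 = 0 \<and> s 3 = 0 \<and> s 6 = 0" "s 1 = 0 \<and> s 2 = 0 \<and> s 4 = 0"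
        by (intro x_dvd_quad w_dvd_quad; simp add: eq; simp add: quad_def)+
      then show ?thesis using 2 by (intro exI[of _ "s 5"]) (simp add: quad_def)
    next
      case 3
      then have "s 1 = 0 \<and> s 3 = 0 \<and> s 5 = 0" "s 1 = 0 \<and> s 2 = 0 \<and> s 4 = 0"
        by (intro y_dvd_quad w_dvd_quad; simp add: eq; simp add: quad_def)+
      then show ?thesis using 3 by (intro exI[of _ "s 6"]) (simp add: quad_def)
    qed
  qed
  then obtain \<mu> where \<mu>: "\<And>x y w. quad s x y w = \<mu> * quad m x y w" by blast
  \<comment> \<open>\<open>quad m\<close> can be cancelled where the coordinates are non-zero, and
    an identity of conics needs to be known only there.\<close>
  have "quad (\<lambda>i. r i - \<mu> * q i) x y w = 0" for x y w
  proof (rule quad_zero_coeffs)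
    fix x y w :: complex assume nz: "x \<noteq> 0" "y \<noteq> 0" "w \<noteq> 0"
    have "quad m x y w \<noteq> 0" using m nz by (auto simp: pair_monomial_def quad_def)
    moreover have "quad m x y w * (quad r x y w - \<mu> * quad q x y w) = 0"
      using eq[of x y w] \<mu>[of x y w] by algebra
    ultimately show "quad (\<lambda>i. r i - \<mu> * q i) x y w = 0" by (simp add: quad_diff)
  qed
  then have "quad r x y w = \<mu> * quad q x y w" for x y w by (simp add: quad_diff)
  with \<mu> show ?thesis by (rule that)
qed

end

lemma vector_4:
  fixes a b c d :: "'a::zero"
  shows "(vector [a, b, c, d] :: 'a ^ 4) $ 1 = a" "(vector [a, b, c, d] :: 'a ^ 4) $ 2 = b"
    "(vector [a, b, c, d] :: 'a ^ 4) $ 3 = c" "(vector [a, b, c, d] :: 'a ^ 4) $ 4 = d"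
  unfolding vector_def by simp_all

context plane_quartic
begin

text \<open>Holomorphic curves on the cone over D whose images in the plane are immersed: the
  derivative is nowhere a multiple of the position vector.\<close>

definition D_arc :: "complex set \<Rightarrow> (complex \<Rightarrow> complex) \<Rightarrow> (complex \<Rightarrow> complex) \<Rightarrow> (complex \<Rightarrow> complex) \<Rightarrow> bool" where
  "D_arc U X Y W \<longleftrightarrow> open U \<and> X holomorphic_on U \<and> Y holomorphic_on U \<and> W holomorphic_on U \<and>
     (\<forall>s\<in>U. cone_D (X s) (Y s) (W s) \<and>
        (\<forall>c. \<not> (deriv X s = c * X s \<and> deriv Y s = c * Y s \<and> deriv W s = c * W s)))"

text \<open>The coordinate that is constantly 1 forces \<open>c = 0\<close>, whereas the coordinate
  equal to the parameter has derivative 1. The other three kinds of graphs are immersed for the same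
  reason.\<close>

lemma D_arc_chart1_graph_x:
  assumes "open U" "\<psi> holomorphic_on U" "\<And>s. s \<in> U \<Longrightarrow> quartic s 1 (\<psi> s) = 0"
  shows "D_arc U (\<lambda>s. s) (\<lambda>s. 1) \<psi>"
  using assms by (auto simp: D_arc_def cone_D_def)

lemma D_arc_chart1_graph_w:
  assumes "open U" "\<xi> holomorphic_on U" "\<And>s. s \<in> U \<Longrightarrow> quartic (\<xi> s) 1 s = 0"
  shows "D_arc U \<xi> (\<lambda>s. 1) (\<lambda>s. s)"
  using assms by (auto simp: D_arc_def cone_D_def)

lemma D_arc_chart2_graph_y:
  assumes "open U" "\<psi> holomorphic_on U" "\<And>s. s \<in> U \<Longrightarrow> quartic 1 s (\<psi> s) = 0"
  shows "D_arc U (\<lambda>s. 1) (\<lambda>s. s) \<psi>"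
  using assms by (auto simp: D_arc_def cone_D_def)

lemma D_arc_chart2_graph_w:
  assumes "open U" "\<xi> holomorphic_on U" "\<And>s. s \<in> U \<Longrightarrow> quartic 1 (\<xi> s) s = 0"
  shows "D_arc U (\<lambda>s. 1) \<xi> (\<lambda>s. s)"
  using assms by (auto simp: D_arc_def cone_D_def)

lemma regularI:
  assumes "\<And>U X Y W. D_arc U X Y W \<Longrightarrow> (\<lambda>s. g (X s) (Y s) (W s)) holomorphic_on U"
  shows "regular g"
  unfolding regular_def chart1.regular_function_def chart2.regular_function_def chart1_p chart2_p
proof (intro conjI allI impI; elim conjE)
  fix U \<psi> assume *: "open U" "\<psi> holomorphic_on U" "\<forall>s\<in>U. quartic s 1 (\<psi> s) = 0"
  show "(\<lambda>s. g s 1 (\<psi> s)) holomorphic_on U"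
    by (rule assms[OF D_arc_chart1_graph_x]) (use * in auto)
next
  fix U \<xi> assume *: "open U" "\<xi> holomorphic_on U" "\<forall>s\<in>U. quartic (\<xi> s) 1 s = 0"
  show "(\<lambda>s. g (\<xi> s) 1 s) holomorphic_on U"
    by (rule assms[OF D_arc_chart1_graph_w]) (use * in auto)
next
  fix U \<psi> assume *: "open U" "\<psi> holomorphic_on U" "\<forall>s\<in>U. quartic 1 s (\<psi> s) = 0"
  show "(\<lambda>s. g 1 s (\<psi> s)) holomorphic_on U"
    by (rule assms[OF D_arc_chart2_graph_y]) (use * in auto)
next
  fix U \<xi> assume *: "open U" "\<xi> holomorphic_on U" "\<forall>s\<in>U. quartic 1 (\<xi> s) s = 0"
  show "(\<lambda>s. g 1 (\<xi> s) s) holomorphic_on U"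
    by (rule assms[OF D_arc_chart2_graph_w]) (use * in auto)
qed

lemma D_arc_scale:
  assumes "D_arc U X Y W" "c \<noteq> 0"
  shows "D_arc U (\<lambda>s. c * X s) (\<lambda>s. c * Y s) (\<lambda>s. c * W s)"
proof -
  have "deriv (\<lambda>s. c * f s) s = c * deriv f s" if "f holomorphic_on U" "s \<in> U" for f s
    using assms(1) that by (intro deriv_cmult) (auto simp: D_arc_def holomorphic_on_imp_differentiable_at)
  then show ?thesis using assms
    by (auto simp: D_arc_def cone_D_scale mult.left_commute intro!: holomorphic_intros)
qed

lemma D_arc_exists:
  assumes pt: "cone_D x y w"
  obtains U X Y W s where "D_arc U X Y W" "s \<in> U" "X s = x" "Y s = y" "W s = w"
proof -
  have chart1: "\<exists>U X Y W s. D_arc U X Y W \<and> s \<in> U \<and> X s = x \<and> Y s = 1 \<and> W s = w"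
    if "quartic x 1 w = 0" for x w
  proof -
    have "chart1.p x w = 0" using that by (simp add: chart1_p)
    then show ?thesis
    proof (cases rule: chart1.local_graph)
      case (over_x U \<psi>)
      then show ?thesis
        by (intro exI[of _ U] exI[of _ "\<lambda>s. s"] exI[of _ "\<lambda>s. 1"] exI[of _ \<psi>] exI[of _ x] conjI D_arc_chart1_graph_x)
          (auto simp: chart1_p)
    next
      case (over_w U \<xi>)
      then show ?thesis
        by (intro exI[of _ U] exI[of _ \<xi>] exI[of _ "\<lambda>s. 1"] exI[of _ "\<lambda>s. s"] exI[of _ w] conjI D_arc_chart1_graph_w)
          (auto simp: chart1_p)
    qed
  qed
  have chart2: "\<exists>U X Y W s. D_arc U X Y W \<and> s \<in> U \<and> X s = 1 \<and> Y s = y \<and> W s = w"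
    if "quartic 1 y w = 0" for y w
  proof -
    have "chart2.p y w = 0" using that by (simp add: chart2_p)
    then show ?thesis
    proof (cases rule: chart2.local_graph)
      case (over_x U \<psi>)
      then show ?thesis
        by (intro exI[of _ U] exI[of _ "\<lambda>s. 1"] exI[of _ "\<lambda>s. s"] exI[of _ \<psi>] exI[of _ y] conjI D_arc_chart2_graph_y)
          (auto simp: chart2_p)
    next
      case (over_w U \<xi>)
      then show ?thesis
        by (intro exI[of _ U] exI[of _ "\<lambda>s. 1"] exI[of _ \<xi>] exI[of _ "\<lambda>s. s"] exI[of _ w] conjI D_arc_chart2_graph_w)
          (auto simp: chart2_p)
    qed
  qed
  consider "y \<noteq> 0" | "y = 0" "x \<noteq> 0" using y_zero pt by blast
  then show ?thesis
  proof cases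
    case 1
    then have "quartic (x / y) 1 (w / y) = 0" using cone_D_scale[of y "x / y" 1 "w / y"] pt by (simp add: cone_D_def)
    then obtain U X Y W s where arc: "D_arc U X Y W" "s \<in> U" "X s = x / y" "Y s = 1" "W s = w / y"
      using chart1 by blast
    show ?thesis by (rule that[OF D_arc_scale[OF arc(1) 1] arc(2)]) (use arc 1 in auto)
  next
    case 2
    then have "quartic 1 (y / x) (w / x) = 0" using cone_D_scale[of x 1 "y / x" "w / x"] pt by (simp add: cone_D_def)
    then obtain U X Y W s where arc: "D_arc U X Y W" "s \<in> U" "X s = 1" "Y s = y / x" "W s = w / x"
      using chart2 by blast
    show ?thesis by (rule that[OF D_arc_scale[OF arc(1) 2(2)] arc(2)]) (use arc 2 in auto)
  qed
qed

end

section \<open>Differentials of the equations of D\<close>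

lemma has_derivative_vecI:
  fixes f :: "'a::real_normed_vector \<Rightarrow> complex ^ 4"
  assumes "\<And>i. ((\<lambda>x. f x $ i) has_derivative (\<lambda>h. f' h $ i)) (at x)"
  shows "(f has_derivative f') (at x)"
  by (subst has_derivative_componentwise_within)
    (simp add: Basis_vec_def inner_axis has_derivative_inner_left assms)

text \<open>Twice the symmetrized bilinear form of \<open>M\<close>: the differential at
  \<open>P\<close> of the quadratic form with matrix \<open>M\<close>.\<close>

definition polar :: "complex ^ 4 ^ 4 \<Rightarrow> complex ^ 4 \<Rightarrow> complex ^ 4 \<Rightarrow> complex" where
  "polar M P v = (\<Sum>i\<in>UNIV. \<Sum>j\<in>UNIV. M $ i $ j * (P $ i * v $ j + v $ i * P $ j))"

text \<open>Each coordinate vanishes on a line of the plane of D, and there the equation of D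
  becomes \<open>q\<^sup>2\<close>; so the four lines are bitangents, possibly with coinciding
  points of contact. The fixed matrix \<open>M\<close> gives access to the differential of
  \<open>q\<close>.\<close>

locale bitangent_cover =
  fixes q :: "complex ^ 4 \<Rightarrow> complex" and M :: "complex ^ 4 ^ 4"
  assumes q_eq: "q P = (\<Sum>i\<in>UNIV. \<Sum>j\<in>UNIV. M $ i $ j * P $ i * P $ j)"
    and smooth_D: "smooth_complete_intersection D_linear (D_quartic q)"
begin

lemma has_derivative_q: "(q has_derivative polar M P) (at P)"
proof -
  have "(\<lambda>P. \<Sum>i\<in>UNIV. \<Sum>j\<in>UNIV. M $ i $ j * P $ i * P $ j) = q" by (simp add: fun_eq_iff q_eq)
  moreover have "((\<lambda>P. \<Sum>i\<in>UNIV. \<Sum>j\<in>UNIV. M $ i $ j * P $ i * P $ j) has_derivative polar M P) (at P)"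
    unfolding polar_def
    by (rule derivative_eq_intros bounded_linear.has_derivative[OF bounded_linear_vec_nth] refl)+
      (simp add: fun_eq_iff algebra_simps)
  ultimately show ?thesis by simp
qed

lemma polar_linear: "polar M P (c *s u + d *s v) = c * polar M P u + d * polar M P v"
  by (simp add: polar_def sum.distrib sum_distrib_left algebra_simps)

lemma differential_D_linear: "differential D_linear P v = v $ 1 + v $ 2 + v $ 3 + v $ 4"
proof -
  have "(D_linear has_derivative (\<lambda>v. v $ 1 + v $ 2 + v $ 3 + v $ 4)) (at P)"
    unfolding D_linear_def
    by (rule derivative_eq_intros bounded_linear.has_derivative[OF bounded_linear_vec_nth] refl)+
  then show ?thesis by (simp add: frechet_derivative_at[symmetric])
qed

definition cofactor_sum :: "complex ^ 4 \<Rightarrow> complex ^ 4 \<Rightarrow> complex" where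
  "cofactor_sum P v = v $ 1 * P $ 2 * P $ 3 * P $ 4 + P $ 1 * v $ 2 * P $ 3 * P $ 4 +
     P $ 1 * P $ 2 * v $ 3 * P $ 4 + P $ 1 * P $ 2 * P $ 3 * v $ 4"

lemma has_derivative_product:
  "((\<lambda>P. P $ 1 * P $ 2 * P $ 3 * P $ 4) has_derivative cofactor_sum P) (at P)" for P :: "complex ^ 4"
  unfolding cofactor_sum_def
  by (rule derivative_eq_intros bounded_linear.has_derivative[OF bounded_linear_vec_nth] refl)+
    (simp add: fun_eq_iff algebra_simps)

lemma differential_D_quartic:
  "differential (D_quartic q) P v = 2 * q P * polar M P v - cofactor_sum P v"
proof -
  have "(D_quartic q has_derivative (\<lambda>v. 2 * q P * polar M P v - cofactor_sum P v)) (at P)"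
    unfolding D_quartic_def
    by (rule derivative_eq_intros has_derivative_q has_derivative_product refl)+
      (simp add: fun_eq_iff algebra_simps)
  then show ?thesis by (simp add: frechet_derivative_at[symmetric])
qed

definition sq :: "complex ^ 4 \<Rightarrow> complex ^ 4 \<Rightarrow> complex ^ 4" where
  "sq P v = (\<chi> i. 2 * P $ i * v $ i)"

lemma has_derivative_squares: "(squares has_derivative sq P) (at P)"
proof -
  have "((\<lambda>P. (P $ i)\<^sup>2) has_derivative (\<lambda>v. 2 * P $ i * v $ i)) (at P)" for i
    by (rule derivative_eq_intros bounded_linear.has_derivative[OF bounded_linear_vec_nth] refl)+
      (simp add: fun_eq_iff algebra_simps)
  then show ?thesis by (intro has_derivative_vecI) (simp add: squares_def sq_def)
qed

section \<open>The cover of the quartic by the space curve\<close>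

definition plane_point :: "complex \<Rightarrow> complex \<Rightarrow> complex \<Rightarrow> complex ^ 4" where
  "plane_point x y w = vector [x, y, w, - (x + y + w)]"

lemma plane_point_nth:
  "plane_point x y w $ 1 = x" "plane_point x y w $ 2 = y" "plane_point x y w $ 3 = w"
  "plane_point x y w $ 4 = - (x + y + w)"
  by (simp_all add: plane_point_def vector_4)

lemma plane_point_eqI: "D_linear z = 0 \<Longrightarrow> z = plane_point (z $ 1) (z $ 2) (z $ 3)"
proof -
  assume "D_linear z = 0"
  then have "z $ 4 = - (z $ 1 + z $ 2 + z $ 3)" unfolding D_linear_def by algebra
  then show ?thesis by (simp add: vec_eq_iff forall_4 plane_point_nth)
qed

text \<open>The coefficients of \<open>q\<close> on the plane: values at a basis and, for the mixed
  terms, polarization.\<close>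

definition qc :: "nat \<Rightarrow> complex" where
  "qc = (!) [0, q (plane_point 1 0 0), q (plane_point 0 1 0), q (plane_point 0 0 1),
     q (plane_point 1 1 0) - q (plane_point 1 0 0) - q (plane_point 0 1 0),
     q (plane_point 1 0 1) - q (plane_point 1 0 0) - q (plane_point 0 0 1),
     q (plane_point 0 1 1) - q (plane_point 0 1 0) - q (plane_point 0 0 1)]"

lemma q_plane_point: "q (plane_point x y w) = quad qc x y w"
  by (simp add: quad_def qc_def q_eq sum_4 plane_point_nth power2_eq_square algebra_simps)

lemma polar_eq: "polar M P v = q (P + v) - q P - q v"
  by (simp add: polar_def q_eq sum.distrib[symmetric] sum_subtractf[symmetric] algebra_simps)

lemma D_quartic_plane_point:
  "D_quartic q (plane_point x y w) = (quad qc x y w)\<^sup>2 + x * y * w * (x + y + w)"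
  unfolding D_quartic_def q_plane_point plane_point_nth by algebra

lemma differential_D_quartic_plane_point:
  "differential (D_quartic q) (plane_point x y w) (plane_point a b c) =
    a * (2 * quad qc x y w * (2 * qc 1 * x + qc 4 * y + qc 5 * w) + y * w * (x + y + w) + x * y * w) +
    b * (2 * quad qc x y w * (2 * qc 2 * y + qc 4 * x + qc 6 * w) + x * w * (x + y + w) + x * y * w) +
    c * (2 * quad qc x y w * (2 * qc 3 * w + qc 5 * x + qc 6 * y) + x * y * (x + y + w) + x * y * w)"
proof -
  have "plane_point x y w + plane_point a b c = plane_point (x + a) (y + b) (w + c)"
    by (simp add: vec_eq_iff forall_4 plane_point_nth)
  then have "polar M (plane_point x y w) (plane_point a b c) =
      a * (2 * qc 1 * x + qc 4 * y + qc 5 * w) + b * (2 * qc 2 * y + qc 4 * x + qc 6 * w) +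
      c * (2 * qc 3 * w + qc 5 * x + qc 6 * y)"
    by (simp add: polar_eq q_plane_point quad_def power2_eq_square algebra_simps)
  then show ?thesis
    unfolding differential_D_quartic q_plane_point cofactor_sum_def plane_point_nth by algebra
qed

lemma plane_quartic_qc: "plane_quartic qc"
proof (rule plane_quartic.intro, rule ccontr)
  fix x y w
  assume 0: "(quad qc x y w)\<^sup>2 + x * y * w * (x + y + w) = 0" and nz: "x \<noteq> 0 \<or> y \<noteq> 0 \<or> w \<noteq> 0"
    and crit: "\<not> (2 * quad qc x y w * (2 * qc 1 * x + qc 4 * y + qc 5 * w) + y * w * (x + y + w) + x * y * w \<noteq> 0 \<or>
      2 * quad qc x y w * (2 * qc 2 * y + qc 4 * x + qc 6 * w) + x * w * (x + y + w) + x * y * w \<noteq> 0 \<or>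
      2 * quad qc x y w * (2 * qc 3 * w + qc 5 * x + qc 6 * y) + x * y * (x + y + w) + x * y * w \<noteq> 0)"
  let ?P = "plane_point x y w"
  have tangent: "differential (D_quartic q) ?P (plane_point a b c) = 0" for a b c
    using crit unfolding differential_D_quartic_plane_point by simp
  \<comment> \<open>\<open>e4\<close> is transversal to the plane, and
    \<open>differential D_linear\<close> is 1 on it. The differential of the quartic vanishes along
    the plane, so it is \<open>\<mu>\<close> times that of \<open>D_linear\<close>, against the
    Jacobian criterion.\<close>
  define e4 :: "complex ^ 4" where "e4 = axis 4 1"
  define \<mu> where "\<mu> = differential (D_quartic q) ?P e4"
  have "?P \<noteq> 0"
  proof
    assume "?P = 0"
    then have "?P $ 1 = 0" "?P $ 2 = 0" "?P $ 3 = 0" by simp_all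
    with nz show False by (simp add: plane_point_nth)
  qed
  then have cone: "?P \<in> cone D_linear (D_quartic q)"
    using 0 by (simp add: cone_def D_quartic_plane_point) (simp add: D_linear_def plane_point_nth)
  have "(- \<mu>) * differential D_linear ?P v + 1 * differential (D_quartic q) ?P v = 0" for v
  proof -
    define v' where "v' = plane_point (v $ 1) (v $ 2) (v $ 3)"
    have v: "v = 1 *s v' + (v $ 1 + v $ 2 + v $ 3 + v $ 4) *s e4"
      by (simp add: vec_eq_iff forall_4 v'_def plane_point_nth e4_def axis_def)
    have "differential (D_quartic q) ?P (1 *s v' + c *s e4) =
        differential (D_quartic q) ?P v' + c * differential (D_quartic q) ?P e4" for c
      unfolding differential_D_quartic polar_linear
      by (simp add: cofactor_sum_def algebra_simps)
    then have "differential (D_quartic q) ?P v =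
        (v $ 1 + v $ 2 + v $ 3 + v $ 4) * differential (D_quartic q) ?P e4"
      using v tangent unfolding v'_def by (metis add_0)
    then show ?thesis by (simp add: differential_D_linear \<mu>_def)
  qed
  then show False using smooth_D cone unfolding smooth_complete_intersection_def by (metis zero_neq_one)
qed

end

sublocale bitangent_cover \<subseteq> plane_quartic qc by (rule plane_quartic_qc)

context bitangent_cover
begin

abbreviation CC :: "(complex ^ 4) set" where "CC \<equiv> cone C_quadric (C_quartic q)"

lemma mem_CC:
  "P \<in> CC \<longleftrightarrow> P \<noteq> 0 \<and> D_linear (squares P) = 0 \<and> q (squares P) = P $ 1 * P $ 2 * P $ 3 * P $ 4"
  by (simp add: cone_def C_quadric_def D_linear_def C_quartic_def squares_def)

lemma q_squares: "P \<in> CC \<Longrightarrow> quad qc ((P $ 1)\<^sup>2) ((P $ 2)\<^sup>2) ((P $ 3)\<^sup>2) = P $ 1 * P $ 2 * P $ 3 * P $ 4"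
  using plane_point_eqI[of "squares P"] q_plane_point by (simp add: mem_CC squares_def)

lemma fourth_square: "P \<in> CC \<Longrightarrow> (P $ 4)\<^sup>2 = - ((P $ 1)\<^sup>2 + (P $ 2)\<^sup>2 + (P $ 3)\<^sup>2)"
  by (simp add: mem_CC D_linear_def squares_def add_eq_0_iff)

lemma cone_D_squares: assumes "P \<in> CC" shows "cone_D ((P $ 1)\<^sup>2) ((P $ 2)\<^sup>2) ((P $ 3)\<^sup>2)"
proof -
  have "quartic ((P $ 1)\<^sup>2) ((P $ 2)\<^sup>2) ((P $ 3)\<^sup>2) = 0"
    unfolding quartic_def q_squares[OF assms] using fourth_square[OF assms] by algebra
  moreover have "P $ 1 \<noteq> 0 \<or> P $ 2 \<noteq> 0 \<or> P $ 3 \<noteq> 0"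
  proof (rule ccontr)
    assume "\<not> (P $ 1 \<noteq> 0 \<or> P $ 2 \<noteq> 0 \<or> P $ 3 \<noteq> 0)"
    then have "P = 0" using fourth_square[OF assms] by (simp add: vec_eq_iff forall_4)
    then show False using assms by (simp add: mem_CC)
  qed
  ultimately show ?thesis by (auto simp: cone_D_def)
qed

text \<open>Two vanishing coordinates would put the image of \<open>P\<close> on two of the four
  bitangents at once, which smoothness of D forbids.\<close>

lemma zero_coordinate_unique:
  assumes "P \<in> CC" "P $ i = 0" "P $ j = 0" shows "i = j"
proof -
  have "(P $ 4)\<^sup>2 = 0 \<longleftrightarrow> (P $ 1)\<^sup>2 + (P $ 2)\<^sup>2 + (P $ 3)\<^sup>2 = 0"
    unfolding fourth_square[OF assms(1)] by (simp only: neg_equal_0_iff_equal)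
  note D = cone_D_squares[OF assms(1)] and fourth = this
  have "P $ 1 = 0 \<Longrightarrow> P $ 2 \<noteq> 0 \<and> P $ 3 \<noteq> 0 \<and> P $ 4 \<noteq> 0"
    using x_zero[of "(P $ 2)\<^sup>2" "(P $ 3)\<^sup>2"] D fourth by auto
  moreover have "P $ 2 = 0 \<Longrightarrow> P $ 1 \<noteq> 0 \<and> P $ 3 \<noteq> 0 \<and> P $ 4 \<noteq> 0"
    using y_zero[of "(P $ 1)\<^sup>2" "(P $ 3)\<^sup>2"] D fourth by auto
  moreover have "P $ 3 = 0 \<Longrightarrow> P $ 1 \<noteq> 0 \<and> P $ 2 \<noteq> 0 \<and> P $ 4 \<noteq> 0"
    using w_zero[of "(P $ 1)\<^sup>2" "(P $ 2)\<^sup>2"] D fourth by auto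
  moreover have "P $ 4 = 0 \<Longrightarrow> P $ 1 \<noteq> 0 \<and> P $ 2 \<noteq> 0 \<and> P $ 3 \<noteq> 0"
    using t_zero[OF D] fourth by auto
  ultimately show ?thesis
    using assms(2,3) exhaust_4[of i] exhaust_4[of j] by metis
qed

lemma three_nonzero: assumes "P \<in> CC" obtains i where "\<And>j. j \<noteq> i \<Longrightarrow> P $ j \<noteq> 0"
proof (cases "\<exists>i. P $ i = 0")
  case True
  then show ?thesis using that zero_coordinate_unique[OF assms] by metis
qed (use that in blast)

lemma prod_4: "(\<Prod>j\<in>UNIV. f j) = f 1 * f 2 * f 3 * f (4 :: 4)" for f :: "4 \<Rightarrow> complex"
  unfolding UNIV_4 by (simp add: mult_ac)

lemma prod_split: "(\<Prod>j\<in>UNIV. f j) = f i * (\<Prod>j\<in>-{i}. f j)" for f :: "4 \<Rightarrow> complex"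
  by (subst prod.remove[of _ i]) (auto simp: Compl_eq_Diff_UNIV)

lemma coordinate_eq:
  assumes "P \<in> CC" "\<And>j. j \<noteq> i \<Longrightarrow> P $ j \<noteq> 0"
  shows "P $ i = q (squares P) / (\<Prod>j\<in>-{i}. P $ j)"
proof -
  have "q (squares P) = P $ i * (\<Prod>j\<in>-{i}. P $ j)"
    using assms(1) prod_split[of "\<lambda>j. P $ j" i] by (simp add: mem_CC prod_4)
  moreover have "(\<Prod>j\<in>-{i}. P $ j) \<noteq> 0" using assms(2) by simp
  ultimately show ?thesis by simp
qed

definition lift :: "4 \<Rightarrow> complex ^ 4 \<Rightarrow> (4 \<Rightarrow> complex) \<Rightarrow> complex ^ 4" where
  "lift i z \<rho> = (\<chi> j. if j = i then q z / (\<Prod>k\<in>-{i}. \<rho> k) else \<rho> j)"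

text \<open>Three square roots determine the fourth: this is what makes the cover unramified
  over the points where a coordinate vanishes.\<close>

lemma lift_mem:
  assumes D: "cone_D x y w" and z: "z = plane_point x y w"
    and \<rho>: "\<And>j. j \<noteq> i \<Longrightarrow> (\<rho> j)\<^sup>2 = z $ j" "\<And>j. j \<noteq> i \<Longrightarrow> z $ j \<noteq> 0"
  shows "squares (lift i z \<rho>) = z" "lift i z \<rho> \<in> CC"
proof -
  let ?p = "\<Prod>k\<in>-{i}. \<rho> k"
  have "\<rho> j \<noteq> 0" if "j \<noteq> i" for j using \<rho>[OF that] by auto
  then have p: "?p \<noteq> 0" by simp
  have "(q z)\<^sup>2 = (\<Prod>j\<in>UNIV. z $ j)"
    using D unfolding cone_D_def quartic_def z q_plane_point prod_4 plane_point_nth by algebra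
  also have "\<dots> = z $ i * (\<Prod>k\<in>-{i}. z $ k)" by (rule prod_split)
  also have "(\<Prod>k\<in>-{i}. z $ k) = ?p\<^sup>2"
    unfolding prod_power_distrib by (rule prod.cong) (auto simp: \<rho>)
  finally have "(q z / ?p)\<^sup>2 = z $ i" using p by (simp add: power_divide)
  then show sq: "squares (lift i z \<rho>) = z"
    by (simp add: vec_eq_iff squares_def lift_def \<rho>)
  have "q z = (\<Prod>j\<in>UNIV. lift i z \<rho> $ j)"
  proof -
    have "(\<Prod>j\<in>-{i}. lift i z \<rho> $ j) = ?p" by (rule prod.cong) (auto simp: lift_def)
    then show ?thesis unfolding prod_split[of _ i] using p by (simp add: lift_def)
  qed
  moreover have "z \<noteq> 0"
  proof
    assume "z = 0"
    then have "z $ 1 = 0" "z $ 2 = 0" "z $ 3 = 0" by simp_all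
    then show False using D z by (simp add: cone_D_def plane_point_nth)
  qed
  then have "lift i z \<rho> \<noteq> 0"
    using sq by (metis (no_types, lifting) squares_def vec_eq_iff vec_lambda_beta zero_index zero_power2)
  ultimately show "lift i z \<rho> \<in> CC"
    using z unfolding mem_CC sq by (simp add: prod_4 D_linear_def plane_point_nth)
qed

lemma lift_eq: "P \<in> CC \<Longrightarrow> (\<And>j. j \<noteq> i \<Longrightarrow> P $ j \<noteq> 0) \<Longrightarrow> lift i (squares P) (($) P) = P"
  using coordinate_eq[of P i] by (simp add: lift_def vec_eq_iff)

text \<open>At most one of the four coordinates vanishes at a point of D; any square roots of the
  other three are completed by \<open>lift\<close>.\<close>

lemma point_over: assumes D: "cone_D x y w" obtains P where "P \<in> CC" "squares P = plane_point x y w"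
proof -
  let ?z = "plane_point x y w"
  have "\<exists>i. \<forall>j. j \<noteq> i \<longrightarrow> ?z $ j \<noteq> 0"
  proof -
    consider "x = 0" | "y = 0" | "w = 0" | "x \<noteq> 0" "y \<noteq> 0" "w \<noteq> 0" by blast
    then show ?thesis
    proof cases
      case 1 with x_zero[of y w] D show ?thesis
        by (intro exI[of _ 1]) (auto simp: forall_4 plane_point_nth add_eq_0_iff)
    next
      case 2 with y_zero[of x w] D show ?thesis
        by (intro exI[of _ 2]) (auto simp: forall_4 plane_point_nth add_eq_0_iff)
    next
      case 3 with w_zero[of x y] D show ?thesis
        by (intro exI[of _ 3]) (auto simp: forall_4 plane_point_nth add_eq_0_iff)
    next
      case 4 then show ?thesis by (intro exI[of _ 4]) (simp add: forall_4 plane_point_nth)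
    qed
  qed
  then obtain i where i: "\<And>j. j \<noteq> i \<Longrightarrow> ?z $ j \<noteq> 0" by blast
  show ?thesis
    by (rule that[OF lift_mem(2,1)[OF D refl, of i "\<lambda>j. csqrt (?z $ j)"]]) (use i in auto)
qed

abbreviation cone_arc :: "complex set \<Rightarrow> (complex \<Rightarrow> complex ^ 4) \<Rightarrow> bool" where
  "cone_arc \<equiv> holomorphic_arc C_quadric (C_quartic q)"

text \<open>Along these arcs the residue of the velocity has no zeros, so it can be divided
  out.\<close>

definition immersed_arc :: "complex set \<Rightarrow> (complex \<Rightarrow> complex ^ 4) \<Rightarrow> bool" where
  "immersed_arc U \<gamma> \<longleftrightarrow> cone_arc U \<gamma> \<and>
     (\<forall>s\<in>U. \<forall>c. velocity \<gamma> s \<noteq> c *s \<gamma> s)"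

text \<open>Local lifting through the cover: three coordinates are holomorphic square roots, and the
  fourth follows from the equation of C.\<close>

lemma lift_arc:
  assumes arc: "D_arc U X Y W" and s0: "s0 \<in> U"
    and P0: "P0 \<in> CC" "squares P0 = plane_point (X s0) (Y s0) (W s0)"
  obtains r \<gamma> where "0 < r" "ball s0 r \<subseteq> U" "immersed_arc (ball s0 r) \<gamma>" "\<gamma> s0 = P0"
    "\<And>s. s \<in> ball s0 r \<Longrightarrow> squares (\<gamma> s) = plane_point (X s) (Y s) (W s)"
proof -
  define Z where "Z s = plane_point (X s) (Y s) (W s)" for s
  have U: "open U" and hol: "X holomorphic_on U" "Y holomorphic_on U" "W holomorphic_on U"
    and D: "\<And>s. s \<in> U \<Longrightarrow> cone_D (X s) (Y s) (W s)"
    and imm: "\<And>s c. s \<in> U \<Longrightarrow> \<not> (deriv X s = c * X s \<and> deriv Y s = c * Y s \<and> deriv W s = c * W s)"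
    using arc unfolding D_arc_def by blast+
  have holZ: "(\<lambda>s. Z s $ j) holomorphic_on U" for j
    using exhaust_4[of j] by (auto simp: Z_def plane_point_nth intro!: holomorphic_intros hol)
  have Z0: "Z s0 $ j = (P0 $ j)\<^sup>2" for j using P0(2) by (simp add: Z_def flip: P0(2)) (simp add: squares_def)
  obtain i where i: "\<And>j. j \<noteq> i \<Longrightarrow> P0 $ j \<noteq> 0" using three_nonzero[OF P0(1)] by blast
  \<comment> \<open>The normalization to 1 at \<open>s0\<close> keeps \<open>u j s\<close> in the
    right half plane near \<open>s0\<close>, where \<open>csqrt\<close> is holomorphic; the factor
    \<open>P0 $ j\<close> in \<open>\<rho>\<close> selects the square root that starts at
    \<open>P0\<close>. If coordinate \<open>i\<close> vanishes at \<open>s0\<close>, then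
    \<open>u i\<close> is 0 by convention.\<close>
  define u where "u j s = Z s $ j / Z s0 $ j" for j s
  have holu: "u j holomorphic_on U" for j
    unfolding u_def by (cases "Z s0 $ j = 0") (auto intro!: holomorphic_intros holZ)
  have "\<forall>\<^sub>F s in nhds s0. s \<in> U \<and> (\<forall>j\<in>-{i}. 0 < Re (u j s))"
  proof (intro eventually_conj eventually_ball_finite ballI)
    show "\<forall>\<^sub>F s in nhds s0. s \<in> U" using U s0 by (rule eventually_nhds_in_open)
    fix j assume "j \<in> -{i}"
    then have "u j s0 = 1" using i by (simp add: u_def Z0)
    have "isCont (u j) s0"
      using holomorphic_on_imp_continuous_on[OF holu] U s0 by (simp add: continuous_on_eq_continuous_at)
    then have "isCont (\<lambda>s. Re (u j s)) s0" by (rule continuous_Re)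
    then have "((\<lambda>s. Re (u j s)) \<longlongrightarrow> Re (u j s0)) (nhds s0)"
      unfolding isCont_def using tendsto_at_iff_tendsto_nhds[of "\<lambda>s. Re (u j s)" s0] by blast
    then show "\<forall>\<^sub>F s in nhds s0. 0 < Re (u j s)"
      by (rule order_tendstoD(1)) (simp add: \<open>u j s0 = 1\<close>)
  qed simp
  then obtain r where r: "0 < r" "\<And>s. s \<in> ball s0 r \<Longrightarrow> s \<in> U \<and> (\<forall>j\<in>-{i}. 0 < Re (u j s))"
    by (auto simp: eventually_nhds_metric dist_commute)
  define \<rho> where "\<rho> s j = P0 $ j * csqrt (u j s)" for s j
  define \<gamma> where "\<gamma> s = lift i (Z s) (\<rho> s)" for s
  have \<rho>: "(\<rho> s j)\<^sup>2 = Z s $ j" if "j \<noteq> i" for s j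
    using i[OF that] by (simp add: \<rho>_def power_mult_distrib u_def Z0)
  have Znz: "Z s $ j \<noteq> 0" if "s \<in> ball s0 r" "j \<noteq> i" for s j
  proof -
    have "0 < Re (u j s)" using r(2)[OF that(1)] that(2) by blast
    then show ?thesis by (auto simp: u_def)
  qed
  have \<gamma>: "squares (\<gamma> s) = Z s" "\<gamma> s \<in> CC" if "s \<in> ball s0 r" for s
    unfolding \<gamma>_def using lift_mem[OF D Z_def \<rho> Znz] r(2) that by auto
  have \<gamma>0: "\<gamma> s0 = P0"
  proof -
    have \<rho>0: "\<rho> s0 j = P0 $ j" if "j \<noteq> i" for j using i[OF that] by (simp add: \<rho>_def u_def Z0)
    then have "(\<Prod>k\<in>-{i}. \<rho> s0 k) = (\<Prod>k\<in>-{i}. P0 $ k)" by (intro prod.cong) auto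
    moreover have "Z s0 = squares P0" by (simp add: Z_def P0(2))
    ultimately have "\<gamma> s0 = lift i (squares P0) (($) P0)"
      unfolding \<gamma>_def lift_def using \<rho>0 by (simp cong: if_cong)
    then show ?thesis using lift_eq[OF P0(1) i] by simp
  qed
  have hol\<rho>: "(\<lambda>s. \<rho> s j) holomorphic_on ball s0 r" if "j \<noteq> i" for j
  proof -
    have "u j s \<notin> \<real>\<^sub>\<le>\<^sub>0" if "s \<in> ball s0 r" for s
    proof -
      have "0 < Re (u j s)" using r(2)[OF that] \<open>j \<noteq> i\<close> by blast
      then show ?thesis by (auto simp: complex_nonpos_Reals_iff)
    qed
    moreover have "u j holomorphic_on ball s0 r"
      using holu r(2) by (meson holomorphic_on_subset subsetI)
    ultimately show ?thesis unfolding \<rho>_def by (intro holomorphic_intros) auto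
  qed
  have \<rho>nz: "\<rho> s j \<noteq> 0" if "s \<in> ball s0 r" "j \<noteq> i" for s j using \<rho>[of j s] Znz[OF that] that by auto
  have hol\<gamma>: "(\<lambda>s. \<gamma> s $ j) holomorphic_on ball s0 r" for j
  proof (cases "j = i")
    case True
    have "(\<lambda>s. q (Z s)) holomorphic_on ball s0 r"
      unfolding q_eq using holZ r(2) by (intro holomorphic_intros; meson holomorphic_on_subset subsetI)
    then have "(\<lambda>s. q (Z s) / (\<Prod>k\<in>-{i}. \<rho> s k)) holomorphic_on ball s0 r"
      using hol\<rho> \<rho>nz by (intro holomorphic_intros) auto
    then show ?thesis using True by (simp add: \<gamma>_def lift_def)
  next
    case False
    then show ?thesis using hol\<rho>[OF False] by (simp add: \<gamma>_def lift_def)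
  qed
  \<comment> \<open>Squaring doubles logarithmic derivatives: a radial velocity with factor
    \<open>c\<close> on C would give one with factor \<open>2 * c\<close> on D, where the arc is
    immersed.\<close>
  have "velocity \<gamma> s \<noteq> c *s \<gamma> s" if s: "s \<in> ball s0 r" for s c
  proof
    assume vel: "velocity \<gamma> s = c *s \<gamma> s"
    have "deriv (\<lambda>s. Z s $ j) s = (2 * c) * Z s $ j" for j
    proof (rule DERIV_imp_deriv)
      have "deriv (\<lambda>s. \<gamma> s $ j) s = c * \<gamma> s $ j"
        using arg_cong[OF vel, of "\<lambda>v. v $ j"] by (simp add: velocity_def)
      moreover have "((\<lambda>s. \<gamma> s $ j) has_field_derivative deriv (\<lambda>s. \<gamma> s $ j) s) (at s)"
        using holomorphic_derivI[OF hol\<gamma> open_ball s] .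
      ultimately have d: "((\<lambda>s. (\<gamma> s $ j)\<^sup>2) has_field_derivative 2 * \<gamma> s $ j * (c * \<gamma> s $ j)) (at s)"
        by (auto intro!: derivative_eq_intros)
      have eq: "(\<gamma> s $ j)\<^sup>2 = Z s $ j" if "s \<in> ball s0 r" for s
        using \<gamma>(1)[OF that] by (simp add: squares_def vec_eq_iff)
      have *: "2 * \<gamma> s $ j * (c * \<gamma> s $ j) = (2 * c) * Z s $ j"
        unfolding eq[OF s, symmetric] by (simp add: power2_eq_square)
      show "((\<lambda>s. Z s $ j) has_field_derivative (2 * c) * Z s $ j) (at s)"
        unfolding *[symmetric] by (rule has_field_derivative_transform_within_open[OF d open_ball s]) (rule eq)
    qed
    from this[of 1] this[of 2] this[of 3] show False
      using imm[of s "2 * c"] r(2)[OF s] by (simp add: Z_def plane_point_nth)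
  qed
  then have "immersed_arc (ball s0 r) \<gamma>"
    unfolding immersed_arc_def holomorphic_arc_def using \<gamma>(2) hol\<gamma> by auto
  then show ?thesis
    by (intro that[of r \<gamma>] r(1) \<gamma>0) (use r(2) \<gamma>(1) in \<open>auto simp: Z_def\<close>)
qed

lemma immersed_arc_exists:
  assumes "P \<in> CC" obtains U \<gamma> s where "immersed_arc U \<gamma>" "s \<in> U" "\<gamma> s = P"
proof -
  obtain U X Y W s where arc: "D_arc U X Y W" "s \<in> U" "X s = (P $ 1)\<^sup>2" "Y s = (P $ 2)\<^sup>2" "W s = (P $ 3)\<^sup>2"
    by (rule D_arc_exists[OF cone_D_squares[OF assms]])
  have "squares P = plane_point (X s) (Y s) (W s)"
    unfolding arc using plane_point_eqI[of "squares P"] assms by (simp add: mem_CC squares_def)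
  then obtain r \<gamma> where lift: "0 < r" "immersed_arc (ball s r) \<gamma>" "\<gamma> s = P"
    by (rule lift_arc[OF arc(1,2) assms]) blast
  show ?thesis by (rule that[OF lift(2) _ lift(3)]) (simp add: lift(1))
qed

section \<open>Sections on C and their descent to D\<close>

definition C_homogeneous :: "nat \<Rightarrow> (complex ^ 4 \<Rightarrow> complex) \<Rightarrow> bool" where
  "C_homogeneous k f \<longleftrightarrow> (\<forall>P\<in>CC. \<forall>c. c \<noteq> 0 \<longrightarrow> f (c *s P) = c ^ k * f P)"

text \<open>Tested along immersed arcs, because the coefficient of a form is found by dividing by
  the residue of the velocity, which can vanish on other arcs.\<close>

definition C_regular :: "(complex ^ 4 \<Rightarrow> complex) \<Rightarrow> bool" where
  "C_regular f \<longleftrightarrow> (\<forall>U \<gamma>. immersed_arc U \<gamma> \<longrightarrow> (\<lambda>s. f (\<gamma> s)) holomorphic_on U)"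

definition character :: "complex \<Rightarrow> complex \<Rightarrow> (complex ^ 4 \<Rightarrow> complex) \<Rightarrow> bool" where
  "character \<alpha> \<beta> f \<longleftrightarrow> (\<forall>P\<in>CC. f (act_a P) = \<alpha> * f P \<and> f (act_b P) = \<beta> * f P)"

lemma act_nth:
  "act_a P $ 1 = P $ 1" "act_a P $ 2 = P $ 2" "act_a P $ 3 = - P $ 3" "act_a P $ 4 = - P $ 4"
  "act_b P $ 1 = P $ 1" "act_b P $ 2 = - P $ 2" "act_b P $ 3 = P $ 3" "act_b P $ 4 = - P $ 4"
  by (simp_all add: act_a_def act_b_def vector_4)

lemma squares_act: "squares (act_a P) = squares P" "squares (act_b P) = squares P"
  by (simp_all add: vec_eq_iff forall_4 squares_def act_nth)

lemma act_mem_CC: "P \<in> CC \<Longrightarrow> act_a P \<in> CC" "P \<in> CC \<Longrightarrow> act_b P \<in> CC"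
  unfolding mem_CC squares_act by (auto simp: act_nth vec_eq_iff forall_4)

lemma squares_scale: "squares (c *s P) = c\<^sup>2 *s squares P"
  by (simp add: vec_eq_iff squares_def power_mult_distrib)

lemma q_scale: "q (c *s P) = c\<^sup>2 * q P"
  by (simp add: q_eq sum_distrib_left power2_eq_square mult_ac)

lemma scale_mem_CC: "P \<in> CC \<Longrightarrow> c \<noteq> 0 \<Longrightarrow> c *s P \<in> CC"
  unfolding mem_CC squares_scale q_scale
  by (auto simp: D_linear_def vec_eq_iff power2_eq_square simp flip: distrib_left)

text \<open>The eight sign changes of determinant 1 are generated by \<open>act_a\<close>,
  \<open>act_b\<close> and -1, and -1 acts trivially in even degree.\<close>

lemma sign_change:
  assumes f: "C_homogeneous (2 * k) f" "character 1 1 f" and P: "P \<in> CC"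
    and \<epsilon>: "\<And>j. \<epsilon> j = 1 \<or> \<epsilon> j = -1" "(\<Prod>j\<in>UNIV. \<epsilon> j) = 1"
  shows "f (\<chi> j. \<epsilon> j * P $ j) = f P"
proof -
  have a: "f (act_a Q) = f Q" and b: "f (act_b Q) = f Q" if "Q \<in> CC" for Q
    using f(2) that by (auto simp: character_def)
  have m: "f (- 1 *s Q) = f Q" if "Q \<in> CC" for Q
    using f(1) that unfolding C_homogeneous_def by (metis neg_equal_0_iff_equal one_neq_zero power_minus1_even mult_1)
  have ab: "f (act_a (act_b P)) = f P" using a[OF act_mem_CC(2)[OF P]] b[OF P] by simp
  note mem = P act_mem_CC[OF P] act_mem_CC(1)[OF act_mem_CC(2)[OF P]]
  have "\<epsilon> 4 = \<epsilon> 1 * \<epsilon> 2 * \<epsilon> 3"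
    using \<epsilon>(1)[of 1] \<epsilon>(1)[of 2] \<epsilon>(1)[of 3] \<epsilon>(1)[of 4] \<epsilon>(2) by (auto simp: prod_4)
  moreover have "v = (\<chi> j. \<epsilon> j * P $ j)" if "\<And>j. v $ j = \<epsilon> j * P $ j" for v
    using that by (simp add: vec_eq_iff)
  ultimately consider "(\<chi> j. \<epsilon> j * P $ j) \<in> {P, act_a P, act_b P, act_a (act_b P)}"
    | "(\<chi> j. \<epsilon> j * P $ j) \<in> {- 1 *s P, - 1 *s act_a P, - 1 *s act_b P, - 1 *s act_a (act_b P)}"
    using \<epsilon>(1)[of 1] \<epsilon>(1)[of 2] \<epsilon>(1)[of 3]
    by (elim disjE) (simp_all add: vec_eq_iff forall_4 act_nth)
  then show ?thesis
    using a[OF P] b[OF P] ab m[OF mem(1)] m[OF mem(2)] m[OF mem(3)] m[OF mem(4)] by cases auto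
qed

text \<open>Points with the same squares differ by signs, and the equation
  \<open>q = X Y Z T\<close> forces the product of the signs to be 1.\<close>

lemma same_squares:
  assumes f: "C_homogeneous (2 * k) f" "character 1 1 f" and P: "P \<in> CC" "P' \<in> CC"
    and sq: "squares P' = squares P"
  shows "f P' = f P"
proof -
  have "(P' $ j)\<^sup>2 = (P $ j)\<^sup>2" for j using arg_cong[OF sq, of "\<lambda>v. v $ j"] by (simp add: squares_def)
  then have "P' $ j = P $ j \<or> P' $ j = - P $ j" for j by (simp add: power2_eq_iff)
  then have "\<forall>j. \<exists>\<epsilon>. (\<epsilon> = 1 \<or> \<epsilon> = -1) \<and> P' $ j = \<epsilon> * P $ j" by (metis mult_1 mult_minus1)
  then obtain \<epsilon> where \<epsilon>: "\<And>j. \<epsilon> j = 1 \<or> \<epsilon> j = -1" "\<And>j. P' $ j = \<epsilon> j * P $ j"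
    unfolding choice_iff by blast
  obtain i where i: "\<And>j. j \<noteq> i \<Longrightarrow> P $ j \<noteq> 0" using three_nonzero[OF P(1)] by blast
  then have i': "\<And>j. j \<noteq> i \<Longrightarrow> P' $ j \<noteq> 0" using \<epsilon> by (metis mult_1 mult_minus1 neg_equal_0_iff_equal)
  \<comment> \<open>If coordinate \<open>i\<close> vanishes, its sign is arbitrary; \<open>s\<close>
    is the choice for which the product of all four signs is 1.\<close>
  define s where "s = (\<Prod>j\<in>-{i}. \<epsilon> j)"
  have "s\<^sup>2 = 1"
    unfolding s_def prod_power_distrib by (rule prod.neutral) (use \<epsilon>(1) in \<open>auto simp: power2_eq_1_iff\<close>)
  then have s: "s = 1 \<or> s = -1" "s * s = 1" by (simp add: power2_eq_1_iff, simp add: power2_eq_square)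
  have "P' $ i = s * P $ i"
  proof -
    have "(\<Prod>j\<in>-{i}. P' $ j) = s * (\<Prod>j\<in>-{i}. P $ j)"
      by (simp add: \<epsilon>(2) prod.distrib s_def)
    then have "P' $ i = q (squares P) / (s * (\<Prod>j\<in>-{i}. P $ j))"
      using coordinate_eq[OF P(2) i'] sq by simp
    also have "\<dots> = s * (q (squares P) / (\<Prod>j\<in>-{i}. P $ j))" using s(1) by auto
    finally show ?thesis using coordinate_eq[OF P(1) i] by simp
  qed
  then have "P' = (\<chi> j. (if j = i then s else \<epsilon> j) * P $ j)"
    using \<epsilon>(2) by (simp add: vec_eq_iff)
  moreover have "(\<Prod>j\<in>UNIV. if j = i then s else \<epsilon> j) = 1"
  proof -
    have "(\<Prod>j\<in>-{i}. if j = i then s else \<epsilon> j) = s" unfolding s_def by (rule prod.cong) auto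
    then show ?thesis unfolding prod_split[of _ i] using s(2) by simp
  qed
  ultimately show ?thesis using sign_change[OF f P(1), of "\<lambda>j. if j = i then s else \<epsilon> j"] \<epsilon>(1) s(1) by auto
qed

text \<open>An invariant section is constant on the fibres of \<open>squares\<close>, hence a
  function of the squares, of half the degree. Regularity descends because arcs on D lift locally to
  C.\<close>

lemma descent:
  assumes f: "C_homogeneous (2 * k) f" "character 1 1 f" "C_regular f"
  obtains g where "homogeneous k g" "regular g" "\<And>P. P \<in> CC \<Longrightarrow> f P = g ((P $ 1)\<^sup>2) ((P $ 2)\<^sup>2) ((P $ 3)\<^sup>2)"
proof -
  define g where "g x y w = f (SOME P. P \<in> CC \<and> squares P = plane_point x y w)" for x y w
  have g: "g x y w = f P" if "P \<in> CC" "squares P = plane_point x y w" for x y w P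
  proof -
    have "(SOME P. P \<in> CC \<and> squares P = plane_point x y w) \<in> CC \<and>
        squares (SOME P. P \<in> CC \<and> squares P = plane_point x y w) = plane_point x y w"
      by (rule someI[of _ P]) (use that in auto)
    then show ?thesis unfolding g_def using same_squares[OF f(1,2) that(1)] that(2) by simp
  qed
  show ?thesis
  proof (rule that)
    show "homogeneous k g"
      unfolding homogeneous_def
    proof (intro allI impI, elim conjE)
      fix x y w c assume D: "cone_D x y w" and c: "c \<noteq> (0::complex)"
      obtain P where P: "P \<in> CC" "squares P = plane_point x y w" by (rule point_over[OF D])
      \<comment> \<open>Scaling by \<open>c\<close> on the cone over D is scaling by a square root
        of \<open>c\<close> on the cone over C.\<close>
      have c': "csqrt c \<noteq> 0" using c by simp
      have "squares (csqrt c *s P) = plane_point (c * x) (c * y) (c * w)"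
        by (simp add: squares_scale P(2) vec_eq_iff forall_4 plane_point_nth algebra_simps)
      then have "g (c * x) (c * y) (c * w) = f (csqrt c *s P)"
        by (rule g[OF scale_mem_CC[OF P(1) c']])
      also have "\<dots> = c ^ k * f P"
        using f(1) P(1) c' by (simp add: C_homogeneous_def power_mult)
      finally show "g (c * x) (c * y) (c * w) = c ^ k * g x y w" using g[OF P] by simp
    qed
    show "regular g"
    proof (rule regularI)
      fix U X Y W assume arc: "D_arc U X Y W"
      have "\<exists>r>0. (\<lambda>s. g (X s) (Y s) (W s)) holomorphic_on ball s0 r" if s0: "s0 \<in> U" for s0
      proof -
        have "cone_D (X s0) (Y s0) (W s0)" using arc s0 by (simp add: D_arc_def)
        then obtain P0 where P0: "P0 \<in> CC" "squares P0 = plane_point (X s0) (Y s0) (W s0)"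
          by (rule point_over)
        obtain r \<gamma> where r: "0 < r" "immersed_arc (ball s0 r) \<gamma>"
          "\<And>s. s \<in> ball s0 r \<Longrightarrow> squares (\<gamma> s) = plane_point (X s) (Y s) (W s)"
          by (rule lift_arc[OF arc s0 P0]) blast
        have "\<gamma> s \<in> CC" if "s \<in> ball s0 r" for s
          using r(2) that by (auto simp: immersed_arc_def holomorphic_arc_def)
        then have eq: "f (\<gamma> s) = g (X s) (Y s) (W s)" if "s \<in> ball s0 r" for s
          using g[OF _ r(3)[OF that]] that by simp
        have "(\<lambda>s. f (\<gamma> s)) holomorphic_on ball s0 r" using f(3) r(2) by (auto simp: C_regular_def)
        then have "(\<lambda>s. g (X s) (Y s) (W s)) holomorphic_on ball s0 r"
          by (rule holomorphic_transform) (rule eq)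
        then show ?thesis using r(1) by blast
      qed
      then have "(\<lambda>s. g (X s) (Y s) (W s)) analytic_on U" by (auto simp: analytic_on_def)
      then show "(\<lambda>s. g (X s) (Y s) (W s)) holomorphic_on U" by (rule analytic_imp_holomorphic)
    qed
    fix P assume P: "P \<in> CC"
    then show "f P = g ((P $ 1)\<^sup>2) ((P $ 2)\<^sup>2) ((P $ 3)\<^sup>2)"
      using g[OF P] plane_point_eqI[of "squares P"] by (simp add: mem_CC squares_def)
  qed
qed

theorem invariant_section:
  assumes "C_homogeneous 2 f" "character 1 1 f" "C_regular f"
  obtains \<alpha> \<beta> \<gamma> where "\<And>P. P \<in> CC \<Longrightarrow> f P = \<alpha> * (P $ 1)\<^sup>2 + \<beta> * (P $ 2)\<^sup>2 + \<gamma> * (P $ 3)\<^sup>2"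
proof -
  obtain g where g: "homogeneous 1 g" "regular g" "\<And>P. P \<in> CC \<Longrightarrow> f P = g ((P $ 1)\<^sup>2) ((P $ 2)\<^sup>2) ((P $ 3)\<^sup>2)"
    by (rule descent[of 1 f]) (use assms in auto)
  obtain \<alpha> \<beta> \<gamma> where "\<And>x y w. cone_D x y w \<Longrightarrow> g x y w = \<alpha> * x + \<beta> * y + \<gamma> * w"
    by (rule regular_linear[OF g(1,2)]) blast
  then show ?thesis by (intro that[of \<alpha> \<beta> \<gamma>]) (simp add: g(3) cone_D_squares)
qed

text \<open>A section with a non-trivial character is divided by the monomials \<open>\<phi>\<close>, \<open>\<psi>\<close> with the same
  character: \<open>f \<phi>\<close> and \<open>f \<psi>\<close> descend to conics, and the quartic relation between these forces
  \<open>f\<close> into the span of \<open>\<phi>\<close> and \<open>\<psi>\<close>.\<close>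

theorem twisted_section:
  assumes f: "C_homogeneous 2 f" "C_regular f"
    and inv: "character 1 1 (\<lambda>P. f P * \<phi> P)" "character 1 1 (\<lambda>P. f P * \<psi> P)"
    and hom: "C_homogeneous 2 \<phi>" "C_homogeneous 2 \<psi>" and reg: "C_regular \<phi>" "C_regular \<psi>"
    and m: "pair_monomial m" "\<And>x y w. quad m x y w * quad m' x y w = - (x * y * w * (x + y + w))"
    and \<phi>: "\<And>P. P \<in> CC \<Longrightarrow> (\<phi> P)\<^sup>2 = quad m ((P $ 1)\<^sup>2) ((P $ 2)\<^sup>2) ((P $ 3)\<^sup>2)"
    and \<psi>: "\<And>P. P \<in> CC \<Longrightarrow> (\<psi> P)\<^sup>2 = quad m' ((P $ 1)\<^sup>2) ((P $ 2)\<^sup>2) ((P $ 3)\<^sup>2)"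
    and \<phi>\<psi>: "\<And>P. P \<in> CC \<Longrightarrow> \<phi> P * \<psi> P = P $ 1 * P $ 2 * P $ 3 * P $ 4"
    and nz: "\<And>P. P \<in> CC \<Longrightarrow> \<phi> P \<noteq> 0 \<or> \<psi> P \<noteq> 0"
  obtains \<mu> \<nu> where "\<And>P. P \<in> CC \<Longrightarrow> f P = \<mu> * \<phi> P + \<nu> * \<psi> P"
proof -
  have conic: "\<exists>s. \<forall>P\<in>CC. f P * \<theta> P = quad s ((P $ 1)\<^sup>2) ((P $ 2)\<^sup>2) ((P $ 3)\<^sup>2)"
    if \<theta>: "character 1 1 (\<lambda>P. f P * \<theta> P)" "C_homogeneous 2 \<theta>" "C_regular \<theta>" for \<theta>
  proof -
    have "C_homogeneous (2 * 2) (\<lambda>P. f P * \<theta> P)"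
      using f(1) \<theta>(2) by (auto simp: C_homogeneous_def power2_eq_square power4_eq_xxxx)
    moreover have "C_regular (\<lambda>P. f P * \<theta> P)"
      using f(2) \<theta>(3) by (auto simp: C_regular_def intro!: holomorphic_intros)
    ultimately obtain g where g: "homogeneous 2 g" "regular g"
      "\<And>P. P \<in> CC \<Longrightarrow> f P * \<theta> P = g ((P $ 1)\<^sup>2) ((P $ 2)\<^sup>2) ((P $ 3)\<^sup>2)"
      using descent[OF _ \<theta>(1)] by blast
    obtain s where "\<And>x y w. cone_D x y w \<Longrightarrow> g x y w = quad s x y w"
      by (rule regular_quadratic[OF g(1,2)]) blast
    then show ?thesis by (intro exI[of _ s]) (simp add: g(3) cone_D_squares)
  qed
  obtain s1 where s1: "\<And>P. P \<in> CC \<Longrightarrow> f P * \<phi> P = quad s1 ((P $ 1)\<^sup>2) ((P $ 2)\<^sup>2) ((P $ 3)\<^sup>2)"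
    using conic[OF inv(1) hom(1) reg(1)] by auto
  obtain s2 where s2: "\<And>P. P \<in> CC \<Longrightarrow> f P * \<psi> P = quad s2 ((P $ 1)\<^sup>2) ((P $ 2)\<^sup>2) ((P $ 3)\<^sup>2)"
    using conic[OF inv(2) hom(2) reg(2)] by auto
  \<comment> \<open>On C both sides are equal to \<open>f * \<phi>\<^sup>2 * \<psi>\<close>.\<close>
  have "quad m x y w * quad s2 x y w = quad qc x y w * quad s1 x y w" if D: "cone_D x y w" for x y w
  proof -
    obtain P where P: "P \<in> CC" "squares P = plane_point x y w" by (rule point_over[OF D])
    have xyw: "x = (P $ 1)\<^sup>2" "y = (P $ 2)\<^sup>2" "w = (P $ 3)\<^sup>2"
      using P(2) by (simp_all add: vec_eq_iff forall_4 squares_def plane_point_nth)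
    show ?thesis
      unfolding xyw \<phi>[OF P(1), symmetric] s1[OF P(1), symmetric] s2[OF P(1), symmetric]
        q_squares[OF P(1)] \<phi>\<psi>[OF P(1), symmetric]
      by (simp add: power2_eq_square mult_ac)
  qed
  then obtain \<mu> where \<mu>: "\<And>x y w. quad m x y w * quad s2 x y w - quad qc x y w * quad s1 x y w = \<mu> * quartic x y w"
    by (rule quartic_vanishing) (assumption, rule that, assumption)
  \<comment> \<open>The equation of D is \<open>q\<^sup>2 - m m'\<close>, so its multiple can be
    split between the two sides: \<open>q (s1 + \<mu> q) = m (s2 + \<mu> m')\<close> holds on the
    whole plane, where divisibility applies.\<close>
  have "quad qc x y w * quad (\<lambda>i. s1 i - (- \<mu>) * qc i) x y w =
      quad m x y w * quad (\<lambda>i. s2 i - (- \<mu>) * m' i) x y w" for x y w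
    unfolding quad_diff using \<mu>[of x y w] m(2)[of x y w] unfolding quartic_def by algebra
  then obtain \<nu> where \<nu>: "\<And>x y w. quad (\<lambda>i. s1 i - (- \<mu>) * qc i) x y w = \<nu> * quad m x y w"
      "\<And>x y w. quad (\<lambda>i. s2 i - (- \<mu>) * m' i) x y w = \<nu> * quad qc x y w"
    by (rule pair_monomial_dvd[OF m(1)]) blast
  show ?thesis
  proof (rule that)
    fix P assume P: "P \<in> CC"
    let ?x = "(P $ 1)\<^sup>2" and ?y = "(P $ 2)\<^sup>2" and ?w = "(P $ 3)\<^sup>2"
    \<comment> \<open>The two conics give the claim multiplied by \<open>\<phi>\<close> and by
      \<open>\<psi>\<close>, which have no common zero on C.\<close>
    have "\<phi> P * (f P - (\<nu> * \<phi> P + - \<mu> * \<psi> P)) = 0"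
      using \<nu>(1)[of ?x ?y ?w]
      unfolding quad_diff s1[OF P, symmetric] \<phi>[OF P, symmetric] q_squares[OF P] \<phi>\<psi>[OF P, symmetric]
      by (simp add: power2_eq_square algebra_simps)
    moreover have "\<psi> P * (f P - (\<nu> * \<phi> P + - \<mu> * \<psi> P)) = 0"
      using \<nu>(2)[of ?x ?y ?w]
      unfolding quad_diff s2[OF P, symmetric] \<psi>[OF P, symmetric] q_squares[OF P] \<phi>\<psi>[OF P, symmetric]
      by (simp add: power2_eq_square algebra_simps)
    ultimately show "f P = \<nu> * \<phi> P + - \<mu> * \<psi> P" using nz[OF P] by auto
  qed
qed

end

section \<open>The residue form\<close>

lemma det_4:
  "det (A :: 'a::comm_ring_1 ^ 4 ^ 4) =
    A$1$1 * (A$2$2 * (A$3$3 * A$4$4 - A$3$4 * A$4$3) - A$2$3 * (A$3$2 * A$4$4 - A$3$4 * A$4$2) + A$2$4 * (A$3$2 * A$4$3 - A$3$3 * A$4$2)) -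
    A$1$2 * (A$2$1 * (A$3$3 * A$4$4 - A$3$4 * A$4$3) - A$2$3 * (A$3$1 * A$4$4 - A$3$4 * A$4$1) + A$2$4 * (A$3$1 * A$4$3 - A$3$3 * A$4$1)) +
    A$1$3 * (A$2$1 * (A$3$2 * A$4$4 - A$3$4 * A$4$2) - A$2$2 * (A$3$1 * A$4$4 - A$3$4 * A$4$1) + A$2$4 * (A$3$1 * A$4$2 - A$3$2 * A$4$1)) -
    A$1$4 * (A$2$1 * (A$3$2 * A$4$3 - A$3$3 * A$4$2) - A$2$2 * (A$3$1 * A$4$3 - A$3$3 * A$4$1) + A$2$3 * (A$3$1 * A$4$2 - A$3$2 * A$4$1))"
proof -
  have f1234: "finite {2::4, 3, 4}" "1 \<notin> {2::4, 3, 4}" by auto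
  have f234: "finite {3::4, 4}" "2 \<notin> {3::4, 4}" by auto
  have f34: "finite {4::4}" "3 \<notin> {4::4}" by auto
  show ?thesis
    unfolding det_def UNIV_4
    unfolding sum_over_permutations_insert[OF f1234]
    unfolding sum_over_permutations_insert[OF f234]
    unfolding sum_over_permutations_insert[OF f34]
    unfolding permutes_sing
    by (simp add: sign_swap_id permutation_swap_id permutation_compose sign_compose sign_id swap_id_eq algebra_simps)
qed

definition vol :: "complex ^ 4 \<Rightarrow> complex ^ 4 \<Rightarrow> complex ^ 4 \<Rightarrow> complex ^ 4 \<Rightarrow> complex" where
  "vol P v n m = det (vector [P, v, n, m] :: complex ^ 4 ^ 4)"

lemma vol_eq:
  "vol P v n m =
    P$1 * (v$2 * (n$3 * m$4 - n$4 * m$3) - v$3 * (n$2 * m$4 - n$4 * m$2) + v$4 * (n$2 * m$3 - n$3 * m$2)) -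
    P$2 * (v$1 * (n$3 * m$4 - n$4 * m$3) - v$3 * (n$1 * m$4 - n$4 * m$1) + v$4 * (n$1 * m$3 - n$3 * m$1)) +
    P$3 * (v$1 * (n$2 * m$4 - n$4 * m$2) - v$2 * (n$1 * m$4 - n$4 * m$1) + v$4 * (n$1 * m$2 - n$2 * m$1)) -
    P$4 * (v$1 * (n$2 * m$3 - n$3 * m$2) - v$2 * (n$1 * m$3 - n$3 * m$1) + v$3 * (n$1 * m$2 - n$2 * m$1))"
  by (simp only: vol_def det_4 vector_4)

lemma vol_linear2: "vol P (a *s u + b *s v) n m = a * vol P u n m + b * vol P v n m"
  by (simp add: vol_eq algebra_simps)

lemma vol_linear3: "vol P v (a *s n + b *s n') m = a * vol P v n m + b * vol P v n' m"
  by (simp add: vol_eq algebra_simps)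

lemma vol_linear4: "vol P v n (a *s m + b *s m') = a * vol P v n m + b * vol P v n m'"
  by (simp add: vol_eq algebra_simps)

lemma vol_swap: "vol P v m n = - vol P v n m"
  by (simp add: vol_eq algebra_simps)

lemma vol_same: "vol P v n n = 0" "vol P P n m = 0"
  by (simp_all add: vol_eq algebra_simps)

lemma vol_scale: "vol (c *s P) (d *s v) n m = c * d * vol P v n m"
  by (simp add: vol_eq algebra_simps)

text \<open>The values of \<open>vol P v\<close> on pairs of coordinate vectors are, up to sign, the
  2 by 2 minors of \<open>P\<close> and \<open>v\<close>.\<close>

lemma vol_nondegenerate:
  assumes "P \<noteq> 0" "\<And>n m. vol P v n m = 0"
  obtains c where "v = c *s P"
proof -
  have minors: "P $ i * v $ j = P $ j * v $ i" for i j
    using assms(2)[of "axis 1 1" "axis 2 1"] assms(2)[of "axis 1 1" "axis 3 1"] assms(2)[of "axis 1 1" "axis 4 1"]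
      assms(2)[of "axis 2 1" "axis 3 1"] assms(2)[of "axis 2 1" "axis 4 1"] assms(2)[of "axis 3 1" "axis 4 1"]
      exhaust_4[of i] exhaust_4[of j]
    by (auto simp: vol_eq axis_def algebra_simps)
  obtain i where i: "P $ i \<noteq> 0" using assms(1) by (auto simp: vec_eq_iff)
  have "v = (v $ i / P $ i) *s P" using minors[of i] i by (simp add: vec_eq_iff field_simps)
  then show ?thesis by (rule that)
qed

lemma det_nonzero_kernel:
  fixes A :: "complex ^ 4 ^ 4"
  assumes "A *v c = 0" "c \<noteq> 0" shows "det A = 0"
proof (rule ccontr)
  assume "det A \<noteq> 0"
  then obtain B where "B ** A = mat 1" using invertible_det_nz invertible_def by blast
  then have "c = B *v (A *v c)" by (simp add: matrix_vector_mul_assoc)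
  with assms show False by simp
qed

lemma linear_expand:
  fixes L :: "complex ^ 4 \<Rightarrow> complex"
  assumes "\<And>c d u v. L (c *s u + d *s v) = c * L u + d * L v"
  shows "L v = v $ 1 * L (axis 1 1) + v $ 2 * L (axis 2 1) + v $ 3 * L (axis 3 1) + v $ 4 * L (axis 4 1)"
proof -
  have "v = 1 *s (v $ 1 *s axis 1 1 + v $ 2 *s axis 2 1) + 1 *s (v $ 3 *s axis 3 1 + v $ 4 *s axis 4 1)"
    by (simp add: vec_eq_iff forall_4 axis_def)
  then have "L v = L (1 *s (v $ 1 *s axis 1 1 + v $ 2 *s axis 2 1) + 1 *s (v $ 3 *s axis 3 1 + v $ 4 *s axis 4 1))"
    by simp
  then show ?thesis unfolding assms by (simp add: algebra_simps)
qed

context bitangent_cover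
begin

definition dF :: "complex ^ 4 \<Rightarrow> complex ^ 4 \<Rightarrow> complex" where
  "dF P v = 2 * P $ 1 * v $ 1 + 2 * P $ 2 * v $ 2 + 2 * P $ 3 * v $ 3 + 2 * P $ 4 * v $ 4"

definition dG :: "complex ^ 4 \<Rightarrow> complex ^ 4 \<Rightarrow> complex" where
  "dG P v = polar M (squares P) (sq P v) - cofactor_sum P v"

lemma has_derivative_F: "(C_quadric has_derivative dF P) (at P)"
  unfolding C_quadric_def dF_def
  by (rule derivative_eq_intros bounded_linear.has_derivative[OF bounded_linear_vec_nth] refl)+
    (simp add: fun_eq_iff algebra_simps)

lemma has_derivative_G: "(C_quartic q has_derivative dG P) (at P)"
  unfolding C_quartic_def dG_def
  by (intro has_derivative_diff has_derivative_product
      has_derivative_compose[OF has_derivative_squares has_derivative_q])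

lemma differential_F: "differential C_quadric P v = dF P v"
  by (simp add: frechet_derivative_at[OF has_derivative_F, symmetric])

lemma differential_G: "differential (C_quartic q) P v = dG P v"
  by (simp add: frechet_derivative_at[OF has_derivative_G, symmetric])

definition T :: "complex ^ 4 \<Rightarrow> (complex ^ 4) set" where
  "T P = {v. dF P v = 0 \<and> dG P v = 0}"

lemma tangent_eq: "tangent C_quadric (C_quartic q) P = T P"
  by (simp add: tangent_def T_def differential_F differential_G)

lemma dF_linear: "dF P (c *s u + d *s v) = c * dF P u + d * dF P v"
  by (simp add: dF_def algebra_simps)

lemma sq_linear: "sq P (c *s u + d *s v) = c *s sq P u + d *s sq P v"
  by (simp add: sq_def vec_eq_iff algebra_simps)

lemma cofactor_sum_linear: "cofactor_sum P (c *s u + d *s v) = c * cofactor_sum P u + d * cofactor_sum P v"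
  by (simp add: cofactor_sum_def algebra_simps)

lemma dG_linear: "dG P (c *s u + d *s v) = c * dG P u + d * dG P v"
  by (simp add: dG_def sq_linear polar_linear cofactor_sum_linear algebra_simps)

lemma T_linear: "u \<in> T P \<Longrightarrow> v \<in> T P \<Longrightarrow> c *s u + d *s v \<in> T P"
  by (simp add: T_def dF_linear dG_linear)

lemma T_scale: "u \<in> T P \<Longrightarrow> c *s u \<in> T P"
  using T_linear[of u P u c 0] by simp

lemma T_add: "u \<in> T P \<Longrightarrow> v \<in> T P \<Longrightarrow> u + v \<in> T P"
  using T_linear[of u P v 1 1] by simp

lemma zero_mem_T: "0 \<in> T P" by (simp add: T_def dF_def dG_def polar_def sq_def cofactor_sum_def)

text \<open>Euler's relation for the two equations.\<close>

lemma self_mem_T: assumes "P \<in> CC" shows "P \<in> T P"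
proof -
  have "sq P P = 2 *s squares P + 0 *s 0" by (simp add: vec_eq_iff sq_def squares_def power2_eq_square)
  then have "polar M (squares P) (sq P P) = 2 * polar M (squares P) (squares P)"
    by (simp only: polar_linear mult_zero_left add_0_right)
  also have "polar M (squares P) (squares P) = 2 * q (squares P)"
    by (simp add: polar_def q_eq sum_distrib_left algebra_simps)
  finally have "dG P P = 0" using assms by (simp add: dG_def mem_CC cofactor_sum_def algebra_simps)
  moreover have "dF P P = 2 * D_linear (squares P)"
    by (simp add: dF_def D_linear_def squares_def power2_eq_square algebra_simps)
  then have "dF P P = 0" using assms by (simp add: mem_CC)
  ultimately show ?thesis by (simp add: T_def)
qed

text \<open>A relation between \<open>dF\<close> and \<open>dG\<close> at \<open>P\<close>,
  multiplied in coordinate \<open>i\<close> by the product \<open>m i\<close> of the other three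
  coordinates, becomes a relation between the differentials of the equations of D at
  \<open>squares P\<close>.\<close>

lemma smooth_C:
  assumes P: "P \<in> CC" and dep: "\<And>v. a * dF P v + b * dG P v = 0"
  shows "a = 0 \<and> b = 0"
proof -
  define z where "z = squares P"
  define m where "m i = cofactor_sum P (axis i 1)" for i :: 4
  define \<pi> where "\<pi> i = polar M z (axis i 1)" for i :: 4
  have qz: "q z = P $ 1 * P $ 2 * P $ 3 * P $ 4" using P by (simp add: mem_CC z_def)
  have zn: "z $ i = (P $ i)\<^sup>2" for i by (simp add: z_def squares_def)
  have eq: "a * (2 * P $ i) + b * (2 * P $ i * \<pi> i - m i) = 0" for i
  proof -
    have "sq P (axis i 1) = (2 * P $ i) *s axis i 1 + 0 *s 0" by (simp add: vec_eq_iff sq_def axis_def)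
    then have "dG P (axis i 1) = 2 * P $ i * \<pi> i - m i"
      by (simp only: dG_def polar_linear \<pi>_def m_def z_def) simp
    moreover have "dF P (axis i 1) = 2 * P $ i"
      using exhaust_4[of i] by (auto simp: dF_def axis_def)
    ultimately show ?thesis using dep[of "axis i 1"] by simp
  qed
  have m: "P $ i * m i = q z" "cofactor_sum z (axis i 1) = (m i)\<^sup>2" for i
    using exhaust_4[of i] by (auto simp: m_def cofactor_sum_def axis_def qz zn power_mult_distrib)
  have zC: "z \<in> cone D_linear (D_quartic q)"
  proof -
    have "z \<noteq> 0" using P by (auto simp: mem_CC z_def squares_def vec_eq_iff)
    moreover have "D_linear z = 0" using P by (simp add: mem_CC z_def)
    moreover have "D_quartic q z = 0" by (simp add: D_quartic_def qz zn power_mult_distrib)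
    ultimately show ?thesis by (simp add: cone_def)
  qed
  \<comment> \<open>The coefficient \<open>2 * a * q z\<close> arises from
    \<open>P $ i * m i = q z\<close>; the cofactors of \<open>z\<close> are the squares of those of
    \<open>P\<close>.\<close>
  have "(2 * a * q z) * differential D_linear z v + b * differential (D_quartic q) z v = 0" for v
  proof -
    have zero: "2 * a * q z + b * (2 * q z * \<pi> i - (m i)\<^sup>2) = 0" for i
    proof -
      have "m i * (a * (2 * P $ i) + b * (2 * P $ i * \<pi> i - m i)) = 0" using eq by simp
      then show ?thesis unfolding m(1)[of i, symmetric] by (simp add: power2_eq_square algebra_simps)
    qed
    define L where "L v = (2 * a * q z) * differential D_linear z v + b * differential (D_quartic q) z v" for v
    have "L (axis i 1) = 0" for i
    proof -
      have "differential D_linear z (axis i 1) = 1"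
        using exhaust_4[of i] by (auto simp: differential_D_linear axis_def)
      then show ?thesis using zero[of i] by (simp add: L_def differential_D_quartic m \<pi>_def)
    qed
    moreover have "L (c *s u + d *s v) = c * L u + d * L v" for c d u v
      by (simp add: L_def differential_D_linear differential_D_quartic polar_linear cofactor_sum_linear algebra_simps)
    ultimately show ?thesis using linear_expand[of L v] by (simp add: L_def)
  qed
  then have "b = 0" using smooth_D zC unfolding smooth_complete_intersection_def by blast
  moreover obtain i where "P $ i \<noteq> 0" using P by (auto simp: mem_CC vec_eq_iff)
  ultimately show ?thesis using eq[of i] by simp
qed

text \<open>The value of the 2-form \<open>dF \<and> dG\<close> on \<open>n\<close>,
  \<open>m\<close>.\<close>

definition jacobian :: "complex ^ 4 \<Rightarrow> complex ^ 4 \<Rightarrow> complex ^ 4 \<Rightarrow> complex" where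
  "jacobian P n m = dF P n * dG P m - dF P m * dG P n"

lemma jacobian_nonzero:
  assumes P: "P \<in> CC" obtains i j where "jacobian P (axis i 1) (axis j 1) \<noteq> 0"
proof -
  have "\<exists>i j. jacobian P (axis i 1) (axis j 1) \<noteq> 0"
  proof (rule ccontr)
    assume *: "\<not> ?thesis"
    have "\<exists>i. dF P (axis i 1) \<noteq> 0"
    proof (rule ccontr)
      assume "\<not> ?thesis"
      then have "dF P v = 0" for v using linear_expand[of "dF P" v] dF_linear by simp
      then show False using smooth_C[OF P, of 1 0] by simp
    qed
    then obtain i where i: "dF P (axis i 1) \<noteq> 0" by blast
    let ?L = "\<lambda>v. (- dG P (axis i 1)) * dF P v + dF P (axis i 1) * dG P v"
    have "?L (axis j 1) = 0" for j using * by (simp add: jacobian_def algebra_simps)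
    moreover have "?L (c *s u + d *s v) = c * ?L u + d * ?L v" for c d u v
      by (simp add: dF_linear dG_linear algebra_simps)
    ultimately have "?L v = 0" for v using linear_expand[of ?L v] by simp
    then show False using smooth_C[OF P] i by blast
  qed
  then show ?thesis using that by blast
qed

text \<open>\<open>T P\<close> is the kernel of two independent linear forms, hence a plane, so
  \<open>P\<close>, \<open>v\<close>, \<open>t\<close> are linearly dependent.\<close>

lemma vol_tangent:
  assumes P: "P \<in> CC" and v: "v \<in> T P" and t: "t \<in> T P" shows "vol P v t x = 0"
proof -
  \<comment> \<open>The coefficient vector of a non-zero combination of \<open>dF\<close> and
    \<open>dG\<close> that vanishes at \<open>x\<close> as well; it is orthogonal to all four rows
    of the determinant.\<close>
  define c where "c = (if x \<in> T P then \<chi> i. dF P (axis i 1)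
    else \<chi> i. dG P x * dF P (axis i 1) - dF P x * dG P (axis i 1))"
  define a b where "a = (if x \<in> T P then 1 else dG P x)" and "b = (if x \<in> T P then 0 else - dF P x)"
  have c: "c $ i = a * dF P (axis i 1) + b * dG P (axis i 1)" for i
    by (simp add: c_def a_def b_def)
  have dot: "(\<Sum>i\<in>UNIV. u $ i * c $ i) = a * dF P u + b * dG P u" for u
    using linear_expand[of "dF P" u, OF dF_linear] linear_expand[of "dG P" u, OF dG_linear]
    by (simp add: c sum_4 algebra_simps)
  have ab: "a \<noteq> 0 \<or> b \<noteq> 0" by (auto simp: a_def b_def T_def)
  have "c \<noteq> 0"
  proof
    assume "c = 0"
    then have "a * dF P u + b * dG P u = 0" for u using dot[of u] by simp
    then show False using smooth_C[OF P] ab by blast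
  qed
  moreover have "(vector [P, v, t, x] :: complex ^ 4 ^ 4) *v c = 0"
    unfolding vec_eq_iff matrix_vector_mult_def
    using self_mem_T[OF P] v t
    by (simp add: forall_4 vector_4 dot) (auto simp: T_def a_def b_def)
  ultimately show ?thesis unfolding vol_def by (intro det_nonzero_kernel[of _ c])
qed

abbreviation \<kappa> :: "complex ^ 4 \<Rightarrow> complex ^ 4 \<Rightarrow> complex" where
  "\<kappa> \<equiv> residue_form C_quadric (C_quartic q)"

text \<open>\<open>jacobian P\<close> and \<open>vol P v\<close> are both alternating and depend
  only on classes modulo \<open>T P\<close>. The quotient by \<open>T P\<close> has dimension 2, so
  they are proportional.\<close>

lemma jacobian_vol:
  assumes P: "P \<in> CC" and v: "v \<in> T P" and nz: "jacobian P n0 m0 \<noteq> 0"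
  shows "jacobian P n m * vol P v n0 m0 = jacobian P n0 m0 * vol P v n m"
proof -
  let ?\<delta> = "jacobian P n0 m0"
  \<comment> \<open>Cramer's rule: \<open>A n\<close> and \<open>B n\<close> are chosen such that
    \<open>t n\<close> is tangent.\<close>
  define A where "A n = dF P n * dG P m0 - dG P n * dF P m0" for n
  define B where "B n = dF P n0 * dG P n - dG P n0 * dF P n" for n
  define t where "t n = ?\<delta> *s n + (-1) *s (A n *s n0 + B n *s m0)" for n
  have t: "t n \<in> T P" for n
    unfolding T_def t_def mem_Collect_eq dF_linear dG_linear A_def B_def jacobian_def
    by (intro conjI; algebra)
  have dec: "?\<delta> *s n + 0 *s 0 = 1 *s t n + 1 *s (A n *s n0 + B n *s m0)" for n
    by (simp add: t_def)
  have "?\<delta> * (?\<delta> * vol P v n m) = vol P v (?\<delta> *s n + 0 *s 0) (?\<delta> *s m + 0 *s 0)"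
    by (simp only: vol_linear3 vol_linear4) simp
  also have "\<dots> = (A n * B m - B n * A m) * vol P v n0 m0"
    unfolding dec vol_linear3 vol_linear4 vol_tangent[OF P v t]
    using vol_tangent[OF P v t, of m] vol_swap[of P v "t m"] vol_swap[of P v n0 m0]
    by (simp add: vol_same algebra_simps)
  also have "A n * B m - B n * A m = ?\<delta> * jacobian P n m"
    unfolding A_def B_def jacobian_def by algebra
  finally show ?thesis using nz by simp
qed

text \<open>The description in \<open>residue_form\<close> is met because \<open>vol\<close> is
  proportional to \<open>jacobian\<close>, and by one number only because some
  \<open>jacobian\<close> is non-zero.\<close>

lemma residue_form_eq:
  assumes P: "P \<in> CC" and v: "v \<in> T P"
  shows "jacobian P n m * \<kappa> P v = vol P v n m"
proof -
  obtain i j where nz: "jacobian P (axis i 1) (axis j 1) \<noteq> 0" by (rule jacobian_nonzero[OF P])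
  let ?k = "vol P v (axis i 1) (axis j 1) / jacobian P (axis i 1) (axis j 1)"
  have "\<forall>n m. jacobian P n m * ?k = vol P v n m"
    using jacobian_vol[OF P v nz] nz by (simp add: field_simps)
  moreover have "\<kappa> P v = ?k"
    unfolding residue_form_def differential_F differential_G jacobian_def[symmetric] vol_def[symmetric]
  proof (rule the_equality)
    show "\<forall>n m. jacobian P n m * ?k = vol P v n m" by fact
    fix k assume "\<forall>n m. jacobian P n m * k = vol P v n m"
    then show "k = ?k" using nz by (metis nonzero_mult_div_cancel_left)
  qed
  ultimately show ?thesis by simp
qed

lemma residue_form_eqI:
  assumes "P \<in> CC" "v \<in> T P" "\<And>n m. jacobian P n m * k = vol P v n m"
  shows "\<kappa> P v = k"
proof -
  obtain i j where "jacobian P (axis i 1) (axis j 1) \<noteq> 0" by (rule jacobian_nonzero[OF assms(1)])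
  then show ?thesis
    using residue_form_eq[OF assms(1,2), of "axis i 1" "axis j 1"] assms(3)[of "axis i 1" "axis j 1"]
    by (metis mult_cancel_left)
qed

lemma residue_form_linear:
  assumes "P \<in> CC" "u \<in> T P" "v \<in> T P"
  shows "\<kappa> P (c *s u + d *s v) = c * \<kappa> P u + d * \<kappa> P v"
  by (rule residue_form_eqI[OF assms(1) T_linear[OF assms(2,3)]])
    (simp add: vol_linear2 distrib_left mult.left_commute residue_form_eq assms)

lemma residue_form_add: "P \<in> CC \<Longrightarrow> u \<in> T P \<Longrightarrow> v \<in> T P \<Longrightarrow> \<kappa> P (u + v) = \<kappa> P u + \<kappa> P v"
  using residue_form_linear[of P u v 1 1] by simp

lemma residue_form_scale: "P \<in> CC \<Longrightarrow> u \<in> T P \<Longrightarrow> \<kappa> P (c *s u) = c * \<kappa> P u"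
  using residue_form_linear[of P u u c 0] by simp

lemma residue_form_zero: "P \<in> CC \<Longrightarrow> \<kappa> P 0 = 0"
  using residue_form_scale[of P 0 0] zero_mem_T by simp

lemma residue_form_self: "P \<in> CC \<Longrightarrow> \<kappa> P P = 0"
  by (rule residue_form_eqI) (auto simp: self_mem_T vol_same)

lemma residue_form_kernel:
  assumes "P \<in> CC" "v \<in> T P" "\<kappa> P v = 0" obtains c where "v = c *s P"
  by (rule vol_nondegenerate[of P v])
    (use assms residue_form_eq[OF assms(1,2)] in \<open>auto simp: mem_CC\<close>)

lemma T_scale_point:
  assumes "c \<noteq> 0" shows "c *s v \<in> T (c *s P) \<longleftrightarrow> v \<in> T P"
    and "jacobian (c *s P) n m = c ^ 4 * jacobian P n m"
proof -
  have F: "dF (c *s P) n = c * dF P n" for n by (simp add: dF_def algebra_simps)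
  have "sq (c *s P) n = c *s sq P n + 0 *s 0" for n by (simp add: sq_def vec_eq_iff)
  moreover have "polar M (c\<^sup>2 *s z) n = c\<^sup>2 * polar M z n" for z n
    by (simp add: polar_def sum_distrib_left algebra_simps)
  ultimately have G: "dG (c *s P) n = c ^ 3 * dG P n" for n
    unfolding dG_def squares_scale by (simp only: polar_linear) (simp add: cofactor_sum_def power2_eq_square power3_eq_cube algebra_simps)
  have s: "dF P (c *s v) = c * dF P v" "dG P (c *s v) = c * dG P v"
    using dF_linear[of P c v 0 0] dG_linear[of P c v 0 0] by simp_all
  show "c *s v \<in> T (c *s P) \<longleftrightarrow> v \<in> T P" using assms by (simp add: T_def F G s)
  show "jacobian (c *s P) n m = c ^ 4 * jacobian P n m"
    unfolding jacobian_def F G by algebra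
qed

text \<open>\<open>vol\<close> is multiplied by \<open>c^2\<close> and \<open>jacobian\<close> by
  \<open>c^(1 + 3)\<close>. The resulting weight -2 is the one that a quadratic form
  compensates.\<close>

lemma residue_form_scale_point:
  assumes "P \<in> CC" "v \<in> T P" "c \<noteq> 0"
  shows "\<kappa> (c *s P) (c *s v) = \<kappa> P v / c\<^sup>2"
proof (rule residue_form_eqI)
  show "c *s P \<in> CC" using assms scale_mem_CC by blast
  show "c *s v \<in> T (c *s P)" using assms T_scale_point by blast
  show "jacobian (c *s P) n m * (\<kappa> P v / c\<^sup>2) = vol (c *s P) (c *s v) n m" for n m
    unfolding vol_scale T_scale_point(2)[OF assms(3)] residue_form_eq[OF assms(1,2), symmetric]
    using assms(3) by (simp add: power2_eq_square power4_eq_xxxx)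
qed

text \<open>The sign changes preserve both equations and have determinant 1; hence they preserve the
  residue form.\<close>

lemma act_invariance:
  assumes g: "g = act_a \<or> g = act_b"
  shows "g v \<in> T (g P) \<longleftrightarrow> v \<in> T P" "jacobian (g P) (g n) (g m) = jacobian P n m"
    "vol (g P) (g v) (g n) (g m) = vol P v n m" "g (g v) = v"
proof -
  have F: "dF (g P) (g n) = dF P n" for n using g by (auto simp: dF_def act_nth)
  have "sq (g P) (g n) = sq P n" "cofactor_sum (g P) (g n) = cofactor_sum P n" for n
    using g by (auto simp: sq_def vec_eq_iff forall_4 act_nth cofactor_sum_def)
  then have G: "dG (g P) (g n) = dG P n" for n using g by (auto simp: dG_def squares_act)
  show "g v \<in> T (g P) \<longleftrightarrow> v \<in> T P" "jacobian (g P) (g n) (g m) = jacobian P n m"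
    by (simp_all add: T_def jacobian_def F G)
  show "vol (g P) (g v) (g n) (g m) = vol P v n m" using g by (auto simp: vol_eq act_nth algebra_simps)
  show "g (g v) = v" using g by (auto simp: vec_eq_iff forall_4 act_nth)
qed

lemma residue_form_act:
  assumes "P \<in> CC" "v \<in> T P" and g: "g = act_a \<or> g = act_b"
  shows "\<kappa> (g P) (g v) = \<kappa> P v"
proof (rule residue_form_eqI)
  show "g P \<in> CC" using assms act_mem_CC by auto
  show "g v \<in> T (g P)" using assms act_invariance(1)[OF g] by blast
  show "jacobian (g P) n m * \<kappa> P v = vol (g P) (g v) n m" for n m
    using residue_form_eq[OF assms(1,2), of "g n" "g m"]
      act_invariance(2)[OF g, of P "g n" "g m"] act_invariance(3)[OF g, of P v "g n" "g m"]
    by (simp add: act_invariance(4)[OF g])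
qed

lemma arc_velocity:
  assumes arc: "cone_arc U \<gamma>" and s: "s \<in> U"
  shows "\<gamma> s \<in> CC" "velocity \<gamma> s \<in> T (\<gamma> s)"
proof -
  have U: "open U" and CC: "\<And>s. s \<in> U \<Longrightarrow> \<gamma> s \<in> CC" and hol: "\<And>i. (\<lambda>s. \<gamma> s $ i) holomorphic_on U"
    using arc by (auto simp: holomorphic_arc_def)
  show "\<gamma> s \<in> CC" using CC s .
  have der: "(\<gamma> has_derivative (\<lambda>h. h *s velocity \<gamma> s)) (at s)"
  proof (rule has_derivative_vecI)
    fix i
    show "((\<lambda>s. \<gamma> s $ i) has_derivative (\<lambda>h. (h *s velocity \<gamma> s) $ i)) (at s)"
      using holomorphic_derivI[OF hol U s, of i]
      by (simp add: has_field_derivative_def velocity_def mult.commute[of _ "deriv _ _"])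
  qed
  have "D (velocity \<gamma> s) = 0"
    if "(H has_derivative D) (at (\<gamma> s))" "\<And>s. s \<in> U \<Longrightarrow> H (\<gamma> s) = 0" for H D :: "complex ^ 4 \<Rightarrow> complex"
  proof -
    have "((\<lambda>s. H (\<gamma> s)) has_derivative (\<lambda>h. D (h *s velocity \<gamma> s))) (at s)"
      by (rule has_derivative_compose[OF der that(1)])
    moreover have "((\<lambda>s. H (\<gamma> s)) has_derivative (\<lambda>h. 0)) (at s)"
      by (rule has_derivative_transform_within_open[where f = "\<lambda>_. 0", OF _ U s])
        (use that(2) in auto)
    ultimately have "(\<lambda>h. D (h *s velocity \<gamma> s)) = (\<lambda>h. 0)" by (rule has_derivative_unique)
    from fun_cong[OF this, of 1] show ?thesis by simp
  qed
  from this[OF has_derivative_F] this[OF has_derivative_G] show "velocity \<gamma> s \<in> T (\<gamma> s)"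
    using CC by (auto simp: T_def cone_def)
qed

text \<open>Locally the residue is the quotient of \<open>vol\<close> by a \<open>jacobian\<close>,
  both taken on two fixed coordinate vectors for which the latter has no zero.\<close>

lemma residue_form_holomorphic:
  assumes arc: "cone_arc U \<gamma>"
  shows "(\<lambda>s. \<kappa> (\<gamma> s) (velocity \<gamma> s)) holomorphic_on U"
proof -
  have U: "open U" and hol: "\<And>i. (\<lambda>s. \<gamma> s $ i) holomorphic_on U"
    using arc by (auto simp: holomorphic_arc_def)
  have holv: "(\<lambda>s. velocity \<gamma> s $ i) holomorphic_on U" for i
    using holomorphic_deriv[OF hol U, of i] by (simp add: velocity_def)
  have holJ: "(\<lambda>s. jacobian (\<gamma> s) n m) holomorphic_on U" for n m
    unfolding jacobian_def dF_def dG_def polar_def sq_def cofactor_sum_def squares_def vec_lambda_beta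
    by (intro holomorphic_intros hol)
  have holV: "(\<lambda>s. vol (\<gamma> s) (velocity \<gamma> s) n m) holomorphic_on U" for n m
    unfolding vol_eq by (intro holomorphic_intros hol holv)
  have "\<exists>r>0. (\<lambda>s. \<kappa> (\<gamma> s) (velocity \<gamma> s)) holomorphic_on ball s0 r" if s0: "s0 \<in> U" for s0
  proof -
    obtain i j where nz: "jacobian (\<gamma> s0) (axis i 1) (axis j 1) \<noteq> 0"
      by (rule jacobian_nonzero[OF arc_velocity(1)[OF arc s0]])
    let ?J = "\<lambda>s. jacobian (\<gamma> s) (axis i 1) (axis j 1)"
    have "continuous_on U ?J" by (rule holomorphic_on_imp_continuous_on[OF holJ])
    then obtain r where r: "0 < r" "\<And>s. s \<in> U \<Longrightarrow> dist s0 s < r \<Longrightarrow> ?J s \<noteq> 0"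
      using continuous_on_avoid[of U ?J s0 0] s0 nz by blast
    obtain r' where r': "0 < r'" "ball s0 r' \<subseteq> U" using U s0 openE by blast
    define \<rho> where "\<rho> = min r r'"
    have sub: "ball s0 \<rho> \<subseteq> U" and J: "\<And>s. s \<in> ball s0 \<rho> \<Longrightarrow> ?J s \<noteq> 0"
      using r r' by (auto simp: \<rho>_def subset_iff)
    have "(\<lambda>s. vol (\<gamma> s) (velocity \<gamma> s) (axis i 1) (axis j 1) / ?J s) holomorphic_on ball s0 \<rho>"
      using J by (intro holomorphic_on_divide holomorphic_on_subset[OF holV sub] holomorphic_on_subset[OF holJ sub])
    then have "(\<lambda>s. \<kappa> (\<gamma> s) (velocity \<gamma> s)) holomorphic_on ball s0 \<rho>"
    proof (rule holomorphic_transform)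
      fix s assume s: "s \<in> ball s0 \<rho>"
      then have "s \<in> U" using sub by blast
      then show "vol (\<gamma> s) (velocity \<gamma> s) (axis i 1) (axis j 1) / ?J s = \<kappa> (\<gamma> s) (velocity \<gamma> s)"
        using residue_form_eq[OF arc_velocity[OF arc], of s "axis i 1" "axis j 1"] J[OF s] by (simp add: field_simps)
    qed
    then show ?thesis using r(1) r'(1) by (intro exI[of _ \<rho>]) (simp add: \<rho>_def)
  qed
  then have "(\<lambda>s. \<kappa> (\<gamma> s) (velocity \<gamma> s)) analytic_on U" by (auto simp: analytic_on_def)
  then show ?thesis by (rule analytic_imp_holomorphic)
qed

lemma arc_residue_nonzero:
  assumes "immersed_arc U \<gamma>" "s \<in> U" shows "\<kappa> (\<gamma> s) (velocity \<gamma> s) \<noteq> 0"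
proof
  assume 0: "\<kappa> (\<gamma> s) (velocity \<gamma> s) = 0"
  have arc: "cone_arc U \<gamma>" using assms by (simp add: immersed_arc_def)
  obtain c where "velocity \<gamma> s = c *s \<gamma> s" by (rule residue_form_kernel[OF arc_velocity[OF arc assms(2)] 0])
  then show False using assms by (auto simp: immersed_arc_def)
qed

text \<open>The velocity of an immersed arc through \<open>P\<close> is not radial, and the residue
  vanishes on radial vectors only.\<close>

lemma tangent_vector_exists:
  assumes "P \<in> CC" obtains v where "v \<in> T P" "\<kappa> P v \<noteq> 0"
proof -
  obtain U \<gamma> s where arc: "immersed_arc U \<gamma>" "s \<in> U" "\<gamma> s = P" by (rule immersed_arc_exists[OF assms])
  then have "velocity \<gamma> s \<in> T P" using arc_velocity(2)[of U \<gamma> s] by (simp add: immersed_arc_def)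
  then show ?thesis using that arc_residue_nonzero[OF arc(1,2)] arc(3) by blast
qed

section \<open>Coefficients of invariant 2-forms\<close>

abbreviation "CC2 \<equiv> cone2 C_quadric (C_quartic q)"
abbreviation "TT \<equiv> tangent2 C_quadric (C_quartic q)"
abbreviation "alternating \<equiv> alternating_form C_quadric (C_quartic q)"
abbreviation "holomorphic_2form \<equiv> holomorphic_form C_quadric (C_quartic q)"
abbreviation "adj \<equiv> adjunction_form C_quadric (C_quartic q)"

lemma H0_omega_productD:
  assumes "\<alpha> \<in> H0_omega_product C_quadric (C_quartic q)"
  shows "alternating \<alpha>" "descends \<alpha>" "holomorphic_2form \<alpha>"
  using assms by (auto simp: H0_omega_product_def)

lemma mem_cone2: "(P, Q) \<in> CC2 \<longleftrightarrow> P \<in> CC \<and> Q \<in> CC"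
  by (simp add: cone2_def)

lemma mem_tangent2: "(u, v) \<in> TT (P, Q) \<longleftrightarrow> u \<in> T P \<and> v \<in> T Q"
  by (simp add: tangent2_def tangent_eq)

lemma scale2_Pair: "scale2 c d (P, Q) = (c *s P, d *s Q)"
  by (simp add: scale2_def)

lemma form_add:
  assumes "alternating \<alpha>" "P \<in> CC" "Q \<in> CC"
    and "u \<in> T P" "u' \<in> T P" "v \<in> T P" "w \<in> T Q" "w' \<in> T Q" "z \<in> T Q"
  shows "\<alpha> (P, Q) (u + u', w + w') (v, z) = \<alpha> (P, Q) (u, w) (v, z) + \<alpha> (P, Q) (u', w') (v, z)"
    "\<alpha> (P, Q) (c *s u, c *s w) (v, z) = c * \<alpha> (P, Q) (u, w) (v, z)"
    "\<alpha> (P, Q) (v, z) (u, w) = - \<alpha> (P, Q) (u, w) (v, z)"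
proof -
  have *: "\<forall>p \<in> CC2. \<forall>u \<in> TT p.
     \<forall>u' \<in> TT p. \<forall>v \<in> TT p. \<forall>c.
        \<alpha> p (u + u') v = \<alpha> p u v + \<alpha> p u' v \<and> \<alpha> p (scale2 c c u) v = c * \<alpha> p u v \<and> \<alpha> p v u = - \<alpha> p u v"
    using assms(1) unfolding alternating_form_def by blast
  have "\<alpha> (P, Q) ((u, w) + (u', w')) (v, z) = \<alpha> (P, Q) (u, w) (v, z) + \<alpha> (P, Q) (u', w') (v, z) \<and>
      \<alpha> (P, Q) (scale2 c c (u, w)) (v, z) = c * \<alpha> (P, Q) (u, w) (v, z) \<and>
      \<alpha> (P, Q) (v, z) (u, w) = - \<alpha> (P, Q) (u, w) (v, z)"
    by (rule *[rule_format]) (simp_all add: mem_cone2 mem_tangent2 assms)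
  then show "\<alpha> (P, Q) (u + u', w + w') (v, z) = \<alpha> (P, Q) (u, w) (v, z) + \<alpha> (P, Q) (u', w') (v, z)"
    "\<alpha> (P, Q) (c *s u, c *s w) (v, z) = c * \<alpha> (P, Q) (u, w) (v, z)"
    "\<alpha> (P, Q) (v, z) (u, w) = - \<alpha> (P, Q) (u, w) (v, z)"
    by (simp_all add: scale2_Pair)
qed

text \<open>A vector of \<open>T P\<close> is determined modulo \<open>P\<close> by its residue, so forms that
  descend are multiples of \<open>pr\<^sub>1\<^sup>* \<kappa> \<and> pr\<^sub>2\<^sup>* \<kappa>\<close>.\<close>

lemma form_coefficient:
  assumes \<alpha>: "alternating \<alpha>" "descends \<alpha>"
  obtains h where "\<And>P Q u1 u2 v1 v2. P \<in> CC \<Longrightarrow> Q \<in> CC \<Longrightarrow> u1 \<in> T P \<Longrightarrow> v1 \<in> T P \<Longrightarrow> u2 \<in> T Q \<Longrightarrow> v2 \<in> T Q \<Longrightarrow>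
    \<alpha> (P, Q) (u1, u2) (v1, v2) = h P Q * (\<kappa> P u1 * \<kappa> Q v2 - \<kappa> P v1 * \<kappa> Q u2)"
proof -
  have "\<forall>P\<in>CC. \<exists>v. v \<in> T P \<and> \<kappa> P v \<noteq> 0" using tangent_vector_exists by blast
  then obtain e where e: "\<And>P. P \<in> CC \<Longrightarrow> e P \<in> T P" "\<And>P. P \<in> CC \<Longrightarrow> \<kappa> P (e P) \<noteq> 0"
    unfolding bchoice_iff by blast
  have dec: "\<exists>a. u = a *s P + (\<kappa> P u / \<kappa> P (e P)) *s e P" if Pu: "P \<in> CC" "u \<in> T P" for P u
  proof -
    let ?b = "\<kappa> P u / \<kappa> P (e P)"
    have "u + (- ?b) *s e P \<in> T P" using T_linear[OF Pu(2) e(1)[OF Pu(1)], of 1 "- ?b"] by simp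
    moreover have "\<kappa> P (u + (- ?b) *s e P) = 0"
      using residue_form_linear[OF Pu e(1)[OF Pu(1)], of 1 "- ?b"] e(2)[OF Pu(1)] by simp
    ultimately obtain a where "u + (- ?b) *s e P = a *s P" by (rule residue_form_kernel[OF Pu(1)])
    then have "u = a *s P + ?b *s e P" by (simp add: vec_eq_iff) (metis add.commute diff_add_cancel)
    then show ?thesis by blast
  qed
  \<comment> \<open>\<open>P\<close> and \<open>e P\<close> span \<open>T P\<close>, and radial
    vectors are annihilated, so the form is determined by its value on \<open>(e P, 0)\<close> and
    \<open>(0, e Q)\<close>.\<close>
  define h where "h P Q = \<alpha> (P, Q) (e P, 0) (0, e Q) / (\<kappa> P (e P) * \<kappa> Q (e Q))" for P Q
  show ?thesis
  proof (rule that)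
    fix P Q u1 u2 v1 v2
    assume P: "P \<in> CC" and Q: "Q \<in> CC" and u: "u1 \<in> T P" "u2 \<in> T Q" and v: "v1 \<in> T P" "v2 \<in> T Q"
    note mem = P Q u v e(1)[OF P] e(1)[OF Q] zero_mem_T T_scale T_add self_mem_T
    note add = form_add(1)[OF \<alpha>(1) P Q] and scale = form_add(2)[OF \<alpha>(1) P Q] and anti = form_add(3)[OF \<alpha>(1) P Q]
    have fibre1: "\<alpha> (P, Q) (a *s P, 0) z = 0" and fibre2: "\<alpha> (P, Q) (0, a *s Q) z = 0" for a z
    proof -
      have "\<alpha> (P, Q) (scale2 a 0 (P, Q)) z = 0" "\<alpha> (P, Q) (scale2 0 a (P, Q)) z = 0"
        using \<alpha>(2) unfolding descends_def by blast+
      then show "\<alpha> (P, Q) (a *s P, 0) z = 0" "\<alpha> (P, Q) (0, a *s Q) z = 0" by (simp_all add: scale2_Pair)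
    qed
    have red1: "\<alpha> (P, Q) (x, 0) (y, z) = \<kappa> P x / \<kappa> P (e P) * \<alpha> (P, Q) (e P, 0) (y, z)"
      if "x \<in> T P" "y \<in> T P" "z \<in> T Q" for x y z
    proof -
      obtain a where a: "x = a *s P + (\<kappa> P x / \<kappa> P (e P)) *s e P" using dec[OF P \<open>x \<in> T P\<close>] by blast
      have "\<alpha> (P, Q) (x, 0) (y, z) = \<alpha> (P, Q) (a *s P + (\<kappa> P x / \<kappa> P (e P)) *s e P, 0 + 0) (y, z)"
        using a by simp
      also have "\<dots> = \<alpha> (P, Q) (a *s P, 0) (y, z) + \<alpha> (P, Q) ((\<kappa> P x / \<kappa> P (e P)) *s e P, 0) (y, z)"
        using mem that by (intro add) auto
      also have "\<alpha> (P, Q) ((\<kappa> P x / \<kappa> P (e P)) *s e P, 0) (y, z) =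
          \<alpha> (P, Q) ((\<kappa> P x / \<kappa> P (e P)) *s e P, (\<kappa> P x / \<kappa> P (e P)) *s 0) (y, z)" by simp
      also have "\<dots> = \<kappa> P x / \<kappa> P (e P) * \<alpha> (P, Q) (e P, 0) (y, z)"
        using mem that by (intro scale) auto
      finally show ?thesis by (simp add: fibre1)
    qed
    have red2: "\<alpha> (P, Q) (0, x) (y, z) = \<kappa> Q x / \<kappa> Q (e Q) * \<alpha> (P, Q) (0, e Q) (y, z)"
      if "x \<in> T Q" "y \<in> T P" "z \<in> T Q" for x y z
    proof -
      obtain a where a: "x = a *s Q + (\<kappa> Q x / \<kappa> Q (e Q)) *s e Q" using dec[OF Q \<open>x \<in> T Q\<close>] by blast
      have "\<alpha> (P, Q) (0, x) (y, z) = \<alpha> (P, Q) (0 + 0, a *s Q + (\<kappa> Q x / \<kappa> Q (e Q)) *s e Q) (y, z)"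
        using a by simp
      also have "\<dots> = \<alpha> (P, Q) (0, a *s Q) (y, z) + \<alpha> (P, Q) (0, (\<kappa> Q x / \<kappa> Q (e Q)) *s e Q) (y, z)"
        using mem that by (intro add) auto
      also have "\<alpha> (P, Q) (0, (\<kappa> Q x / \<kappa> Q (e Q)) *s e Q) (y, z) =
          \<alpha> (P, Q) ((\<kappa> Q x / \<kappa> Q (e Q)) *s 0, (\<kappa> Q x / \<kappa> Q (e Q)) *s e Q) (y, z)" by simp
      also have "\<dots> = \<kappa> Q x / \<kappa> Q (e Q) * \<alpha> (P, Q) (0, e Q) (y, z)"
        using mem that by (intro scale) auto
      finally show ?thesis by (simp add: fibre2)
    qed
    have split: "\<alpha> (P, Q) (x, y) z = \<alpha> (P, Q) (x, 0) z + \<alpha> (P, Q) (0, y) z"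
      if "x \<in> T P" "y \<in> T Q" "fst z \<in> T P" "snd z \<in> T Q" for x y z
      using add[of x 0 "fst z" 0 y "snd z"] that mem by simp
    have flip: "\<alpha> (P, Q) z (x, y) = - \<alpha> (P, Q) (x, y) z"
      if "x \<in> T P" "y \<in> T Q" "fst z \<in> T P" "snd z \<in> T Q" for x y z
      using anti[of x x "fst z" y y "snd z"] that by simp
    have self: "\<alpha> (P, Q) (e P, 0) (e P, 0) = 0" "\<alpha> (P, Q) (0, e Q) (0, e Q) = 0"
      using flip[of "e P" 0 "(e P, 0)"] flip[of 0 "e Q" "(0, e Q)"] mem by auto
    let ?k = "\<kappa> P (e P)" and ?l = "\<kappa> Q (e Q)"
    have "\<alpha> (P, Q) (u1, u2) (v1, v2) = \<kappa> P u1 / ?k * \<alpha> (P, Q) (e P, 0) (v1, v2) + \<kappa> Q u2 / ?l * \<alpha> (P, Q) (0, e Q) (v1, v2)"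
      using split[of u1 u2 "(v1, v2)"] red1[of u1 v1 v2] red2[of u2 v1 v2] mem by simp
    also have "\<alpha> (P, Q) (e P, 0) (v1, v2) = - (\<kappa> Q v2 / ?l * \<alpha> (P, Q) (0, e Q) (e P, 0))"
      using flip[of v1 v2 "(e P, 0)"] split[of v1 v2 "(e P, 0)"] red1[of v1 "e P" 0] red2[of v2 "e P" 0] self mem by simp
    also have "\<alpha> (P, Q) (0, e Q) (v1, v2) = - (\<kappa> P v1 / ?k * \<alpha> (P, Q) (e P, 0) (0, e Q))"
      using flip[of v1 v2 "(0, e Q)"] split[of v1 v2 "(0, e Q)"] red1[of v1 0 "e Q"] red2[of v2 0 "e Q"] self mem by simp
    also have "\<alpha> (P, Q) (0, e Q) (e P, 0) = - \<alpha> (P, Q) (e P, 0) (0, e Q)"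
      using flip[of "e P" 0 "(0, e Q)"] mem by simp
    finally show "\<alpha> (P, Q) (u1, u2) (v1, v2) = h P Q * (\<kappa> P u1 * \<kappa> Q v2 - \<kappa> P v1 * \<kappa> Q u2)"
      using e(2)[OF P] e(2)[OF Q] by (simp add: h_def field_simps)
  qed
qed

text \<open>The second variable needs no separate condition: antisymmetry transfers the properties
  to it.\<close>

definition sections_in_first :: "(complex ^ 4 \<Rightarrow> complex ^ 4 \<Rightarrow> complex) \<Rightarrow> bool" where
  "sections_in_first h \<longleftrightarrow> (\<forall>Q\<in>CC. C_homogeneous 2 (\<lambda>P. h P Q) \<and> C_regular (\<lambda>P. h P Q))"

definition antisymmetric :: "(complex ^ 4 \<Rightarrow> complex ^ 4 \<Rightarrow> complex) \<Rightarrow> bool" where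
  "antisymmetric h \<longleftrightarrow> (\<forall>P\<in>CC. \<forall>Q\<in>CC. h Q P = - h P Q)"

definition diagonal_invariant :: "(complex ^ 4 \<Rightarrow> complex ^ 4 \<Rightarrow> complex) \<Rightarrow> bool" where
  "diagonal_invariant h \<longleftrightarrow>
     (\<forall>P\<in>CC. \<forall>Q\<in>CC. h (act_a P) (act_a Q) = h P Q \<and> h (act_b P) (act_b Q) = h P Q)"

lemma group_elements:
  "map_prod act_a act_a \<in> group_DeltaG_Z2" "map_prod act_b act_b \<in> group_DeltaG_Z2" "prod.swap \<in> group_DeltaG_Z2"
  unfolding group_DeltaG_Z2_def group_G_def
  by (intro CollectI exI[of _ id] exI[of _ act_a] exI[of _ act_b] exI[of _ prod.swap]; simp add: prod.map_id0)+

lemma H0_coefficient: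
  assumes \<alpha>: "\<alpha> \<in> H0_omega_S q"
  obtains h where "sections_in_first h" "antisymmetric h" "diagonal_invariant h"
    "\<alpha> = adj h"
proof -
  have prod: "\<alpha> \<in> H0_omega_product C_quadric (C_quartic q)"
    and inv: "\<And>\<sigma> p u v. \<sigma> \<in> group_DeltaG_Z2 \<Longrightarrow> \<alpha> (\<sigma> p) (\<sigma> u) (\<sigma> v) = \<alpha> p u v"
    using \<alpha> unfolding H0_omega_S_def pullback_form_def fun_eq_iff by blast+
  note alt = H0_omega_productD(1)[OF prod] and desc = H0_omega_productD(2)[OF prod]
    and hol = H0_omega_productD(3)[OF prod]
  obtain h where h: "\<And>P Q u1 u2 v1 v2. P \<in> CC \<Longrightarrow> Q \<in> CC \<Longrightarrow> u1 \<in> T P \<Longrightarrow> v1 \<in> T P \<Longrightarrow> u2 \<in> T Q \<Longrightarrow> v2 \<in> T Q \<Longrightarrow>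
    \<alpha> (P, Q) (u1, u2) (v1, v2) = h P Q * (\<kappa> P u1 * \<kappa> Q v2 - \<kappa> P v1 * \<kappa> Q u2)"
    using form_coefficient[OF alt desc] by blast
  have h0: "\<alpha> (P, Q) (v, 0) (0, w) = h P Q * (\<kappa> P v * \<kappa> Q w)" if "P \<in> CC" "Q \<in> CC" "v \<in> T P" "w \<in> T Q" for P Q v w
    using h[of P Q v 0 0 w] that by (simp add: zero_mem_T residue_form_zero)
  have h0': "\<alpha> (P, Q) (0, w) (v, 0) = - h P Q * (\<kappa> P v * \<kappa> Q w)" if "P \<in> CC" "Q \<in> CC" "v \<in> T P" "w \<in> T Q" for P Q v w
    using h[of P Q 0 v w 0] that by (simp add: zero_mem_T residue_form_zero)
  show ?thesis
  proof (rule that)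
    show "\<alpha> = adj h"
    proof (intro ext)
      fix p u v :: point2
      obtain P Q u1 u2 v1 v2 where eq: "p = (P, Q)" "u = (u1, u2)" "v = (v1, v2)" by (metis prod.exhaust)
      show "\<alpha> p u v = adj h p u v"
      proof (cases "p \<in> CC2 \<and> u \<in> TT p \<and>
          v \<in> TT p")
        case True
        then show ?thesis using h[of P Q u1 v1 u2 v2]
          unfolding eq adjunction_form_def by (simp add: mem_cone2 mem_tangent2)
      next
        case False
        then have "\<alpha> p u v = 0" using alt unfolding alternating_form_def by blast
        then show ?thesis using False unfolding adjunction_form_def by auto
      qed
    qed
    show "antisymmetric h"
      unfolding antisymmetric_def
    proof (intro ballI)
      fix P Q assume P: "P \<in> CC" and Q: "Q \<in> CC"
      obtain v where v: "v \<in> T P" "\<kappa> P v \<noteq> 0" by (rule tangent_vector_exists[OF P])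
      obtain w where w: "w \<in> T Q" "\<kappa> Q w \<noteq> 0" by (rule tangent_vector_exists[OF Q])
      \<comment> \<open>Exchanging the factors changes the sign of the wedge product of the two
        residue forms, so an invariant form has an antisymmetric coefficient.\<close>
      have "\<alpha> (Q, P) (0, v) (w, 0) = \<alpha> (P, Q) (v, 0) (0, w)"
        using inv[OF group_elements(3), of "(P, Q)" "(v, 0)" "(0, w)"] by simp
      then have "- h Q P * (\<kappa> P v * \<kappa> Q w) = h P Q * (\<kappa> P v * \<kappa> Q w)"
        using h0[OF P Q v(1) w(1)] h0'[OF Q P w(1) v(1)] by (simp add: mult.commute)
      then have "- h Q P = h P Q" using v(2) w(2) by (metis mult_eq_0_iff mult_right_cancel)
      then show "h Q P = - h P Q" by (metis minus_minus)
    qed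
    show "diagonal_invariant h"
    proof -
      have "h (g P) (g Q) = h P Q" if g: "g = act_a \<or> g = act_b" and P: "P \<in> CC" and Q: "Q \<in> CC" for g P Q
      proof -
        obtain v where v: "v \<in> T P" "\<kappa> P v \<noteq> 0" by (rule tangent_vector_exists[OF P])
        obtain w where w: "w \<in> T Q" "\<kappa> Q w \<noteq> 0" by (rule tangent_vector_exists[OF Q])
        have "map_prod g g \<in> group_DeltaG_Z2" using g group_elements by auto
        moreover have "g 0 = 0" using g by (auto simp: vec_eq_iff forall_4 act_nth)
        ultimately have "\<alpha> (g P, g Q) (g v, 0) (0, g w) = \<alpha> (P, Q) (v, 0) (0, w)"
          using inv[of "map_prod g g" "(P, Q)" "(v, 0)" "(0, w)"] by simp
        moreover have "g P \<in> CC" "g Q \<in> CC" "g v \<in> T (g P)" "g w \<in> T (g Q)"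
          using g P Q v w act_mem_CC act_invariance(1)[OF g] by auto
        ultimately have "h (g P) (g Q) * (\<kappa> P v * \<kappa> Q w) = h P Q * (\<kappa> P v * \<kappa> Q w)"
          using h0[of "g P" "g Q" "g v" "g w"] h0[OF P Q v(1) w(1)]
          by (simp add: residue_form_act[OF P v(1) g] residue_form_act[OF Q w(1) g])
        then show ?thesis using v(2) w(2) by simp
      qed
      then show ?thesis by (simp add: diagonal_invariant_def)
    qed
    show "sections_in_first h"
      unfolding sections_in_first_def
    proof (intro ballI conjI)
      fix Q assume Q: "Q \<in> CC"
      show "C_homogeneous 2 (\<lambda>P. h P Q)"
        unfolding C_homogeneous_def
      proof (intro ballI allI impI)
        fix P and c :: complex assume P: "P \<in> CC" and c: "c \<noteq> 0"
        obtain v where v: "v \<in> T P" "\<kappa> P v \<noteq> 0" by (rule tangent_vector_exists[OF P])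
        obtain w where w: "w \<in> T Q" "\<kappa> Q w \<noteq> 0" by (rule tangent_vector_exists[OF Q])
        have "\<alpha> (scale2 c 1 (P, Q)) (scale2 c 1 (v, 0)) (scale2 c 1 (0, w)) = \<alpha> (P, Q) (v, 0) (0, w)"
          using desc c unfolding descends_def by (metis zero_neq_one)
        then have "\<alpha> (c *s P, Q) (c *s v, 0) (0, w) = \<alpha> (P, Q) (v, 0) (0, w)" by (simp add: scale2_Pair)
        then have "h (c *s P) Q * (\<kappa> P v / c\<^sup>2 * \<kappa> Q w) = h P Q * (\<kappa> P v * \<kappa> Q w)"
          using h0[OF scale_mem_CC[OF P c] Q _ w(1), of "c *s v"] h0[OF P Q v(1) w(1)] T_scale_point(1)[OF c] v(1)
          by (simp add: residue_form_scale_point[OF P v(1) c])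
        then show "h (c *s P) Q = c\<^sup>2 * h P Q" using v(2) w(2) c by (simp add: field_simps)
      qed
      obtain V \<delta> t where arcQ: "immersed_arc V \<delta>" "t \<in> V" "\<delta> t = Q" by (rule immersed_arc_exists[OF Q])
      show "C_regular (\<lambda>P. h P Q)"
        unfolding C_regular_def
      proof (intro allI impI)
        fix U \<gamma> assume arc: "immersed_arc U \<gamma>"
        have arcs: "cone_arc U \<gamma>" "cone_arc V \<delta>"
          using arc arcQ(1) by (auto simp: immersed_arc_def)
        then have U: "open U" by (simp add: holomorphic_arc_def)
        let ?A = "\<lambda>(s, t). \<alpha> (\<gamma> s, \<delta> t) (velocity \<gamma> s, 0) (0, velocity \<delta> t)"
        have A: "complex_differentiable2 ?A (U \<times> V)" using hol arcs unfolding holomorphic_form_def by blast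
        \<comment> \<open>The second arc is frozen at the parameter \<open>t\<close> with
          \<open>\<delta> t = Q\<close>. Dividing this slice by the residues of both velocities
          leaves \<open>h (\<gamma> s) Q\<close>.\<close>
        have "(\<lambda>s. ?A (s, t)) holomorphic_on U"
          unfolding holomorphic_on_open[OF U]
        proof
          fix s assume "s \<in> U"
          then obtain a b where "(?A has_derivative (\<lambda>(s, t). a * s + b * t)) (at (s, t))"
            using A arcQ(2) unfolding complex_differentiable2_def by blast
          moreover have "((\<lambda>s. (s, t)) has_derivative (\<lambda>h. (h, 0))) (at s)"
            by (auto intro!: derivative_eq_intros)
          ultimately have "((\<lambda>s. ?A (s, t)) has_derivative (\<lambda>h. (\<lambda>(s, t). a * s + b * t) (h, 0))) (at s)"
            by (rule has_derivative_compose[where g = ?A and f = "\<lambda>s. (s, t)", rotated])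
          then have "((\<lambda>s. ?A (s, t)) has_derivative (\<lambda>h. a * h)) (at s)" by simp
          then show "\<exists>f'. ((\<lambda>s. ?A (s, t)) has_field_derivative f') (at s)"
            unfolding has_field_derivative_def by blast
        qed
        moreover have kQ: "\<kappa> Q (velocity \<delta> t) \<noteq> 0" using arc_residue_nonzero[OF arcQ(1,2)] arcQ(3) by simp
        have "?A (s, t) = h (\<gamma> s) Q * (\<kappa> (\<gamma> s) (velocity \<gamma> s) * \<kappa> Q (velocity \<delta> t))" if "s \<in> U" for s
          using h0[OF arc_velocity(1)[OF arcs(1) that] Q arc_velocity(2)[OF arcs(1) that], of "velocity \<delta> t"]
            arc_velocity(2)[OF arcs(2) arcQ(2)] by (simp add: arcQ(3))
        then have eq: "?A (s, t) / (\<kappa> (\<gamma> s) (velocity \<gamma> s) * \<kappa> Q (velocity \<delta> t)) = h (\<gamma> s) Q" if "s \<in> U" for s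
          using kQ arc_residue_nonzero[OF arc that] that by simp
        ultimately have "(\<lambda>s. ?A (s, t) / (\<kappa> (\<gamma> s) (velocity \<gamma> s) * \<kappa> Q (velocity \<delta> t))) holomorphic_on U"
          using kQ arc_residue_nonzero[OF arc]
          by (intro holomorphic_on_divide holomorphic_on_mult holomorphic_on_const residue_form_holomorphic[OF arcs(1)]) auto
        then show "(\<lambda>s. h (\<gamma> s) Q) holomorphic_on U" by (rule holomorphic_transform) (rule eq)
      qed
    qed
  qed
qed

section \<open>Antisymmetric pairings within one character\<close>

lemma linear_vanishing_CC:
  assumes "\<And>P. P \<in> CC \<Longrightarrow> \<alpha> * (P $ 1)\<^sup>2 + \<beta> * (P $ 2)\<^sup>2 + \<gamma> * (P $ 3)\<^sup>2 = 0"
  shows "\<alpha> = 0 \<and> \<beta> = 0 \<and> \<gamma> = 0"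
proof (rule linear_vanishing)
  fix x y w assume "cone_D x y w"
  then obtain P where "P \<in> CC" and "squares P = plane_point x y w" by (rule point_over)
  then have "(P $ 1)\<^sup>2 = x" "(P $ 2)\<^sup>2 = y" "(P $ 3)\<^sup>2 = w"
    by (simp_all add: vec_eq_iff forall_4 squares_def plane_point_nth)
  with assms[OF \<open>P \<in> CC\<close>] show "\<alpha> * x + \<beta> * y + \<gamma> * w = 0" by simp
qed

text \<open>Test points that separate the two monomials of a non-trivial character.\<close>

lemma coordinate_zero_point:
  assumes "i \<noteq> 4" obtains P where "P \<in> CC" "P $ i = 0" "\<And>j. j \<noteq> i \<Longrightarrow> P $ j \<noteq> 0"
proof -
  have "\<exists>P\<in>CC. P $ i = 0"
  proof -
    obtain w1 where 1: "cone_D 0 1 w1" by (rule point_x_zero)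
    obtain w2 where 2: "cone_D 1 0 w2" by (rule point_y_zero)
    obtain w3 where 3: "cone_D w3 1 0" by (rule point_w_zero)
    obtain P1 where P1: "P1 \<in> CC" "squares P1 = plane_point 0 1 w1" by (rule point_over[OF 1])
    obtain P2 where P2: "P2 \<in> CC" "squares P2 = plane_point 1 0 w2" by (rule point_over[OF 2])
    obtain P3 where P3: "P3 \<in> CC" "squares P3 = plane_point w3 1 0" by (rule point_over[OF 3])
    have "P1 $ 1 = 0" "P2 $ 2 = 0" "P3 $ 3 = 0"
      using P1(2) P2(2) P3(2) by (simp_all add: vec_eq_iff forall_4 squares_def plane_point_nth)
    with P1(1) P2(1) P3(1) assms exhaust_4[of i] show ?thesis by blast
  qed
  then show ?thesis using that zero_coordinate_unique by metis
qed

text \<open>For fixed \<open>Q\<close> the pairing is linear in the squares of \<open>P\<close>. Its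
  coefficients are combinations of the values at three non-collinear points \<open>A\<close>,
  \<open>B\<close>, \<open>E\<close>, hence linear in the squares of \<open>Q\<close>. So
  \<open>K\<close> is given by a 3 by 3 matrix, and this matrix is skew.\<close>

lemma invariant_pairing:
  assumes K: "sections_in_first K" "antisymmetric K"
    and chr: "\<And>Q. Q \<in> CC \<Longrightarrow> character 1 1 (\<lambda>P. K P Q)"
  obtains c12 c13 c23 where
    "\<And>P Q. P \<in> CC \<Longrightarrow> Q \<in> CC \<Longrightarrow> K P Q = c12 * eta12 P Q + c13 * eta13 P Q + c23 * eta23 P Q"
proof -
  define lin where "lin L \<longleftrightarrow> (\<exists>\<alpha> \<beta> \<gamma>. \<forall>P\<in>CC. L P = \<alpha> * (P $ 1)\<^sup>2 + \<beta> * (P $ 2)\<^sup>2 + \<gamma> * (P $ 3)\<^sup>2)"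
    for L :: "complex ^ 4 \<Rightarrow> complex"
  have lin_comb: "lin (\<lambda>P. c * L P + d * L' P)" if "lin L" "lin L'" for c d L L'
  proof -
    obtain a b g a' b' g' where
      "\<And>P. P \<in> CC \<Longrightarrow> L P = a * (P $ 1)\<^sup>2 + b * (P $ 2)\<^sup>2 + g * (P $ 3)\<^sup>2"
      "\<And>P. P \<in> CC \<Longrightarrow> L' P = a' * (P $ 1)\<^sup>2 + b' * (P $ 2)\<^sup>2 + g' * (P $ 3)\<^sup>2"
      using \<open>lin L\<close> \<open>lin L'\<close> unfolding lin_def by blast
    then show ?thesis unfolding lin_def
      by (intro exI[of _ "c * a + d * a'"] exI[of _ "c * b + d * b'"] exI[of _ "c * g + d * g'"])
        (simp add: algebra_simps)
  qed
  have lin_first: "lin (\<lambda>P. K P Q)" if Q: "Q \<in> CC" for Q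
    unfolding lin_def
    by (rule invariant_section[of "\<lambda>P. K P Q"])
      (use K(1) chr Q in \<open>auto simp: sections_in_first_def\<close>)
  have anti: "K P Q = - 1 * K Q P + 0 * K Q P" if "P \<in> CC" "Q \<in> CC" for P Q
  proof -
    have "K P Q = - K Q P" using K(2) that unfolding antisymmetric_def by blast
    then show ?thesis by (simp only: mult_minus1 mult_zero_left add_0_right)
  qed
  have lin_second: "lin (K P)" if P: "P \<in> CC" for P
    using lin_comb[OF lin_first[OF P] lin_first[OF P], of "-1" 0] anti[OF P] unfolding lin_def by simp
  have "\<forall>Q\<in>CC. \<exists>t. \<forall>P\<in>CC. K P Q = t 1 * (P $ 1)\<^sup>2 + t 2 * (P $ 2)\<^sup>2 + t (3::4) * (P $ 3)\<^sup>2"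
  proof
    fix Q assume "Q \<in> CC"
    then obtain a b g where "\<forall>P\<in>CC. K P Q = a * (P $ 1)\<^sup>2 + b * (P $ 2)\<^sup>2 + g * (P $ 3)\<^sup>2"
      using lin_first unfolding lin_def by blast
    then show "\<exists>t. \<forall>P\<in>CC. K P Q = t 1 * (P $ 1)\<^sup>2 + t 2 * (P $ 2)\<^sup>2 + t (3::4) * (P $ 3)\<^sup>2"
      by (intro exI[of _ "($) (vector [a, b, g, 0])"]) (simp add: vector_4)
  qed
  then obtain t where t: "\<And>P Q. P \<in> CC \<Longrightarrow> Q \<in> CC \<Longrightarrow>
      K P Q = t Q 1 * (P $ 1)\<^sup>2 + t Q 2 * (P $ 2)\<^sup>2 + t Q (3::4) * (P $ 3)\<^sup>2"
    unfolding bchoice_iff by blast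
  obtain x1 x2 w1 w2 w3 where pts: "x1 \<noteq> x2" "w1 \<noteq> w2" "cone_D x1 1 w1" "cone_D x1 1 w2" "cone_D x2 1 w3"
    by (rule noncollinear_points)
  obtain A where A: "A \<in> CC" "squares A = plane_point x1 1 w1" by (rule point_over[OF pts(3)])
  obtain B where B: "B \<in> CC" "squares B = plane_point x1 1 w2" by (rule point_over[OF pts(4)])
  obtain E where E: "E \<in> CC" "squares E = plane_point x2 1 w3" by (rule point_over[OF pts(5)])
  have sq: "(A $ 1)\<^sup>2 = x1" "(A $ 2)\<^sup>2 = 1" "(A $ 3)\<^sup>2 = w1" "(B $ 1)\<^sup>2 = x1" "(B $ 2)\<^sup>2 = 1" "(B $ 3)\<^sup>2 = w2"
    "(E $ 1)\<^sup>2 = x2" "(E $ 2)\<^sup>2 = 1" "(E $ 3)\<^sup>2 = w3"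
    using A(2) B(2) E(2) by (simp_all add: vec_eq_iff forall_4 squares_def plane_point_nth)
  have lin_cong: "lin L" if "lin L'" "\<And>P. P \<in> CC \<Longrightarrow> L P = L' P" for L L'
    using that unfolding lin_def by simp
  have tA: "K A Q = t Q 1 * x1 + t Q 2 + t Q 3 * w1" and tB: "K B Q = t Q 1 * x1 + t Q 2 + t Q 3 * w2"
    and tE: "K E Q = t Q 1 * x2 + t Q 2 + t Q 3 * w3" if "Q \<in> CC" for Q
    using t[OF A(1) that] t[OF B(1) that] t[OF E(1) that] by (simp_all add: sq)
  have l3: "lin (\<lambda>Q. t Q 3)"
  proof (rule lin_cong[OF lin_comb[OF lin_second[OF A(1)] lin_second[OF B(1)]]])
    fix Q assume Q: "Q \<in> CC"
    show "t Q 3 = 1 / (w1 - w2) * K A Q + - 1 / (w1 - w2) * K B Q"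
      using pts(2) by (simp add: tA[OF Q] tB[OF Q] divide_simps) (simp add: algebra_simps)
  qed
  have l1: "lin (\<lambda>Q. t Q 1)"
  proof (rule lin_cong[OF lin_comb[OF lin_comb[OF lin_second[OF A(1)] lin_second[OF E(1)]] l3]])
    fix Q assume Q: "Q \<in> CC"
    show "t Q 1 = 1 * (1 / (x1 - x2) * K A Q + - 1 / (x1 - x2) * K E Q) + - (w1 - w3) / (x1 - x2) * t Q 3"
      using pts(1) by (simp add: tA[OF Q] tE[OF Q] divide_simps) (simp add: algebra_simps)
  qed
  have l2: "lin (\<lambda>Q. t Q 2)"
  proof (rule lin_cong[OF lin_comb[OF lin_comb[OF lin_second[OF A(1)] l1] l3]])
    fix Q assume Q: "Q \<in> CC"
    show "t Q 2 = 1 * (1 * K A Q + - x1 * t Q 1) + - w1 * t Q 3"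
      by (simp add: tA[OF Q] algebra_simps)
  qed
  obtain a11 a12 a13 a21 a22 a23 a31 a32 a33 where
    m: "\<And>Q. Q \<in> CC \<Longrightarrow> t Q 1 = a11 * (Q $ 1)\<^sup>2 + a12 * (Q $ 2)\<^sup>2 + a13 * (Q $ 3)\<^sup>2"
      "\<And>Q. Q \<in> CC \<Longrightarrow> t Q 2 = a21 * (Q $ 1)\<^sup>2 + a22 * (Q $ 2)\<^sup>2 + a23 * (Q $ 3)\<^sup>2"
      "\<And>Q. Q \<in> CC \<Longrightarrow> t Q 3 = a31 * (Q $ 1)\<^sup>2 + a32 * (Q $ 2)\<^sup>2 + a33 * (Q $ 3)\<^sup>2"
    using l1 l2 l3 unfolding lin_def by blast
  \<comment> \<open>\<open>K P Q + K Q P = 0\<close> is a linear relation between the squares of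
    \<open>P\<close>, so its coefficients vanish; these are in turn linear relations between the
    squares of \<open>Q\<close>. The symmetric part of the matrix is therefore zero.\<close>
  have sym: "(2 * a11) * (Q $ 1)\<^sup>2 + (a12 + a21) * (Q $ 2)\<^sup>2 + (a13 + a31) * (Q $ 3)\<^sup>2 = 0 \<and>
      (a12 + a21) * (Q $ 1)\<^sup>2 + (2 * a22) * (Q $ 2)\<^sup>2 + (a23 + a32) * (Q $ 3)\<^sup>2 = 0 \<and>
      (a13 + a31) * (Q $ 1)\<^sup>2 + (a23 + a32) * (Q $ 2)\<^sup>2 + (2 * a33) * (Q $ 3)\<^sup>2 = 0" if Q: "Q \<in> CC" for Q
  proof (rule linear_vanishing_CC)
    fix P assume P: "P \<in> CC"
    have "K Q P = - K P Q" using K(2) P Q unfolding antisymmetric_def by blast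
    then have "K P Q + K Q P = 0" by simp
    then show "((2 * a11) * (Q $ 1)\<^sup>2 + (a12 + a21) * (Q $ 2)\<^sup>2 + (a13 + a31) * (Q $ 3)\<^sup>2) * (P $ 1)\<^sup>2 +
      ((a12 + a21) * (Q $ 1)\<^sup>2 + (2 * a22) * (Q $ 2)\<^sup>2 + (a23 + a32) * (Q $ 3)\<^sup>2) * (P $ 2)\<^sup>2 +
      ((a13 + a31) * (Q $ 1)\<^sup>2 + (a23 + a32) * (Q $ 2)\<^sup>2 + (2 * a33) * (Q $ 3)\<^sup>2) * (P $ 3)\<^sup>2 = 0"
      unfolding t[OF P Q] t[OF Q P] m[OF P] m[OF Q] by (simp add: algebra_simps)
  qed
  have "2 * a11 = 0 \<and> a12 + a21 = 0 \<and> a13 + a31 = 0" "a12 + a21 = 0 \<and> 2 * a22 = 0 \<and> a23 + a32 = 0"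
    "a13 + a31 = 0 \<and> a23 + a32 = 0 \<and> 2 * a33 = 0"
    by (rule linear_vanishing_CC, use sym in blast)+
  then have c: "a11 = 0" "a22 = 0" "a33 = 0" "a21 = - a12" "a31 = - a13" "a32 = - a23"
    by (simp_all add: eq_neg_iff_add_eq_0 add.commute)
  show ?thesis
  proof (rule that)
    fix P Q assume P: "P \<in> CC" and Q: "Q \<in> CC"
    show "K P Q = a12 * eta12 P Q + a13 * eta13 P Q + a23 * eta23 P Q"
      unfolding t[OF P Q] m[OF Q] c eta12_def eta13_def eta23_def minor2_def det_2 vector_2
      by (simp add: algebra_simps)
  qed
qed

text \<open>An antisymmetric pairing on the span of two sections is a multiple of their minor. The
  points \<open>A\<close> and \<open>B\<close>, each a zero of just one of the sections, isolate the
  coefficients.\<close>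

lemma twisted_pairing:
  assumes K: "sections_in_first K" "antisymmetric K"
    and span: "\<And>f. C_homogeneous 2 f \<Longrightarrow> C_regular f \<Longrightarrow> character \<alpha> \<beta> f \<Longrightarrow>
      \<exists>\<mu> \<nu>. \<forall>P\<in>CC. f P = \<mu> * \<phi> P + \<nu> * \<psi> P"
    and chr: "\<And>Q. Q \<in> CC \<Longrightarrow> character \<alpha> \<beta> (\<lambda>P. K P Q)"
    and A: "A \<in> CC" "\<phi> A = 0" "\<psi> A \<noteq> 0" and B: "B \<in> CC" "\<phi> B \<noteq> 0" "\<psi> B = 0"
  obtains c where "\<And>P Q. P \<in> CC \<Longrightarrow> Q \<in> CC \<Longrightarrow> K P Q = c * minor2 \<phi> \<psi> P Q"
proof -
  have "\<forall>Q\<in>CC. \<exists>t. \<forall>P\<in>CC. K P Q = fst t * \<phi> P + snd t * \<psi> P"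
  proof
    fix Q assume Q: "Q \<in> CC"
    have "\<exists>\<mu> \<nu>. \<forall>P\<in>CC. K P Q = \<mu> * \<phi> P + \<nu> * \<psi> P"
      by (rule span) (use K(1) chr Q in \<open>auto simp: sections_in_first_def\<close>)
    then obtain \<mu> \<nu> where "\<forall>P\<in>CC. K P Q = \<mu> * \<phi> P + \<nu> * \<psi> P" by blast
    then show "\<exists>t. \<forall>P\<in>CC. K P Q = fst t * \<phi> P + snd t * \<psi> P" by (intro exI[of _ "(\<mu>, \<nu>)"]) simp
  qed
  then obtain t where t: "\<And>P Q. P \<in> CC \<Longrightarrow> Q \<in> CC \<Longrightarrow> K P Q = fst (t Q) * \<phi> P + snd (t Q) * \<psi> P"
    unfolding bchoice_iff by blast
  have anti: "K P Q = - K Q P" if "P \<in> CC" "Q \<in> CC" for P Q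
    using K(2) that unfolding antisymmetric_def by blast
  have "K A A = 0" "K B B = 0" using anti[OF A(1) A(1)] anti[OF B(1) B(1)] by auto
  then have zero: "snd (t A) = 0" "fst (t B) = 0"
    using t[OF A(1) A(1)] t[OF B(1) B(1)] A B by auto
  have "snd (t Q) * \<psi> A = - (fst (t A) * \<phi> Q)" if Q: "Q \<in> CC" for Q
    using t[OF A(1) Q] t[OF Q A(1)] anti[OF A(1) Q] A zero by simp
  then have b: "snd (t Q) = - (fst (t A) / \<psi> A) * \<phi> Q" if Q: "Q \<in> CC" for Q
    using A(3) that by (simp add: field_simps)
  have "fst (t Q) * \<phi> B = - (snd (t B) * \<psi> Q)" if Q: "Q \<in> CC" for Q
    using t[OF B(1) Q] t[OF Q B(1)] anti[OF B(1) Q] B zero by simp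
  then have a: "fst (t Q) = - (snd (t B) / \<phi> B) * \<psi> Q" if Q: "Q \<in> CC" for Q
    using B(2) that by (simp add: field_simps)
  define c where "c = - (snd (t B) / \<phi> B)"
  define d where "d = - (fst (t A) / \<psi> A)"
  have Keq: "K P Q = c * \<phi> P * \<psi> Q + d * \<psi> P * \<phi> Q" if "P \<in> CC" "Q \<in> CC" for P Q
    using t[OF that] a[OF that(2)] b[OF that(2)] by (simp add: c_def d_def mult_ac)
  have "(c + d) * (\<phi> B * \<psi> A) = 0"
    using anti[OF A(1) B(1)] Keq[OF A(1) B(1)] Keq[OF B(1) A(1)] A(2) B(3) by (simp add: algebra_simps)
  then have d: "d = - c" using A(3) B(2) by (simp add: add_eq_0_iff)
  show ?thesis
  proof (rule that)
    fix P Q assume "P \<in> CC" "Q \<in> CC"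
    then show "K P Q = c * minor2 \<phi> \<psi> P Q"
      using Keq[of P Q] by (simp add: d minor2_def det_2 algebra_simps)
  qed
qed

end

section \<open>Adjunction forms\<close>

lemma complex_differentiable2_product:
  assumes "open U" "open V" "f holomorphic_on U" "g holomorphic_on V"
  shows "complex_differentiable2 (\<lambda>(s, t). f s * g t) (U \<times> V)"
  unfolding complex_differentiable2_def
proof
  fix w assume w: "w \<in> U \<times> V"
  have f: "((\<lambda>w. f (fst w)) has_derivative (\<lambda>h. deriv f (fst w) * fst h)) (at w)"
    using w assms by (intro has_derivative_compose[where g = f and f = fst])
      (auto intro!: derivative_eq_intros holomorphic_derivI[unfolded has_field_derivative_def])
  have g: "((\<lambda>w. g (snd w)) has_derivative (\<lambda>h. deriv g (snd w) * snd h)) (at w)"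
    using w assms by (intro has_derivative_compose[where g = g and f = snd])
      (auto intro!: derivative_eq_intros holomorphic_derivI[unfolded has_field_derivative_def])
  have "((\<lambda>w. f (fst w) * g (snd w)) has_derivative
      (\<lambda>(s, t). (deriv f (fst w) * g (snd w)) * s + (f (fst w) * deriv g (snd w)) * t)) (at w)"
    using has_derivative_mult[OF f g] by (rule has_derivative_eq_rhs) (auto simp: fun_eq_iff algebra_simps)
  then show "\<exists>a b. ((\<lambda>(s, t). f s * g t) has_derivative (\<lambda>(s, t). a * s + b * t)) (at w)"
    unfolding case_prod_unfold by blast
qed

lemma complex_differentiable2_linear:
  assumes "complex_differentiable2 f W" "complex_differentiable2 g W"
  shows "complex_differentiable2 (\<lambda>w. c * f w + d * g w) W"
  unfolding complex_differentiable2_def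
proof
  fix w assume "w \<in> W"
  then obtain a b a' b' where
    f: "(f has_derivative (\<lambda>(s, t). a * s + b * t)) (at w)" and
    g: "(g has_derivative (\<lambda>(s, t). a' * s + b' * t)) (at w)"
    using assms unfolding complex_differentiable2_def by blast
  have "((\<lambda>w. c * f w + d * g w) has_derivative
      (\<lambda>(s, t). (c * a + d * a') * s + (c * b + d * b') * t)) (at w)"
    using has_derivative_add[OF has_derivative_mult_right[OF f, of c] has_derivative_mult_right[OF g, of d]]
    by (rule has_derivative_eq_rhs) (auto simp: fun_eq_iff algebra_simps)
  then show "\<exists>a b. ((\<lambda>w. c * f w + d * g w) has_derivative (\<lambda>(s, t). a * s + b * t)) (at w)" by blast
qed

lemma complex_differentiable2_transform:
  assumes "complex_differentiable2 f W" "open W" "\<And>w. w \<in> W \<Longrightarrow> f w = g w"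
  shows "complex_differentiable2 g W"
  unfolding complex_differentiable2_def
proof
  fix w assume w: "w \<in> W"
  then obtain a b where "(f has_derivative (\<lambda>(s, t). a * s + b * t)) (at w)"
    using assms(1) unfolding complex_differentiable2_def by blast
  then have "(g has_derivative (\<lambda>(s, t). a * s + b * t)) (at w)"
    by (rule has_derivative_transform_within_open[OF _ assms(2) w]) (rule assms(3))
  then show "\<exists>a b. (g has_derivative (\<lambda>(s, t). a * s + b * t)) (at w)" by blast
qed

lemma minor2_eq: "minor2 A B P Q = A P * B Q - A Q * B P"
  by (simp add: minor2_def det_2)

context bitangent_cover
begin

lemma adjunction_form_cong:
  assumes "\<And>P Q. P \<in> CC \<Longrightarrow> Q \<in> CC \<Longrightarrow> B P Q = B' P Q"
  shows "adj B = adj B'"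
  using assms by (auto simp: fun_eq_iff adjunction_form_def cone2_def)

lemma adjunction_form_Pair:
  "adj B (P, Q) (u1, u2) (v1, v2) =
    (if P \<in> CC \<and> Q \<in> CC \<and> u1 \<in> T P \<and> u2 \<in> T Q \<and> v1 \<in> T P \<and> v2 \<in> T Q
     then B P Q * (\<kappa> P u1 * \<kappa> Q v2 - \<kappa> P v1 * \<kappa> Q u2) else 0)"
  by (auto simp: adjunction_form_def mem_cone2 mem_tangent2)

lemma alternating_adjunction_form: "alternating (adj B)"
  unfolding alternating_form_def
proof (intro conjI allI impI ballI)
  fix p u v assume "\<not> (p \<in> CC2 \<and> u \<in> TT p \<and>
    v \<in> TT p)"
  then show "adj B p u v = 0" by (auto simp: adjunction_form_def)
next
  fix p u u' v c assume *: "p \<in> CC2" "u \<in> TT p"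
    "u' \<in> TT p" "v \<in> TT p"
  obtain P Q u1 u2 w1 w2 v1 v2 where eq: "p = (P, Q)" "u = (u1, u2)" "u' = (w1, w2)" "v = (v1, v2)"
    by (metis prod.exhaust)
  have mem: "P \<in> CC" "Q \<in> CC" "u1 \<in> T P" "u2 \<in> T Q" "w1 \<in> T P" "w2 \<in> T Q" "v1 \<in> T P" "v2 \<in> T Q"
    using * by (auto simp: eq mem_cone2 mem_tangent2)
  show "adj B p (u + u') v =
      adj B p u v + adj B p u' v"
    using mem by (simp add: eq adjunction_form_Pair T_add residue_form_add algebra_simps)
  show "adj B p (scale2 c c u) v = c * adj B p u v"
    using mem by (simp add: eq adjunction_form_Pair scale2_Pair T_scale residue_form_scale algebra_simps)
  show "adj B p v u = - adj B p u v"
    using mem by (simp add: eq adjunction_form_Pair algebra_simps)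
qed

lemma scale_mem_CC_iff: "c \<noteq> 0 \<Longrightarrow> c *s P \<in> CC \<longleftrightarrow> P \<in> CC"
  using scale_mem_CC[of "c *s P" "1 / c"] scale_mem_CC[of P c] by auto

lemma act_mem_CC_iff: "g = act_a \<or> g = act_b \<Longrightarrow> g P \<in> CC \<longleftrightarrow> P \<in> CC"
  using act_mem_CC[of P] act_mem_CC[of "g P"] act_invariance(4)[of g P] by auto

text \<open>Bidegree (2, 2) cancels the weight -2 of the residue in each factor, and the residue
  vanishes on radial vectors.\<close>

lemma descends_adjunction_form:
  assumes B: "\<And>c d P Q. B (c *s P) (d *s Q) = c\<^sup>2 * d\<^sup>2 * B P Q"
  shows "descends (adj B)"
  unfolding descends_def
proof (intro conjI allI impI; (elim conjE)?)
  fix c d :: complex and p u v :: point2 assume c: "c \<noteq> 0" and d: "d \<noteq> 0"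
  obtain P Q u1 u2 v1 v2 where eq: "p = (P, Q)" "u = (u1, u2)" "v = (v1, v2)" by (metis prod.exhaust)
  show "adj B (scale2 c d p) (scale2 c d u) (scale2 c d v) =
      adj B p u v"
    unfolding eq scale2_Pair adjunction_form_Pair scale_mem_CC_iff[OF c] scale_mem_CC_iff[OF d]
      T_scale_point(1)[OF c] T_scale_point(1)[OF d] B
    using c d by (simp add: residue_form_scale_point divide_simps)
next
  fix a b :: complex and p v :: point2
  obtain P Q v1 v2 where eq: "p = (P, Q)" "v = (v1, v2)" by (metis prod.exhaust)
  show "adj B p (scale2 a b p) v = 0"
    by (simp add: eq scale2_Pair adjunction_form_Pair residue_form_scale self_mem_T residue_form_self)
qed

text \<open>The premises ask \<open>A\<close> and \<open>B\<close> to be holomorphic along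
  holomorphic curves, as polynomials are. The pulled back coefficient is a difference of two
  products of a function of \<open>s\<close> and a function of \<open>t\<close>.\<close>

lemma holomorphic_adjunction_minor:
  assumes A: "\<And>U \<gamma>. (\<And>i. (\<lambda>s. \<gamma> s $ i) holomorphic_on U) \<Longrightarrow> (\<lambda>s. A (\<gamma> s)) holomorphic_on U"
    and B: "\<And>U \<gamma>. (\<And>i. (\<lambda>s. \<gamma> s $ i) holomorphic_on U) \<Longrightarrow> (\<lambda>s. B (\<gamma> s)) holomorphic_on U"
  shows "holomorphic_2form (adj (minor2 A B))"
  unfolding holomorphic_form_def
proof (intro allI impI, elim conjE)
  fix U V \<gamma> \<delta>
  assume arcs: "cone_arc U \<gamma>" "cone_arc V \<delta>"
  then have UV: "open U" "open V" and comp: "\<And>i. (\<lambda>s. \<gamma> s $ i) holomorphic_on U" "\<And>i. (\<lambda>s. \<delta> s $ i) holomorphic_on V"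
    by (auto simp: holomorphic_arc_def)
  let ?k = "\<lambda>s. \<kappa> (\<gamma> s) (velocity \<gamma> s)" and ?l = "\<lambda>t. \<kappa> (\<delta> t) (velocity \<delta> t)"
  have hol: "(\<lambda>s. A (\<gamma> s) * ?k s) holomorphic_on U" "(\<lambda>s. B (\<gamma> s) * ?k s) holomorphic_on U"
    "(\<lambda>t. A (\<delta> t) * ?l t) holomorphic_on V" "(\<lambda>t. B (\<delta> t) * ?l t) holomorphic_on V"
    by (intro holomorphic_on_mult A B comp residue_form_holomorphic[OF arcs(1)] residue_form_holomorphic[OF arcs(2)])+
  have "complex_differentiable2 (\<lambda>w. 1 * (\<lambda>(s, t). (A (\<gamma> s) * ?k s) * (B (\<delta> t) * ?l t)) w +
      (- 1) * (\<lambda>(s, t). (B (\<gamma> s) * ?k s) * (A (\<delta> t) * ?l t)) w) (U \<times> V)"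
    by (intro complex_differentiable2_linear complex_differentiable2_product UV hol)
  then show "complex_differentiable2 (\<lambda>(s, t). adj (minor2 A B) (\<gamma> s, \<delta> t)
      (velocity \<gamma> s, 0) (0, velocity \<delta> t)) (U \<times> V)"
  proof (rule complex_differentiable2_transform)
    show "open (U \<times> V)" using UV by (rule open_Times)
    fix w assume "w \<in> U \<times> V"
    then obtain s t where w: "w = (s, t)" "s \<in> U" "t \<in> V" by blast
    show "1 * (\<lambda>(s, t). (A (\<gamma> s) * ?k s) * (B (\<delta> t) * ?l t)) w +
      (- 1) * (\<lambda>(s, t). (B (\<gamma> s) * ?k s) * (A (\<delta> t) * ?l t)) w =
      (\<lambda>(s, t). adj (minor2 A B) (\<gamma> s, \<delta> t)
      (velocity \<gamma> s, 0) (0, velocity \<delta> t)) w"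
      using arc_velocity[OF arcs(1) w(2)] arc_velocity[OF arcs(2) w(3)]
      by (simp add: w(1) adjunction_form_Pair zero_mem_T residue_form_zero minor2_eq algebra_simps)
  qed
qed

lemma pullback_act_adjunction_form:
  assumes g: "g = act_a \<or> g = act_b" and B: "\<And>P Q. B (g P) (g Q) = B P Q"
  shows "pullback_form (map_prod g g) (adj B) = adj B"
proof (intro ext)
  fix p u v :: point2
  obtain P Q u1 u2 v1 v2 where eq: "p = (P, Q)" "u = (u1, u2)" "v = (v1, v2)" by (metis prod.exhaust)
  show "pullback_form (map_prod g g) (adj B) p u v =
      adj B p u v"
    unfolding pullback_form_def eq map_prod_simp adjunction_form_Pair B
      act_mem_CC_iff[OF g] act_invariance(1)[OF g]
    by (auto simp: residue_form_act g)
qed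

text \<open>The sign from \<open>B\<close> cancels the sign from exchanging the two
  residues.\<close>

lemma pullback_swap_adjunction_form:
  assumes B: "\<And>P Q. B Q P = - B P Q"
  shows "pullback_form prod.swap (adj B) = adj B"
proof (intro ext)
  fix p u v :: point2
  obtain P Q u1 u2 v1 v2 where eq: "p = (P, Q)" "u = (u1, u2)" "v = (v1, v2)" by (metis prod.exhaust)
  show "pullback_form prod.swap (adj B) p u v =
      adj B p u v"
    unfolding pullback_form_def eq swap_simp adjunction_form_Pair B[of Q P]
    by (simp add: algebra_simps)
qed

lemma pullback_group:
  assumes "pullback_form (map_prod act_a act_a) \<alpha> = \<alpha>" "pullback_form (map_prod act_b act_b) \<alpha> = \<alpha>"
    "pullback_form prod.swap \<alpha> = \<alpha>" and \<sigma>: "\<sigma> \<in> group_DeltaG_Z2"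
  shows "pullback_form \<sigma> \<alpha> = \<alpha>"
proof -
  have comp: "pullback_form (\<sigma> \<circ> \<tau>) \<alpha> = \<alpha>" if "pullback_form \<sigma> \<alpha> = \<alpha>" "pullback_form \<tau> \<alpha> = \<alpha>" for \<sigma> \<tau>
  proof -
    have "pullback_form (\<sigma> \<circ> \<tau>) \<alpha> = pullback_form \<tau> (pullback_form \<sigma> \<alpha>)" by (simp add: pullback_form_def)
    with that show ?thesis by simp
  qed
  have id: "pullback_form id \<alpha> = \<alpha>" by (simp add: pullback_form_def)
  have "pullback_form (map_prod g g) \<alpha> = \<alpha>" if "g \<in> group_G" for g
    using that assms(1,2) id comp[OF assms(1,2)]
    by (auto simp: group_G_def prod.map_id0 map_prod.comp)
  then show ?thesis using \<sigma> assms(3) id comp unfolding group_DeltaG_Z2_def by blast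
qed

text \<open>\<open>\<alpha>\<close> and \<open>\<beta>\<close> are the signs by which the generators
  act on both \<open>A\<close> and \<open>B\<close>; in the minor they occur squared.\<close>

lemma adjunction_minor_mem:
  assumes A: "\<And>c P. A (c *s P) = c\<^sup>2 * A P" "\<And>U \<gamma>. (\<And>i. (\<lambda>s. \<gamma> s $ i) holomorphic_on U) \<Longrightarrow> (\<lambda>s. A (\<gamma> s)) holomorphic_on U"
    and B: "\<And>c P. B (c *s P) = c\<^sup>2 * B P" "\<And>U \<gamma>. (\<And>i. (\<lambda>s. \<gamma> s $ i) holomorphic_on U) \<Longrightarrow> (\<lambda>s. B (\<gamma> s)) holomorphic_on U"
    and sign: "\<And>P. A (act_a P) = \<alpha> * A P" "\<And>P. B (act_a P) = \<alpha> * B P"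
      "\<And>P. A (act_b P) = \<beta> * A P" "\<And>P. B (act_b P) = \<beta> * B P" "\<alpha> * \<alpha> = 1" "\<beta> * \<beta> = 1"
  shows "adj (minor2 A B) \<in> H0_omega_S q"
proof -
  have inv: "minor2 A B (act_a P) (act_a Q) = minor2 A B P Q" "minor2 A B (act_b P) (act_b Q) = minor2 A B P Q" for P Q
  proof -
    have "(\<alpha> * A P) * (\<alpha> * B Q) - (\<alpha> * A Q) * (\<alpha> * B P) = (\<alpha> * \<alpha>) * (A P * B Q - A Q * B P)"
      "(\<beta> * A P) * (\<beta> * B Q) - (\<beta> * A Q) * (\<beta> * B P) = (\<beta> * \<beta>) * (A P * B Q - A Q * B P)"
      by (simp_all add: algebra_simps)
    then show "minor2 A B (act_a P) (act_a Q) = minor2 A B P Q" "minor2 A B (act_b P) (act_b Q) = minor2 A B P Q"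
      by (simp_all add: minor2_eq sign)
  qed
  let ?\<omega> = "adj (minor2 A B)"
  have "descends ?\<omega>"
    by (rule descends_adjunction_form) (simp add: minor2_eq A(1) B(1) algebra_simps)
  moreover have "holomorphic_2form ?\<omega>"
    by (rule holomorphic_adjunction_minor[OF A(2) B(2)])
  moreover have "pullback_form \<sigma> ?\<omega> = ?\<omega>" if \<sigma>: "\<sigma> \<in> group_DeltaG_Z2" for \<sigma>
  proof (rule pullback_group[OF _ _ _ \<sigma>])
    show "pullback_form (map_prod act_a act_a) ?\<omega> = ?\<omega>" "pullback_form (map_prod act_b act_b) ?\<omega> = ?\<omega>"
      by (rule pullback_act_adjunction_form; simp add: inv)+
    show "pullback_form prod.swap ?\<omega> = ?\<omega>"
      by (rule pullback_swap_adjunction_form) (simp add: minor2_eq)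
  qed
  ultimately show ?thesis
    using alternating_adjunction_form unfolding H0_omega_S_def H0_omega_product_def by blast
qed

lemma basis_mem:
  "adj eta12 \<in> H0_omega_S q"
  "adj eta13 \<in> H0_omega_S q"
  "adj eta23 \<in> H0_omega_S q"
  "adj omega45 \<in> H0_omega_S q"
  "adj omega67 \<in> H0_omega_S q"
  "adj omega89 \<in> H0_omega_S q"
  unfolding eta12_def eta13_def eta23_def omega45_def omega67_def omega89_def
       apply (rule adjunction_minor_mem[where \<alpha> = 1 and \<beta> = 1]; auto simp: act_nth power2_eq_square intro!: holomorphic_intros)
      apply (rule adjunction_minor_mem[where \<alpha> = 1 and \<beta> = 1]; auto simp: act_nth power2_eq_square intro!: holomorphic_intros)
     apply (rule adjunction_minor_mem[where \<alpha> = 1 and \<beta> = 1]; auto simp: act_nth power2_eq_square intro!: holomorphic_intros)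
    apply (rule adjunction_minor_mem[where \<alpha> = 1 and \<beta> = "-1"]; auto simp: act_nth power2_eq_square intro!: holomorphic_intros)
   apply (rule adjunction_minor_mem[where \<alpha> = "-1" and \<beta> = 1]; auto simp: act_nth power2_eq_square intro!: holomorphic_intros)
  apply (rule adjunction_minor_mem[where \<alpha> = "-1" and \<beta> = "-1"]; auto simp: act_nth power2_eq_square intro!: holomorphic_intros)
  done

lemma subspace_H0: "forms.subspace (H0_omega_S q)"
proof -
  have lin: "form_scale c \<alpha> + form_scale d \<beta> \<in> H0_omega_S q" if \<alpha>: "\<alpha> \<in> H0_omega_S q" and \<beta>: "\<beta> \<in> H0_omega_S q" for c d \<alpha> \<beta>
  proof -
    define \<gamma> where "\<gamma> = form_scale c \<alpha> + form_scale d \<beta>"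
    have \<gamma>: "\<gamma> p u v = c * \<alpha> p u v + d * \<beta> p u v" for p u v by (simp add: \<gamma>_def form_scale_def)
    have \<alpha>': "alternating \<alpha>" "descends \<alpha>" "holomorphic_2form \<alpha>"
      "\<And>\<sigma>. \<sigma> \<in> group_DeltaG_Z2 \<Longrightarrow> pullback_form \<sigma> \<alpha> = \<alpha>"
      and \<beta>': "alternating \<beta>" "descends \<beta>" "holomorphic_2form \<beta>"
      "\<And>\<sigma>. \<sigma> \<in> group_DeltaG_Z2 \<Longrightarrow> pullback_form \<sigma> \<beta> = \<beta>"
      using \<alpha> \<beta> by (auto simp: H0_omega_S_def H0_omega_product_def)
    have "alternating \<gamma>"
      unfolding alternating_form_def
    proof (intro conjI allI impI ballI)
      fix p u v assume "\<not> (p \<in> CC2 \<and> u \<in> TT p \<and>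
        v \<in> TT p)"
      then have "\<alpha> p u v = 0" "\<beta> p u v = 0" using \<alpha>'(1) \<beta>'(1) unfolding alternating_form_def by blast+
      then show "\<gamma> p u v = 0" by (simp add: \<gamma>)
    next
      fix p u u' v k assume *: "p \<in> CC2" "u \<in> TT p"
        "u' \<in> TT p" "v \<in> TT p"
      have a: "\<alpha> p (u + u') v = \<alpha> p u v + \<alpha> p u' v" "\<alpha> p (scale2 k k u) v = k * \<alpha> p u v" "\<alpha> p v u = - \<alpha> p u v"
        using \<alpha>'(1) * unfolding alternating_form_def by blast+
      have b: "\<beta> p (u + u') v = \<beta> p u v + \<beta> p u' v" "\<beta> p (scale2 k k u) v = k * \<beta> p u v" "\<beta> p v u = - \<beta> p u v"
        using \<beta>'(1) * unfolding alternating_form_def by blast+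
      show "\<gamma> p (u + u') v = \<gamma> p u v + \<gamma> p u' v" "\<gamma> p (scale2 k k u) v = k * \<gamma> p u v" "\<gamma> p v u = - \<gamma> p u v"
        unfolding \<gamma> a b by (simp_all add: algebra_simps)
    qed
    moreover have "descends \<gamma>" using \<alpha>'(2) \<beta>'(2) unfolding descends_def \<gamma> by simp
    moreover have "holomorphic_2form \<gamma>"
      unfolding holomorphic_form_def
    proof (intro allI impI)
      fix U V \<gamma>' \<delta>
      assume "cone_arc U \<gamma>' \<and> cone_arc V \<delta>"
      then have "complex_differentiable2 (\<lambda>w. c * (\<lambda>(s, t). \<alpha> (\<gamma>' s, \<delta> t) (velocity \<gamma>' s, 0) (0, velocity \<delta> t)) w +
          d * (\<lambda>(s, t). \<beta> (\<gamma>' s, \<delta> t) (velocity \<gamma>' s, 0) (0, velocity \<delta> t)) w) (U \<times> V)"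
        using \<alpha>'(3) \<beta>'(3) unfolding holomorphic_form_def by (intro complex_differentiable2_linear) blast+
      then show "complex_differentiable2 (\<lambda>(s, t). \<gamma> (\<gamma>' s, \<delta> t) (velocity \<gamma>' s, 0) (0, velocity \<delta> t)) (U \<times> V)"
        by (simp add: \<gamma> case_prod_unfold)
    qed
    moreover have "pullback_form \<sigma> \<gamma> = \<gamma>" if "\<sigma> \<in> group_DeltaG_Z2" for \<sigma>
      using \<alpha>'(4)[OF that] \<beta>'(4)[OF that] by (simp add: pullback_form_def fun_eq_iff \<gamma>)
    ultimately have "\<gamma> \<in> H0_omega_S q" by (simp add: H0_omega_S_def H0_omega_product_def)
    then show ?thesis by (simp add: \<gamma>_def)
  qed
  have scale: "form_scale c \<alpha> + form_scale 0 \<alpha> = form_scale c \<alpha>" "form_scale 1 \<alpha> = \<alpha>" for c \<alpha>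
    by (simp_all add: fun_eq_iff form_scale_def)
  show ?thesis
    unfolding forms.subspace_def
  proof (intro conjI ballI allI)
    show "0 \<in> H0_omega_S q"
      using lin[OF basis_mem(1) basis_mem(1), of 0 0] by (simp add: form_scale_def zero_fun_def plus_fun_def)
    show "x + y \<in> H0_omega_S q" if "x \<in> H0_omega_S q" "y \<in> H0_omega_S q" for x y
      using lin[OF that, of 1 1] by (simp add: scale)
    show "form_scale c x \<in> H0_omega_S q" if "x \<in> H0_omega_S q" for c x
      using lin[OF that that, of c 0] by (simp add: scale)
  qed
qed

section \<open>Decomposition into characters\<close>

text \<open>For signs \<open>\<alpha>\<close>, \<open>\<beta>\<close> this is the projector onto the
  character in which the generators act by \<open>\<alpha>\<close> and
  \<open>\<beta>\<close>.\<close>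

definition isotypic :: "complex \<Rightarrow> complex \<Rightarrow> (complex ^ 4 \<Rightarrow> complex) \<Rightarrow> complex ^ 4 \<Rightarrow> complex" where
  "isotypic \<alpha> \<beta> f P = (f P + \<alpha> * f (act_a P) + \<beta> * f (act_b P) + \<alpha> * \<beta> * f (act_a (act_b P))) / 4"

lemma isotypic_sum:
  "f P = isotypic 1 1 f P + isotypic 1 (-1) f P + isotypic (-1) 1 f P + isotypic (-1) (-1) f P"
  by (simp add: isotypic_def field_simps)

lemma act_simps: "act_a (act_a P) = P" "act_b (act_b P) = P" "act_b (act_a P) = act_a (act_b P)"
  "act_a (c *s P) = c *s act_a P" "act_b (c *s P) = c *s act_b P"
  by (simp_all add: vec_eq_iff forall_4 act_nth)

lemma character_isotypic:
  assumes "\<alpha> * \<alpha> = 1" "\<beta> * \<beta> = 1" shows "character \<alpha> \<beta> (isotypic \<alpha> \<beta> f)"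
proof -
  have "isotypic \<alpha> \<beta> f (act_a P) = \<alpha> * isotypic \<alpha> \<beta> f P" for P
    unfolding isotypic_def act_simps times_divide_eq_right
    by (rule arg_cong[where f = "\<lambda>x. x / 4"]) (use assms(1) in algebra)
  moreover have "isotypic \<alpha> \<beta> f (act_b P) = \<beta> * isotypic \<alpha> \<beta> f P" for P
    unfolding isotypic_def act_simps times_divide_eq_right
    by (rule arg_cong[where f = "\<lambda>x. x / 4"]) (use assms(2) in algebra)
  ultimately show ?thesis by (simp add: character_def)
qed

lemma immersed_arc_act:
  assumes g: "g = act_a \<or> g = act_b" and arc: "immersed_arc U \<gamma>" shows "immersed_arc U (\<lambda>s. g (\<gamma> s))"
proof -
  have arc': "open U" "\<And>s. s \<in> U \<Longrightarrow> \<gamma> s \<in> CC" "\<And>i. (\<lambda>s. \<gamma> s $ i) holomorphic_on U"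
    and imm: "\<And>s c. s \<in> U \<Longrightarrow> velocity \<gamma> s \<noteq> c *s \<gamma> s"
    using arc by (auto simp: immersed_arc_def holomorphic_arc_def)
  have sign: "(\<exists>\<epsilon>. \<forall>P. g P $ i = \<epsilon> * P $ i)" for i
    using g exhaust_4[of i] by (elim disjE) (simp_all add: act_nth, (metis mult_1 mult_minus1)+)
  then obtain \<epsilon> where \<epsilon>: "\<And>i P. g P $ i = \<epsilon> i * P $ i" by metis
  have "velocity (\<lambda>s. g (\<gamma> s)) s = g (velocity \<gamma> s)" if "s \<in> U" for s
    using holomorphic_on_imp_differentiable_at[OF arc'(3) arc'(1) that]
    by (simp add: vec_eq_iff velocity_def \<epsilon>)
  moreover have "g (c *s P) = c *s g P" for c P using g by (auto simp: act_simps)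
  moreover have "g (g P) = P" for P using act_invariance(4)[OF g] .
  ultimately have "velocity (\<lambda>s. g (\<gamma> s)) s \<noteq> c *s g (\<gamma> s)" if "s \<in> U" for s c
    using imm[OF that, of c] that by metis
  moreover have "(\<lambda>s. g (\<gamma> s) $ i) holomorphic_on U" for i
    unfolding \<epsilon> by (intro holomorphic_intros arc'(3))
  ultimately show ?thesis
    using arc'(1,2) act_mem_CC_iff[OF g] by (auto simp: immersed_arc_def holomorphic_arc_def)
qed

lemma C_regular_act:
  assumes "g = act_a \<or> g = act_b" "C_regular f" shows "C_regular (\<lambda>P. f (g P))"
  unfolding C_regular_def
proof (intro allI impI)
  fix U \<gamma> assume "immersed_arc U \<gamma>"
  from immersed_arc_act[OF assms(1) this] show "(\<lambda>s. f (g (\<gamma> s))) holomorphic_on U"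
    using assms(2) unfolding C_regular_def by blast
qed

lemma isotypic_section:
  assumes "C_homogeneous k f" "C_regular f"
  shows "C_homogeneous k (isotypic \<alpha> \<beta> f)" "C_regular (isotypic \<alpha> \<beta> f)"
proof -
  show "C_homogeneous k (isotypic \<alpha> \<beta> f)"
    using assms(1) act_mem_CC unfolding C_homogeneous_def isotypic_def
    by (auto simp: act_simps algebra_simps)
  have reg: "C_regular (\<lambda>P. f (act_a P))" "C_regular (\<lambda>P. f (act_b P))" "C_regular (\<lambda>P. f (act_a (act_b P)))"
    using C_regular_act[of act_a f] C_regular_act[of act_b f] C_regular_act[of act_b "\<lambda>P. f (act_a P)"] assms(2)
    by simp_all
  show "C_regular (isotypic \<alpha> \<beta> f)"
    unfolding C_regular_def
  proof (intro allI impI)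
    fix U \<gamma> assume arc: "immersed_arc U \<gamma>"
    have "(\<lambda>s. f (\<gamma> s)) holomorphic_on U" "(\<lambda>s. f (act_a (\<gamma> s))) holomorphic_on U"
      "(\<lambda>s. f (act_b (\<gamma> s))) holomorphic_on U" "(\<lambda>s. f (act_a (act_b (\<gamma> s)))) holomorphic_on U"
      using assms(2) reg arc unfolding C_regular_def by blast+
    then show "(\<lambda>s. isotypic \<alpha> \<beta> f (\<gamma> s)) holomorphic_on U"
      unfolding isotypic_def by (intro holomorphic_intros) auto
  qed
qed

text \<open>The projector acts on the first variable only. As each group element \<open>g\<close> is
  an involution, diagonal invariance moves it to the other variable,
  \<open>h (g Q) P = h Q (g P)\<close>, and antisymmetry of \<open>h\<close> applies.\<close>

lemma isotypic_antisymmetric: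
  assumes "antisymmetric h" "diagonal_invariant h"
  shows "antisymmetric (\<lambda>P Q. isotypic \<alpha> \<beta> (\<lambda>P. h P Q) P)"
  unfolding antisymmetric_def
proof (intro ballI)
  fix P Q assume P: "P \<in> CC" and Q: "Q \<in> CC"
  have anti: "h Y X = - h X Y" if "X \<in> CC" "Y \<in> CC" for X Y
    using assms(1) that unfolding antisymmetric_def by blast
  have inv: "h (act_a X) (act_a Y) = h X Y" "h (act_b X) (act_b Y) = h X Y" if "X \<in> CC" "Y \<in> CC" for X Y
    using assms(2) that unfolding diagonal_invariant_def by blast+
  note mem = act_mem_CC
  have "h (act_a Q) P = - h (act_a P) Q"
    using anti[OF P mem(1)[OF Q]] inv(1)[OF P mem(1)[OF Q]] by (simp add: act_simps)
  moreover have "h (act_b Q) P = - h (act_b P) Q"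
    using anti[OF P mem(2)[OF Q]] inv(2)[OF P mem(2)[OF Q]] by (simp add: act_simps)
  moreover have "h (act_a (act_b Q)) P = - h (act_a (act_b P)) Q"
    using anti[OF P mem(1)[OF mem(2)[OF Q]]] inv(2)[OF P mem(1)[OF mem(2)[OF Q]]]
      inv(1)[OF mem(2)[OF P] mem(1)[OF Q]] act_simps(3)[of "act_b Q"]
    by (simp add: act_simps)
  ultimately have "h Q P + \<alpha> * h (act_a Q) P + \<beta> * h (act_b Q) P + \<alpha> * \<beta> * h (act_a (act_b Q)) P =
      - (h P Q + \<alpha> * h (act_a P) Q + \<beta> * h (act_b P) Q + \<alpha> * \<beta> * h (act_a (act_b P)) Q)"
    using anti[OF P Q] by simp
  then show "isotypic \<alpha> \<beta> (\<lambda>X. h X P) Q = - isotypic \<alpha> \<beta> (\<lambda>X. h X Q) P"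
    unfolding isotypic_def by (simp only: minus_divide_left)
qed

lemma isotypic_sections_in_first:
  "sections_in_first h \<Longrightarrow> sections_in_first (\<lambda>P Q. isotypic \<alpha> \<beta> (\<lambda>P. h P Q) P)"
  using isotypic_section[of 2] unfolding sections_in_first_def by simp

section \<open>Monomials spanning the non-trivial characters\<close>

lemma C_regular_monomial: "C_regular (\<lambda>P. P $ i * P $ j)"
  unfolding C_regular_def immersed_arc_def holomorphic_arc_def by (auto intro!: holomorphic_intros)

lemma C_homogeneous_monomial: "C_homogeneous 2 (\<lambda>P. P $ i * P $ j)"
  unfolding C_homogeneous_def by (simp add: power2_eq_square)

text \<open>Products of two functions with the same sign character are invariant. As the indices are
  distinct, the two monomials have product \<open>X Y Z T\<close> and no common zero on C.\<close>

lemma twisted_section_span: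
  assumes f: "C_homogeneous 2 f" "C_regular f" "character \<alpha> \<beta> f" and sign: "\<alpha> * \<alpha> = 1" "\<beta> * \<beta> = 1"
    and chr: "character \<alpha> \<beta> (\<lambda>P. P $ i * P $ j)" "character \<alpha> \<beta> (\<lambda>P. P $ k * P $ l)"
    and m: "pair_monomial m" "\<And>x y w. quad m x y w * quad m' x y w = - (x * y * w * (x + y + w))"
    and sq: "\<And>P. P \<in> CC \<Longrightarrow> (P $ i * P $ j)\<^sup>2 = quad m ((P $ 1)\<^sup>2) ((P $ 2)\<^sup>2) ((P $ 3)\<^sup>2)"
      "\<And>P. P \<in> CC \<Longrightarrow> (P $ k * P $ l)\<^sup>2 = quad m' ((P $ 1)\<^sup>2) ((P $ 2)\<^sup>2) ((P $ 3)\<^sup>2)"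
    and indices: "{i, j, k, l} = UNIV" "distinct [i, j, k, l]"
  shows "\<exists>\<mu> \<nu>. \<forall>P\<in>CC. f P = \<mu> * (P $ i * P $ j) + \<nu> * (P $ k * P $ l)"
proof -
  have prod: "character 1 1 (\<lambda>P. f P * \<theta> P)" if \<theta>: "character \<alpha> \<beta> \<theta>" for \<theta>
  proof -
    have "(\<alpha> * f P) * (\<alpha> * \<theta> P) = (\<alpha> * \<alpha>) * (f P * \<theta> P)" "(\<beta> * f P) * (\<beta> * \<theta> P) = (\<beta> * \<beta>) * (f P * \<theta> P)" for P
      by (simp_all add: mult_ac)
    then show ?thesis using f(3) \<theta> sign by (simp add: character_def)
  qed
  have "P $ i * P $ j * (P $ k * P $ l) = P $ 1 * P $ 2 * P $ 3 * P $ 4" for P :: "complex ^ 4"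
  proof -
    have "(\<Prod>x\<in>{i, j, k, l}. P $ x) = P $ i * P $ j * (P $ k * P $ l)" using indices(2) by (simp add: mult_ac)
    then show ?thesis unfolding indices(1) prod_4 by simp
  qed
  moreover have "P $ i * P $ j \<noteq> 0 \<or> P $ k * P $ l \<noteq> 0" if "P \<in> CC" for P
    using zero_coordinate_unique[OF that] indices(2) by auto
  ultimately obtain \<mu> \<nu> where "\<And>P. P \<in> CC \<Longrightarrow> f P = \<mu> * (P $ i * P $ j) + \<nu> * (P $ k * P $ l)"
    using twisted_section[OF f(1,2) prod[OF chr(1)] prod[OF chr(2)] C_homogeneous_monomial C_homogeneous_monomial
        C_regular_monomial C_regular_monomial m sq] by blast
  then show ?thesis by blast
qed

lemma pair_monomialI: "k \<in> {4, 5, 6} \<Longrightarrow> pair_monomial (\<lambda>i. if i = k then 1 else 0)"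
  unfolding pair_monomial_def by blast

lemma span_45:
  assumes "C_homogeneous 2 f" "C_regular f" "character 1 (-1) f"
  shows "\<exists>\<mu> \<nu>. \<forall>P\<in>CC. f P = \<mu> * (P $ 1 * P $ 2) + \<nu> * (P $ 3 * P $ 4)"
proof (rule twisted_section_span[OF assms])
  let ?m = "\<lambda>n::nat. if n = 4 then 1 else 0 :: complex"
  \<comment> \<open>\<open>quad ?m'\<close> is \<open>z t = - w (x + y + w)\<close>; in the next two
    lemmas it is \<open>y t\<close> and \<open>x t\<close>.\<close>
  let ?m' = "\<lambda>n::nat. if n \<in> {3, 5, 6} then - 1 else 0 :: complex"
  show "character 1 (-1) (\<lambda>P. P $ 1 * P $ 2)" "character 1 (-1) (\<lambda>P. P $ 3 * P $ 4)"
    by (simp_all add: character_def act_nth)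
  show "pair_monomial ?m" by (rule pair_monomialI) simp
  show "quad ?m x y w * quad ?m' x y w = - (x * y * w * (x + y + w))" for x y w
    by (simp add: quad_def power2_eq_square algebra_simps)
  show "(P $ 1 * P $ 2)\<^sup>2 = quad ?m ((P $ 1)\<^sup>2) ((P $ 2)\<^sup>2) ((P $ 3)\<^sup>2)" for P :: "complex ^ 4"
    by (simp add: quad_def power_mult_distrib)
  show "(P $ 3 * P $ 4)\<^sup>2 = quad ?m' ((P $ 1)\<^sup>2) ((P $ 2)\<^sup>2) ((P $ 3)\<^sup>2)" if "P \<in> CC" for P
    unfolding power_mult_distrib fourth_square[OF that] by (simp add: quad_def algebra_simps flip: power2_eq_square)
  show "{1, 2, 3, 4} = (UNIV :: 4 set)" unfolding UNIV_4 by (simp add: insert_commute)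
qed simp_all

lemma span_67:
  assumes "C_homogeneous 2 f" "C_regular f" "character (-1) 1 f"
  shows "\<exists>\<mu> \<nu>. \<forall>P\<in>CC. f P = \<mu> * (P $ 1 * P $ 3) + \<nu> * (P $ 2 * P $ 4)"
proof (rule twisted_section_span[OF assms])
  let ?m = "\<lambda>n::nat. if n = 5 then 1 else 0 :: complex"
  let ?m' = "\<lambda>n::nat. if n \<in> {2, 4, 6} then - 1 else 0 :: complex"
  show "character (-1) 1 (\<lambda>P. P $ 1 * P $ 3)" "character (-1) 1 (\<lambda>P. P $ 2 * P $ 4)"
    by (simp_all add: character_def act_nth)
  show "pair_monomial ?m" by (rule pair_monomialI) simp
  show "quad ?m x y w * quad ?m' x y w = - (x * y * w * (x + y + w))" for x y w
    by (simp add: quad_def power2_eq_square algebra_simps)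
  show "(P $ 1 * P $ 3)\<^sup>2 = quad ?m ((P $ 1)\<^sup>2) ((P $ 2)\<^sup>2) ((P $ 3)\<^sup>2)" for P :: "complex ^ 4"
    by (simp add: quad_def power_mult_distrib)
  show "(P $ 2 * P $ 4)\<^sup>2 = quad ?m' ((P $ 1)\<^sup>2) ((P $ 2)\<^sup>2) ((P $ 3)\<^sup>2)" if "P \<in> CC" for P
    unfolding power_mult_distrib fourth_square[OF that] by (simp add: quad_def algebra_simps flip: power2_eq_square)
  show "{1, 3, 2, 4} = (UNIV :: 4 set)" unfolding UNIV_4 by (simp add: insert_commute)
qed simp_all

text \<open>\<open>pair_monomial\<close> admits as first monomial only the one without
  \<open>T\<close>, so the order is opposite to that in \<open>omega89\<close>.\<close>

lemma span_98:
  assumes "C_homogeneous 2 f" "C_regular f" "character (-1) (-1) f"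
  shows "\<exists>\<mu> \<nu>. \<forall>P\<in>CC. f P = \<mu> * (P $ 2 * P $ 3) + \<nu> * (P $ 1 * P $ 4)"
proof (rule twisted_section_span[OF assms])
  let ?m = "\<lambda>n::nat. if n = 6 then 1 else 0 :: complex"
  let ?m' = "\<lambda>n::nat. if n \<in> {1, 4, 5} then - 1 else 0 :: complex"
  show "character (-1) (-1) (\<lambda>P. P $ 2 * P $ 3)" "character (-1) (-1) (\<lambda>P. P $ 1 * P $ 4)"
    by (simp_all add: character_def act_nth)
  show "pair_monomial ?m" by (rule pair_monomialI) simp
  show "quad ?m x y w * quad ?m' x y w = - (x * y * w * (x + y + w))" for x y w
    by (simp add: quad_def power2_eq_square algebra_simps)
  show "(P $ 2 * P $ 3)\<^sup>2 = quad ?m ((P $ 1)\<^sup>2) ((P $ 2)\<^sup>2) ((P $ 3)\<^sup>2)" for P :: "complex ^ 4"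
    by (simp add: quad_def power_mult_distrib)
  show "(P $ 1 * P $ 4)\<^sup>2 = quad ?m' ((P $ 1)\<^sup>2) ((P $ 2)\<^sup>2) ((P $ 3)\<^sup>2)" if "P \<in> CC" for P
    unfolding power_mult_distrib fourth_square[OF that] by (simp add: quad_def algebra_simps flip: power2_eq_square)
  show "{2, 3, 1, 4} = (UNIV :: 4 set)" unfolding UNIV_4 by (simp add: insert_commute)
qed simp_all

lemma span_89:
  assumes "C_homogeneous 2 f" "C_regular f" "character (-1) (-1) f"
  shows "\<exists>\<mu> \<nu>. \<forall>P\<in>CC. f P = \<mu> * (P $ 1 * P $ 4) + \<nu> * (P $ 2 * P $ 3)"
proof -
  obtain \<mu> \<nu> where "\<forall>P\<in>CC. f P = \<mu> * (P $ 2 * P $ 3) + \<nu> * (P $ 1 * P $ 4)"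
    using span_98[OF assms] by blast
  then show ?thesis by (intro exI[of _ \<nu>] exI[of _ \<mu>]) (simp add: add.commute)
qed

section \<open>Linear independence and span of the six pairings\<close>

definition combination :: "(nat \<Rightarrow> complex) \<Rightarrow> complex ^ 4 \<Rightarrow> complex ^ 4 \<Rightarrow> complex" where
  "combination c P Q = c 0 * eta12 P Q + c 1 * eta13 P Q + c 2 * eta23 P Q +
     c 3 * omega45 P Q + c 4 * omega67 P Q + c 5 * omega89 P Q"

text \<open>The four isotypic parts of \<open>h\<close> in the first variable are again
  antisymmetric, and each is determined by the result for its character.\<close>

lemma pairing_combination:
  assumes h: "sections_in_first h" "antisymmetric h" "diagonal_invariant h"
  obtains c where "\<And>P Q. P \<in> CC \<Longrightarrow> Q \<in> CC \<Longrightarrow> h P Q = combination c P Q"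
proof -
  obtain A1 where A1: "A1 \<in> CC" "A1 $ 1 = 0" "\<And>j. j \<noteq> 1 \<Longrightarrow> A1 $ j \<noteq> 0"
    by (rule coordinate_zero_point[of 1]) auto
  obtain A2 where A2: "A2 \<in> CC" "A2 $ 2 = 0" "\<And>j. j \<noteq> 2 \<Longrightarrow> A2 $ j \<noteq> 0"
    by (rule coordinate_zero_point[of 2]) auto
  obtain A3 where A3: "A3 \<in> CC" "A3 $ 3 = 0" "\<And>j. j \<noteq> 3 \<Longrightarrow> A3 $ j \<noteq> 0"
    by (rule coordinate_zero_point[of 3]) auto
  define K where "K \<alpha> \<beta> P Q = isotypic \<alpha> \<beta> (\<lambda>P. h P Q) P" for \<alpha> \<beta> P Q
  have K: "sections_in_first (K \<alpha> \<beta>)" "antisymmetric (K \<alpha> \<beta>)" for \<alpha> \<beta>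
    using isotypic_sections_in_first[OF h(1)] isotypic_antisymmetric[OF h(2,3)]
    by (simp_all add: K_def[abs_def])
  have chr: "character \<alpha> \<beta> (\<lambda>P. K \<alpha> \<beta> P Q)" if "\<alpha> * \<alpha> = 1" "\<beta> * \<beta> = 1" for \<alpha> \<beta> Q
    using character_isotypic[OF that] by (simp add: K_def)
  obtain c0 c1 c2 where c012: "\<And>P Q. P \<in> CC \<Longrightarrow> Q \<in> CC \<Longrightarrow> K 1 1 P Q = c0 * eta12 P Q + c1 * eta13 P Q + c2 * eta23 P Q"
    by (rule invariant_pairing[OF K[of 1 1] chr]) auto
  \<comment> \<open>\<open>A1\<close> is a zero of \<open>X Y\<close> only and \<open>A3\<close> of
    \<open>Z T\<close> only; for the other two characters \<open>A1\<close> and \<open>A2\<close>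
    play these roles.\<close>
  obtain c3 where c3: "\<And>P Q. P \<in> CC \<Longrightarrow> Q \<in> CC \<Longrightarrow> K 1 (-1) P Q = c3 * omega45 P Q"
    unfolding omega45_def
    by (rule twisted_pairing[OF K[of 1 "-1"] span_45 chr A1(1) _ _ A3(1)]) (auto simp: A1 A3)
  obtain c4 where c4: "\<And>P Q. P \<in> CC \<Longrightarrow> Q \<in> CC \<Longrightarrow> K (-1) 1 P Q = c4 * omega67 P Q"
    unfolding omega67_def
    by (rule twisted_pairing[OF K[of "-1" 1] span_67 chr A1(1) _ _ A2(1)]) (auto simp: A1 A2)
  obtain c5 where c5: "\<And>P Q. P \<in> CC \<Longrightarrow> Q \<in> CC \<Longrightarrow> K (-1) (-1) P Q = c5 * omega89 P Q"
    unfolding omega89_def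
    by (rule twisted_pairing[OF K[of "-1" "-1"] span_89 chr A1(1) _ _ A2(1)]) (auto simp: A1 A2)
  show ?thesis
  proof (rule that[of "(!) [c0, c1, c2, c3, c4, c5]"])
    fix P Q assume "P \<in> CC" "Q \<in> CC"
    then show "h P Q = combination ((!) [c0, c1, c2, c3, c4, c5]) P Q"
      using isotypic_sum[of "\<lambda>P. h P Q" P] c012[of P Q] c3[of P Q] c4[of P Q] c5[of P Q]
      by (simp add: combination_def K_def)
  qed
qed

text \<open>The pairings are invariant under simultaneous translation of \<open>P\<close> and
  \<open>Q\<close>; translating \<open>P\<close> alone separates the four characters.\<close>

lemma combination_eq_zero:
  assumes van: "\<And>P Q. P \<in> CC \<Longrightarrow> Q \<in> CC \<Longrightarrow> combination c P Q = 0"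
  shows "c 0 = 0 \<and> c 1 = 0 \<and> c 2 = 0 \<and> c 3 = 0 \<and> c 4 = 0 \<and> c 5 = 0"
proof -
  let ?e = "\<lambda>P Q. c 0 * eta12 P Q + c 1 * eta13 P Q + c 2 * eta23 P Q"
  have parts: "?e P Q = 0 \<and> c 3 * omega45 P Q = 0 \<and> c 4 * omega67 P Q = 0 \<and> c 5 * omega89 P Q = 0"
    if P: "P \<in> CC" and Q: "Q \<in> CC" for P Q
  proof -
    have "?e P Q + c 3 * omega45 P Q + c 4 * omega67 P Q + c 5 * omega89 P Q = 0"
      using van[OF P Q] by (simp add: combination_def)
    moreover have "?e P Q + c 3 * omega45 P Q - c 4 * omega67 P Q - c 5 * omega89 P Q = 0"
      using van[OF act_mem_CC(1)[OF P] Q]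
      by (simp add: combination_def eta12_def eta13_def eta23_def omega45_def omega67_def omega89_def minor2_eq act_nth algebra_simps)
    moreover have "?e P Q - c 3 * omega45 P Q + c 4 * omega67 P Q - c 5 * omega89 P Q = 0"
      using van[OF act_mem_CC(2)[OF P] Q]
      by (simp add: combination_def eta12_def eta13_def eta23_def omega45_def omega67_def omega89_def minor2_eq act_nth algebra_simps)
    moreover have "?e P Q - c 3 * omega45 P Q - c 4 * omega67 P Q + c 5 * omega89 P Q = 0"
      using van[OF act_mem_CC(1)[OF act_mem_CC(2)[OF P]] Q]
      by (simp add: combination_def eta12_def eta13_def eta23_def omega45_def omega67_def omega89_def minor2_eq act_nth algebra_simps)
    moreover have "a = 0 \<and> b = 0 \<and> d = 0 \<and> e = 0"
      if "a + b + d + e = 0" "a + b - d - e = 0" "a - b + d - e = 0" "a - b - d + e = 0" for a b d e :: complex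
      using that by algebra
    ultimately show ?thesis by blast
  qed
  obtain A1 where A1: "A1 \<in> CC" "A1 $ 1 = 0" "\<And>j. j \<noteq> 1 \<Longrightarrow> A1 $ j \<noteq> 0"
    by (rule coordinate_zero_point[of 1]) auto
  obtain A2 where A2: "A2 \<in> CC" "A2 $ 2 = 0" "\<And>j. j \<noteq> 2 \<Longrightarrow> A2 $ j \<noteq> 0"
    by (rule coordinate_zero_point[of 2]) auto
  obtain A3 where A3: "A3 \<in> CC" "A3 $ 3 = 0" "\<And>j. j \<noteq> 3 \<Longrightarrow> A3 $ j \<noteq> 0"
    by (rule coordinate_zero_point[of 3]) auto
  \<comment> \<open>The first coordinate of \<open>A1\<close> is 0, so only one of the two products
    in each minor survives.\<close>
  have "omega45 A3 A1 \<noteq> 0" "omega67 A2 A1 \<noteq> 0" "omega89 A2 A1 \<noteq> 0"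
    using A1 A2 A3 by (simp_all add: omega45_def omega67_def omega89_def minor2_eq)
  then have c345: "c 3 = 0" "c 4 = 0" "c 5 = 0"
    using parts[OF A3(1) A1(1)] parts[OF A2(1) A1(1)] by auto
  have lin: "c 0 * (Q $ 2)\<^sup>2 + c 1 * (Q $ 3)\<^sup>2 = 0 \<and> - c 0 * (Q $ 1)\<^sup>2 + c 2 * (Q $ 3)\<^sup>2 = 0 \<and>
      - c 1 * (Q $ 1)\<^sup>2 - c 2 * (Q $ 2)\<^sup>2 = 0" if Q: "Q \<in> CC" for Q
  proof (rule linear_vanishing_CC)
    fix P assume P: "P \<in> CC"
    have "?e P Q = 0" using parts[OF P Q] by blast
    then show "(c 0 * (Q $ 2)\<^sup>2 + c 1 * (Q $ 3)\<^sup>2) * (P $ 1)\<^sup>2 + (- c 0 * (Q $ 1)\<^sup>2 + c 2 * (Q $ 3)\<^sup>2) * (P $ 2)\<^sup>2 +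
      (- c 1 * (Q $ 1)\<^sup>2 - c 2 * (Q $ 2)\<^sup>2) * (P $ 3)\<^sup>2 = 0"
      by (simp add: eta12_def eta13_def eta23_def minor2_eq algebra_simps)
  qed
  have "(0::complex) = 0 \<and> c 0 = 0 \<and> c 1 = 0"
    by (rule linear_vanishing_CC) (use lin in auto)
  moreover have "- c 0 = 0 \<and> (0::complex) = 0 \<and> c 2 = 0"
    by (rule linear_vanishing_CC) (use lin in auto)
  ultimately show ?thesis using c345 by simp
qed

text \<open>Tangent vectors with non-zero residues detect the coefficient.\<close>

lemma adjunction_form_eq_zero:
  assumes 0: "adj B = 0" and P: "P \<in> CC" and Q: "Q \<in> CC"
  shows "B P Q = 0"
proof -
  obtain v where v: "v \<in> T P" "\<kappa> P v \<noteq> 0" by (rule tangent_vector_exists[OF P])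
  obtain w where w: "w \<in> T Q" "\<kappa> Q w \<noteq> 0" by (rule tangent_vector_exists[OF Q])
  have "adj B (P, Q) (v, 0) (0, w) = 0" by (simp add: 0)
  then show ?thesis using P Q v w by (simp add: adjunction_form_Pair zero_mem_T residue_form_zero)
qed

abbreviation basis :: "form2 list" where
  "basis \<equiv> map (adj) [eta12, eta13, eta23, omega45, omega67, omega89]"

lemma sum_basis: "(\<Sum>i<6. form_scale (c i) (basis ! i)) = adj (combination c)"
proof -
  have "{..<6::nat} = {0, 1, 2, 3, 4, 5}" by auto
  then show ?thesis
    by (simp add: fun_eq_iff adjunction_form_def form_scale_def combination_def algebra_simps)
qed

lemma basis_independent:
  assumes "(\<Sum>i<6. form_scale (c i) (basis ! i)) = 0" "i < 6" shows "c i = 0"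
proof -
  have "c 0 = 0 \<and> c 1 = 0 \<and> c 2 = 0 \<and> c 3 = 0 \<and> c 4 = 0 \<and> c 5 = 0"
    by (rule combination_eq_zero, rule adjunction_form_eq_zero) (use assms(1) sum_basis in auto)
  moreover have "i \<in> {0, 1, 2, 3, 4, 5}" using assms(2) by auto
  ultimately show ?thesis by auto
qed

text \<open>A repetition would be a linear relation with coefficients 1 and -1.\<close>

lemma distinct_basis: "distinct basis"
proof -
  have "i = j" if ij: "i < 6" "j < 6" "basis ! i = basis ! j" for i j
  proof (rule ccontr)
    assume "i \<noteq> j"
    define c :: "nat \<Rightarrow> complex" where "c k = (if k = i then 1 else if k = j then -1 else 0)" for k
    have "(\<Sum>k<6. form_scale (c k) (basis ! k)) = (\<Sum>k\<in>{i, j}. form_scale (c k) (basis ! k))"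
      using ij by (intro sum.mono_neutral_right) (auto simp: c_def form_scale_def zero_fun_def)
    also have "\<dots> = 0" using \<open>i \<noteq> j\<close> ij(3) by (simp add: c_def form_scale_def fun_eq_iff)
    finally have "c i = 0" using ij by (intro basis_independent) auto
    then show False by (simp add: c_def)
  qed
  then show ?thesis unfolding distinct_conv_nth by auto
qed

lemma independent_basis: "forms.independent (set basis)"
proof (rule forms.independent_if_scalars_zero)
  show "finite (set basis)" by (rule finite_set)
  fix f x assume sum: "(\<Sum>x\<in>set basis. form_scale (f x) x) = 0" and x: "x \<in> set basis"
  have len: "length basis = 6" by simp
  have "(\<Sum>x\<in>set basis. form_scale (f x) x) = (\<Sum>i<6. form_scale (f (basis ! i)) (basis ! i))"
    by (rule sum.reindex_bij_betw[OF bij_betw_nth[OF distinct_basis], symmetric]) (simp_all only: len)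
  with sum have 0: "(\<Sum>i<6. form_scale (f (basis ! i)) (basis ! i)) = 0" by (simp only:)
  obtain i where "i < 6" "basis ! i = x" using x len by (metis in_set_conv_nth)
  with basis_independent[of "\<lambda>i. f (basis ! i)" i, OF 0] show "f x = 0" by blast
qed

lemma span_basis: "forms.span (set basis) = H0_omega_S q"
proof
  show "forms.span (set basis) \<subseteq> H0_omega_S q"
    by (rule forms.span_minimal[OF _ subspace_H0]) (use basis_mem in simp)
  show "H0_omega_S q \<subseteq> forms.span (set basis)"
  proof
    fix \<alpha> assume "\<alpha> \<in> H0_omega_S q"
    then obtain h where h: "sections_in_first h" "antisymmetric h" "diagonal_invariant h"
      "\<alpha> = adj h"
      by (rule H0_coefficient)
    obtain c where "\<And>P Q. P \<in> CC \<Longrightarrow> Q \<in> CC \<Longrightarrow> h P Q = combination c P Q"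
      using pairing_combination[OF h(1-3)] by blast
    then have "\<alpha> = (\<Sum>i<6. form_scale (c i) (basis ! i))"
      unfolding h(4) sum_basis by (rule adjunction_form_cong)
    also have "\<dots> \<in> forms.span (set basis)"
    proof (rule forms.span_sum, rule forms.span_scale, rule forms.span_base, rule nth_mem)
      fix i :: nat assume "i \<in> {..<6}" then show "i < length basis" by simp
    qed
    finally show "\<alpha> \<in> forms.span (set basis)" .
  qed
qed

end

theorem mainTheorem2:
  fixes q :: "complex^4 \<Rightarrow> complex"
  assumes "quadratic_form q"
    and "smooth_complete_intersection D_linear (D_quartic q)"
  defines "basis \<equiv> map (adjunction_form C_quadric (C_quartic q))
                     [eta12, eta13, eta23, omega45, omega67, omega89]"
  shows "distinct basis \<and> forms.independent (set basis) \<and> forms.span (set basis) = H0_omega_S q"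
proof -
  obtain M :: "complex^4^4" where "\<And>P. q P = (\<Sum>i\<in>UNIV. \<Sum>j\<in>UNIV. M $ i $ j * P $ i * P $ j)"
    using assms(1) unfolding quadratic_form_def by blast
  then interpret bitangent_cover q M using assms(2) by unfold_locales
  show ?thesis
    unfolding basis_def using distinct_basis independent_basis span_basis by blast
qed

end
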